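(* Let $N\ge1$, $s\in(0,1)$, $T>0$, and $\mu_0\in\mathcal{M}^+_s$. If $u_1,u_2$ are nonnegative very weak solutions of $\partial_t u+(-\Delta)^s u=0$ in $(0,T)\times\mathbb{R}^N$ that both have initial trace $\mu_0$, then $u_1=u_2$ (almost everywhere). That is, every nonnegative very weak solution is uniquely determined by its initial trace.
   Context: $(-\Delta)^s$ denotes the fractional Laplacian on $\mathbb{R}^N$ (Fourier multiplier $|\xi|^{2s}$). The weight $\Phi$ is defined by $\Phi(x)=1$ for $|x|\le1$ and $\Phi(x)=(1+(|x|^2-1)^4)^{-(N+2s)/8}$ for $|x|\ge1$; $\mathrm{L}^1_\Phi(\mathbb{R}^N)$ is the space of $f\in \mathrm{L}^1_{loc}(\mathbb{R}^N)$ with $\int|f|\Phi\,\mathrm{d}x<\infty$. $\mathcal{M}^+_s$ is the class of nonnegative Radon measures $\mu$ on $\mathbb{R}^N$ with $\int(1+|x|)^{-(N+2s)}\,\mathrm{d}\mu(x)<\infty$. A very weak solution in $(0,T)\times\mathbb{R}^N$ is a function $u\in \mathrm{L}^1_{loc}((0,T);\mathrm{L}^1_\Phi(\mathbb{R}^N))$ such that $\int_0^T\int_{\mathbb{R}^N}u\,\partial_t\psi\,\mathrm{d}x\,\mathrm{d}t=\int_0^T\int_{\mathbb{R}^N}u\,(-\Delta)^s\psi\,\mathrm{d}x\,\mathrm{d}t$ for all nonnegative $\psi\in C_c^\infty((0,T)\times\mathbb{R}^N)$. Such $u$ has initial trace $\mu$ if $u\in \mathrm{L}^1((0,T);\mathrm{L}^1_\Phi(\mathbb{R}^N))$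 and $\lim_{t\to0^+}\int_{\mathbb{R}^N}u(t,x)\psi(x)\,\mathrm{d}x=\int\psi\,\mathrm{d}\mu$ for all $\psi\in C_0(\mathbb{R}^N)$ (limit over a.e. $t$). *)

theory Defs
  imports "HOL-Analysis.Analysis"
begin

fun iter_pderiv :: "'a::euclidean_space list \<Rightarrow> ('a \<Rightarrow> real) \<Rightarrow> 'a \<Rightarrow> real" where
  "iter_pderiv [] f = f"
| "iter_pderiv (v # vs) f = (\<lambda>x. deriv (\<lambda>h. iter_pderiv vs f (x + h *\<^sub>R v)) 0)"

definition smooth_fun :: "('a::euclidean_space \<Rightarrow> real) \<Rightarrow> bool" where
  "smooth_fun f \<longleftrightarrow>
     (\<forall>vs. set vs \<subseteq> Basis \<longrightarrow>
        continuous_on UNIV (iter_pderiv vs f) \<and>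
        (\<forall>v\<in>Basis. \<forall>x. (\<lambda>h. iter_pderiv vs f (x + h *\<^sub>R v)) differentiable (at 0)))"

definition tsupport :: "('a::topological_space \<Rightarrow> real) \<Rightarrow> 'a set" where
  "tsupport f = closure {x. f x \<noteq> 0}"

definition test_fun_on :: "'a::euclidean_space set \<Rightarrow> ('a \<Rightarrow> real) \<Rightarrow> bool" where
  "test_fun_on U f \<longleftrightarrow> smooth_fun f \<and> compact (tsupport f) \<and> tsupport f \<subseteq> U"

definition fourier :: "('a::euclidean_space \<Rightarrow> real) \<Rightarrow> 'a \<Rightarrow> complex" where
  "fourier f \<xi> = (\<integral>y. cis (- (y \<bullet> \<xi>)) * complex_of_real (f y) \<partial>lborel)"

definition frac_lap :: "real \<Rightarrow> ('a::euclidean_space \<Rightarrow> real) \<Rightarrow> 'a \<Rightarrow> real" where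
  "frac_lap s f x =
     Re ((1 / (2 * pi) ^ DIM('a)) *
         (\<integral>\<xi>. cis (x \<bullet> \<xi>) * complex_of_real (norm \<xi> powr (2 * s)) * fourier f \<xi> \<partial>lborel))"

definition Phi :: "real \<Rightarrow> 'a::euclidean_space \<Rightarrow> real" where
  "Phi s x = (if norm x \<le> 1 then 1
              else (1 + (norm x ^ 2 - 1) ^ 4) powr (- (real DIM('a) + 2 * s) / 8))"

definition L1loc_L1Phi :: "real \<Rightarrow> real \<Rightarrow> (real \<Rightarrow> 'a::euclidean_space \<Rightarrow> real) \<Rightarrow> bool" where
  "L1loc_L1Phi s T u \<longleftrightarrow>
     (\<lambda>(t, x). u t x) \<in> borel_measurable (lborel :: (real \<times> 'a) measure) \<and>
     (\<forall>a b. 0 < a \<longrightarrow> a \<le> b \<longrightarrow> b < T \<longrightarrow>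
        (\<integral>\<^sup>+ z. indicator ({a..b} \<times> UNIV) z * ennreal (\<bar>u (fst z) (snd z)\<bar> * Phi s (snd z))
           \<partial>(lborel :: (real \<times> 'a) measure)) < \<infinity>)"

definition L1_L1Phi :: "real \<Rightarrow> real \<Rightarrow> (real \<Rightarrow> 'a::euclidean_space \<Rightarrow> real) \<Rightarrow> bool" where
  "L1_L1Phi s T u \<longleftrightarrow>
     (\<lambda>(t, x). u t x) \<in> borel_measurable (lborel :: (real \<times> 'a) measure) \<and>
     (\<integral>\<^sup>+ z. indicator ({0<..<T} \<times> UNIV) z * ennreal (\<bar>u (fst z) (snd z)\<bar> * Phi s (snd z))
        \<partial>(lborel :: (real \<times> 'a) measure)) < \<infinity>"

definition very_weak_solution :: "real \<Rightarrow> real \<Rightarrow> (real \<Rightarrow> 'a::euclidean_space \<Rightarrow> real) \<Rightarrow> bool" where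
  "very_weak_solution s T u \<longleftrightarrow>
     L1loc_L1Phi s T u \<and>
     (\<forall>\<psi> :: real \<times> 'a \<Rightarrow> real.
        test_fun_on ({0<..<T} \<times> UNIV) \<psi> \<longrightarrow> (\<forall>z. 0 \<le> \<psi> z) \<longrightarrow>
        (\<integral>z. u (fst z) (snd z) * deriv (\<lambda>t. \<psi> (t, snd z)) (fst z) \<partial>lborel)
        = (\<integral>z. u (fst z) (snd z) * frac_lap s (\<lambda>y. \<psi> (fst z, y)) (snd z) \<partial>lborel))"

definition Mplus_s :: "real \<Rightarrow> 'a::euclidean_space measure \<Rightarrow> bool" where
  "Mplus_s s \<mu> \<longleftrightarrow>
     sets \<mu> = sets borel \<and>
     (\<forall>K. compact K \<longrightarrow> emeasure \<mu> K < \<infinity>) \<and>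
     (\<integral>\<^sup>+ x. ennreal ((1 + norm x) powr (- (real DIM('a) + 2 * s))) \<partial>\<mu>) < \<infinity>"

definition has_initial_trace ::
    "real \<Rightarrow> real \<Rightarrow> (real \<Rightarrow> 'a::euclidean_space \<Rightarrow> real) \<Rightarrow> 'a measure \<Rightarrow> bool" where
  "has_initial_trace s T u \<mu> \<longleftrightarrow>
     L1_L1Phi s T u \<and>
     (\<forall>\<psi> :: 'a \<Rightarrow> real. continuous_on UNIV \<psi> \<longrightarrow> compact (tsupport \<psi>) \<longrightarrow>
        (\<exists>E. E \<in> null_sets lborel \<and>
           ((\<lambda>t. \<integral>x. u t x * \<psi> x \<partial>lborel) \<longlongrightarrow> (\<integral>x. \<psi> x \<partial>\<mu>))
             (at 0 within ({0<..} - E))))"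

end

theory Submission
  imports Defs "HOL-Probability.Probability"
begin

text \<open>
  Let \<^term>\<open>w = u1 - u2\<close> on \<open>(0,T)\<close>. By subordination to the Gaussian semigroup \<open>H\<close>,
  \<open>(-\<Delta>)\<^sup>s g = \<kappa> \<integral> (g - H l g) l powr (-1 - s) dl\<close> over \<open>l > 0\<close>. Cutting the integral at \<open>\<delta>\<close> gives
  \<open>K g - P g\<close> with a positive operator \<open>P\<close> and \<open>K\<close> of order \<open>\<delta> powr (-s)\<close>, up to an error of order
  \<open>\<delta> powr (1 - s)\<close>. The weight \<open>\<zeta> = \<integral> l powr (-1 - s) G l dl\<close> over \<open>l \<ge> 1\<close>, where \<open>G l\<close> is the heat
  kernel, decays like \<open>\<Phi>\<close>, and the semigroup law of \<open>G\<close> reduces \<open>P \<zeta> \<le> (K + C) \<zeta>\<close>, with \<open>C\<close>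
  independent of \<open>\<delta>\<close>, and \<open>\<zeta> * \<zeta> \<le> C \<zeta>\<close> to one-dimensional estimates in \<open>l\<close>.

  For a bump \<open>g\<close> put \<open>W(t,x) = \<integral> w(t,y) g(y - x) dy\<close>. The equation and the vanishing trace give
  \<open>W' = - K W + P W + error\<close> with \<open>W = 0\<close> at time \<open>0\<close>, so Duhamel's formula and the positivity of
  \<open>P\<close> bound \<open>\<bar>W\<bar>\<close>. For \<open>J = \<integral>\<integral> exp (- \<beta> t) \<bar>W\<bar> \<zeta>\<close> with \<open>\<beta> = C + 1\<close> Tonelli's theorem yields
  \<open>J (K + \<beta>) \<le> (K + C) J + O(\<delta> powr (1 - s))\<close>, hence \<open>J = O(\<delta> powr (1 - s))\<close>, and \<open>\<delta> \<rightarrow> 0\<close> gives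
  \<open>W = 0\<close> for all bumps, i.e. \<open>w = 0\<close>.
\<close>

section \<open>Smooth bumps and their tensor products\<close>

text \<open>Solutions are only integrable against \<Phi>, and (-\<Delta>)^s of a bump decays only
  polynomially, so the whole argument must run inside one weighted space and the weight must survive
  the operator. \<open>\<zeta>\<close> replaces \<Phi> because it is a superposition of heat
  kernels: P \<zeta> follows from the semigroup law, and \<Phi> enters only through \<zeta> \<le> C
  \<Phi>. Truncation is what admits absolute values: P has a nonnegative kernel, so |P W| \<le> P
  |W|. The unbounded K appears twice, as damping in Duhamel's formula and as the leading constant of
  P \<zeta>, and cancels; \<beta> = C + 1 leaves J (a + 1) \<le> a J + b. Subtracting a J requires J
  finite, which is the purpose of \<zeta> * \<zeta> \<le> C \<zeta>. The order \<delta> powr (1 - s)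
  of the error uses smoothness of the bump only: g - H l g = O(l). The null set in the trace depends
  on the test function, so Duhamel's formula is applied for each x separately and x is integrated
  afterwards. Bumps are products over the coordinates, like Gaussians and Fourier kernels, which
  reduces estimates in R^N to one variable; they still approximate indicators of boxes.\<close>

coinductive smooth1 :: "(real \<Rightarrow> real) \<Rightarrow> bool" where
  smooth1I: "(\<And>x. (f has_real_derivative f' x) (at x)) \<Longrightarrow> smooth1 f' \<Longrightarrow> smooth1 f"

lemma smooth1_deriv:
  assumes "smooth1 f"
  shows "(f has_real_derivative deriv f x) (at x)" "smooth1 (deriv f)"
proof -
  from assms obtain f' where f': "\<And>x. (f has_real_derivative f' x) (at x)" "smooth1 f'"
    by (cases rule: smooth1.cases) auto
  then have "deriv f = f'"
    by (auto simp: fun_eq_iff intro: DERIV_imp_deriv)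
  with f' show "(f has_real_derivative deriv f x) (at x)" "smooth1 (deriv f)"
    by auto
qed

lemma smooth1_deriv_iter: "smooth1 f \<Longrightarrow> smooth1 ((deriv ^^ n) f)"
  by (induction n) (auto intro: smooth1_deriv)

lemma smooth1_continuous: "smooth1 f \<Longrightarrow> continuous_on A f"
  by (meson DERIV_continuous_on DERIV_subset smooth1_deriv(1) top_greatest)

text \<open>Every smoothness proof below exhibits a set of functions closed under differentiation.
  The coinductive form of \<open>smooth1\<close> makes this a complete argument for all orders at
  once, with no formula for the n-th derivative.\<close>

lemma smooth1_coinduct_deriv:
  assumes "S f" "\<And>h. S h \<Longrightarrow> \<exists>h'. S h' \<and> (\<forall>x. (h has_real_derivative h' x) (at x))"
  shows "smooth1 f"
  using assms(1)
proof (coinduction arbitrary: f rule: smooth1.coinduct)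
  case (smooth1 f)
  with assms(2)[of f] show ?case by blast
qed

text \<open>The class of finite sums of products of smooth functions is closed under differentiation, which
  replaces Leibniz' formula in the coinductive proof that products are smooth.\<close>

inductive sum_of_prods :: "(real \<Rightarrow> real) \<Rightarrow> bool" where
  "smooth1 u \<Longrightarrow> smooth1 v \<Longrightarrow> sum_of_prods (\<lambda>x. u x * v x)"
| "sum_of_prods f \<Longrightarrow> sum_of_prods g \<Longrightarrow> sum_of_prods (\<lambda>x. f x + g x)"

lemma sum_of_prods_deriv:
  "sum_of_prods h \<Longrightarrow> \<exists>h'. sum_of_prods h' \<and> (\<forall>x. (h has_real_derivative h' x) (at x))"
proof (induction rule: sum_of_prods.induct)
  case (1 u v)
  have "sum_of_prods (\<lambda>x. deriv u x * v x + u x * deriv v x)"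
    by (intro sum_of_prods.intros 1 smooth1_deriv)
  moreover have "((\<lambda>x. u x * v x) has_real_derivative deriv u x * v x + u x * deriv v x) (at x)" for x
    using DERIV_mult[OF smooth1_deriv(1)[OF 1(1)] smooth1_deriv(1)[OF 1(2)], of x]
    by (simp add: mult.commute)
  ultimately show ?case by blast
next
  case (2 f g)
  then obtain f' g' where "sum_of_prods f'" "\<forall>x. (f has_real_derivative f' x) (at x)"
      "sum_of_prods g'" "\<forall>x. (g has_real_derivative g' x) (at x)"
    by auto
  then show ?case
    by (intro exI[of _ "\<lambda>x. f' x + g' x"]) (auto intro: sum_of_prods.intros DERIV_add)
qed

lemma smooth1_sum_of_prods: "sum_of_prods h \<Longrightarrow> smooth1 h"
  by (rule smooth1_coinduct_deriv[of sum_of_prods]) (auto dest: sum_of_prods_deriv)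

lemma smooth1_const: "smooth1 (\<lambda>x. c)"
  by (rule smooth1_coinduct_deriv[of "\<lambda>f. \<exists>c. f = (\<lambda>x. c)"]) (auto intro!: exI[of _ "\<lambda>x. 0"])

lemma smooth1_mult: "smooth1 u \<Longrightarrow> smooth1 v \<Longrightarrow> smooth1 (\<lambda>x. u x * v x)"
  by (rule smooth1_sum_of_prods) (rule sum_of_prods.intros(1))

lemma smooth1_add:
  assumes "smooth1 u" "smooth1 v" shows "smooth1 (\<lambda>x. u x + v x)"
proof -
  have "sum_of_prods (\<lambda>x. u x * 1 + v x * 1)"
    by (intro sum_of_prods.intros assms smooth1_const)
  then show ?thesis by (auto dest: smooth1_sum_of_prods)
qed

lemma smooth1_diff:
  assumes "smooth1 u" "smooth1 v" shows "smooth1 (\<lambda>x. u x - v x)"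
  using smooth1_add[OF assms(1) smooth1_mult[OF smooth1_const[of "-1"] assms(2)]] by simp

lemma smooth1_exp: "smooth1 (\<lambda>x. exp (k * x))"
proof (rule smooth1_coinduct_deriv[of "\<lambda>f. \<exists>c. f = (\<lambda>x. c * exp (k * x))"])
  fix h assume "\<exists>c. h = (\<lambda>x. c * exp (k * x))"
  then obtain c where c: "h = (\<lambda>x. c * exp (k * x))" by auto
  have "(h has_real_derivative (c * k) * exp (k * x)) (at x)" for x
    unfolding c by (auto intro!: derivative_eq_intros)
  then show "\<exists>h'. (\<exists>c. h' = (\<lambda>x. c * exp (k * x))) \<and> (\<forall>x. (h has_real_derivative h' x) (at x))"
    by (intro exI[of _ "\<lambda>x. (c * k) * exp (k * x)"]) blast
qed (auto intro: exI[of _ 1])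

lemma smooth1_affine:
  assumes "smooth1 f" shows "smooth1 (\<lambda>x. f (a * x + b))"
proof (rule smooth1_coinduct_deriv[of "\<lambda>h. \<exists>f c. smooth1 f \<and> h = (\<lambda>x. c * f (a * x + b))"])
  fix h assume "\<exists>f c. smooth1 f \<and> h = (\<lambda>x. c * f (a * x + b))"
  then obtain f c where f: "smooth1 f" and h: "h = (\<lambda>x. c * f (a * x + b))" by auto
  have "(h has_real_derivative (c * a) * deriv f (a * x + b)) (at x)" for x
  proof -
    have "((\<lambda>x. f (a * x + b)) has_real_derivative deriv f (a * x + b) * a) (at x)"
      by (rule DERIV_chain2[OF smooth1_deriv(1)[OF f]]) (auto intro!: derivative_eq_intros)
    from DERIV_cmult[OF this, of c] show ?thesis
      unfolding h by (simp add: ac_simps)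
  qed
  then show "\<exists>h'. (\<exists>f c. smooth1 f \<and> h' = (\<lambda>x. c * f (a * x + b)))
      \<and> (\<forall>x. (h has_real_derivative h' x) (at x))"
    using smooth1_deriv(2)[OF f]
    by (intro exI[of _ "\<lambda>x. (c * a) * deriv f (a * x + b)"]) blast
qed (use assms in \<open>auto intro!: exI[of _ f] exI[of _ 1]\<close>)

text \<open>Closed under differentiation for fixed \<open>c\<close>; letting \<open>c \<rightarrow> 0\<close> makes the bumps below converge to
  indicators of intervals.\<close>

definition flat_fun :: "real poly \<Rightarrow> real \<Rightarrow> real \<Rightarrow> real" where
  "flat_fun p c t = (if t \<le> 0 then 0 else poly p (1 / t) * exp (- (c / t)))"

lemma tendsto_poly_times_exp_0:
  assumes "c > (0::real)" shows "((\<lambda>z. poly p z * exp (- (c * z))) \<longlongrightarrow> 0) at_top"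
proof -
  have "((\<lambda>z. z ^ k * exp (- (c * z))) \<longlongrightarrow> 0) at_top" for k
  proof -
    have "((\<lambda>z. (c * z) ^ k / exp (c * z)) \<longlongrightarrow> 0) at_top"
      by (rule filterlim_compose[OF tendsto_power_div_exp_0])
        (use assms in \<open>auto intro!: filterlim_tendsto_pos_mult_at_top[OF tendsto_const] filterlim_ident\<close>)
    from tendsto_mult[OF tendsto_const[of "1 / c ^ k"] this] show ?thesis
      using assms by (simp add: power_mult_distrib exp_minus field_simps)
  qed
  then have "((\<lambda>z. \<Sum>i\<le>degree p. coeff p i * (z ^ i * exp (- (c * z)))) \<longlongrightarrow> (\<Sum>i\<le>degree p. coeff p i * 0)) at_top"
    by (intro tendsto_sum tendsto_mult tendsto_const)
  then show ?thesis
    by (simp add: poly_altdef sum_distrib_right mult.assoc)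
qed

text \<open>With z = 1 / t, differentiating p(z) e^(-c z) gives z^2 (c p - p')(z) e^(-c z): the same
  shape with a new polynomial. At t = 0 the difference quotient from the right is again of this
  shape, with polynomial z p(z), and tends to 0.\<close>

lemma flat_fun_deriv:
  assumes c: "c > 0"
  shows "(flat_fun p c has_real_derivative flat_fun (monom 1 2 * (smult c p - pderiv p)) c t) (at t)"
proof -
  consider "t < 0" | "t > 0" | "t = 0" by linarith
  then show ?thesis
  proof cases
    case 1
    have "((\<lambda>t. 0) has_real_derivative flat_fun (monom 1 2 * (smult c p - pderiv p)) c t) (at t)"
      using 1 by (simp add: flat_fun_def)
    then show ?thesis
      by (rule has_field_derivative_transform_within_open[where S = "{..<0}"])
        (use 1 in \<open>auto simp: flat_fun_def\<close>)
  next
    case 2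
    have "((\<lambda>t. poly p (1 / t) * exp (- (c / t))) has_real_derivative
        flat_fun (monom 1 2 * (smult c p - pderiv p)) c t) (at t)"
      using 2 unfolding flat_fun_def
      by (auto intro!: derivative_eq_intros poly_DERIV[THEN DERIV_chain2]
          simp: poly_monom field_simps power2_eq_square)
    then show ?thesis
      by (rule has_field_derivative_transform_within_open[where S = "{0<..}"])
        (use 2 in \<open>auto simp: flat_fun_def\<close>)
  next
    case 3
    have "((\<lambda>y. flat_fun p c y / y) \<longlongrightarrow> 0) (at_right 0)"
    proof -
      have "((\<lambda>y. poly (pCons 0 p) (inverse y) * exp (- (c * inverse y))) \<longlongrightarrow> 0) (at_right 0)"
        by (rule filterlim_compose[OF tendsto_poly_times_exp_0[OF c] filterlim_inverse_at_top_right])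
      then show ?thesis
        by (rule Lim_transform_eventually)
          (auto simp: eventually_at_filter flat_fun_def divide_inverse ac_simps)
    qed
    moreover have "((\<lambda>y. flat_fun p c y / y) \<longlongrightarrow> 0) (at_left 0)"
      by (rule Lim_transform_eventually[OF tendsto_const])
        (auto simp: eventually_at_filter flat_fun_def)
    ultimately have "((\<lambda>y. flat_fun p c y / y) \<longlongrightarrow> 0) (at 0)"
      by (simp add: filterlim_split_at)
    then show ?thesis
      using 3 by (simp add: has_field_derivative_iff flat_fun_def[of _ _ 0])
  qed
qed

lemma smooth1_flat_fun: "c > 0 \<Longrightarrow> smooth1 (flat_fun p c)"
  by (rule smooth1_coinduct_deriv[of "\<lambda>f. \<exists>p. f = flat_fun p c"]) (auto intro: flat_fun_deriv)

definition bump :: "real \<Rightarrow> real \<Rightarrow> real \<Rightarrow> real \<Rightarrow> real" where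
  "bump c a b t = flat_fun 1 c (t - a) * flat_fun 1 c (b - t)"

lemma smooth1_bump: "c > 0 \<Longrightarrow> smooth1 (bump c a b)"
  unfolding bump_def
  using smooth1_mult[OF smooth1_affine[OF smooth1_flat_fun, of c 1 1 "-a"] smooth1_affine[OF smooth1_flat_fun, of c 1 "-1" b]]
  by simp

lemma bump_nonneg: "bump c a b t \<ge> 0"
  by (simp add: bump_def flat_fun_def)

lemma bump_le_1: "c > 0 \<Longrightarrow> bump c a b t \<le> 1"
  unfolding bump_def flat_fun_def by (intro mult_le_one) auto

lemma bump_eq_0_iff: "bump c a b t = 0 \<longleftrightarrow> t \<notin> {a<..<b}"
  by (auto simp: bump_def flat_fun_def)

lemma bump_tendsto_indicator:
  "((\<lambda>n. bump (1 / real (Suc n)) a b t) \<longlonglongrightarrow> indicator {a<..<b} t)"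
proof (cases "t \<in> {a<..<b}")
  case False
  then have "bump (1 / real (Suc n)) a b t = 0" for n
    using bump_eq_0_iff by blast
  then show ?thesis using False by simp
next
  case True
  have "(\<lambda>n. exp (- ((1 / real (Suc n)) / (t - a))) * exp (- ((1 / real (Suc n)) / (b - t))))
      \<longlonglongrightarrow> exp (- (0 / (t - a))) * exp (- (0 / (b - t)))"
    using True by (intro tendsto_intros LIMSEQ_Suc[OF lim_1_over_n]) auto
  then show ?thesis using True by (simp add: bump_def flat_fun_def)
qed

section \<open>Tensor products over the coordinates\<close>

definition tensor :: "('a::euclidean_space \<Rightarrow> real \<Rightarrow> real) \<Rightarrow> 'a \<Rightarrow> real" where
  "tensor f x = (\<Prod>b\<in>Basis. f b (x \<bullet> b))"

lemma tensor_line_deriv: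
  assumes sm: "\<And>b. b \<in> Basis \<Longrightarrow> smooth1 (f b)" and v: "v \<in> Basis"
  shows "((\<lambda>h. tensor f (x + h *\<^sub>R v)) has_real_derivative
     tensor (f(v := deriv (f v))) x) (at 0)"
proof -
  have *: "tensor f (x + h *\<^sub>R v) = f v (h + x \<bullet> v) * (\<Prod>b\<in>Basis - {v}. f b (x \<bullet> b))" for h
  proof -
    have "(\<Prod>b\<in>Basis - {v}. f b ((x + h *\<^sub>R v) \<bullet> b)) = (\<Prod>b\<in>Basis - {v}. f b (x \<bullet> b))"
      using v by (intro prod.cong refl) (auto simp: inner_add_left inner_Basis)
    moreover have "(x + h *\<^sub>R v) \<bullet> v = h + x \<bullet> v"
      using v by (simp add: inner_add_left)
    ultimately show ?thesis
      unfolding tensor_def by (subst prod.remove[OF _ v]) simp_all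
  qed
  have **: "tensor (f(v := deriv (f v))) x = deriv (f v) (x \<bullet> v) * (\<Prod>b\<in>Basis - {v}. f b (x \<bullet> b))"
    unfolding tensor_def using v
    by (subst prod.remove[OF _ v]) (auto intro!: prod.cong)
  have "((\<lambda>h. f v (h + x \<bullet> v)) has_real_derivative deriv (f v) (x \<bullet> v)) (at 0)"
    using DERIV_shift[of "f v" "deriv (f v) (x \<bullet> v)" 0 "x \<bullet> v"] smooth1_deriv(1)[OF sm[OF v]] by simp
  from DERIV_cmult_right[OF this] show ?thesis unfolding * ** .
qed

lemma continuous_on_tensor:
  assumes "\<And>b. b \<in> Basis \<Longrightarrow> continuous_on UNIV (f b)"
  shows "continuous_on UNIV (tensor f)"
  unfolding tensor_def
  by (intro continuous_on_prod continuous_on_compose2[OF assms] continuous_intros) auto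

text \<open>A partial derivative along a basis vector only replaces one factor by its derivative, so
  every \<open>iter_pderiv\<close> of a tensor is a tensor of smooth factors; continuity and
  differentiability along lines are then read off.\<close>

lemma smooth_fun_tensor:
  assumes sm: "\<And>b. b \<in> Basis \<Longrightarrow> smooth1 (f b)"
  shows "smooth_fun (tensor f)"
proof -
  have "\<exists>f'. iter_pderiv vs (tensor f) = tensor f' \<and> (\<forall>b\<in>Basis. smooth1 (f' b))"
    if "set vs \<subseteq> Basis" for vs
    using that
  proof (induction vs)
    case Nil
    then show ?case using sm by auto
  next
    case (Cons v vs)
    then obtain f' where f': "iter_pderiv vs (tensor f) = tensor f'" "\<forall>b\<in>Basis. smooth1 (f' b)"
      by auto
    have v: "v \<in> Basis" using Cons.prems by auto
    have "iter_pderiv (v # vs) (tensor f) = tensor (f'(v := deriv (f' v)))"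
      by (simp add: f' fun_eq_iff)
        (use tensor_line_deriv[of f' v] f'(2) v in \<open>blast intro: DERIV_imp_deriv\<close>)
    moreover have "\<forall>b\<in>Basis. smooth1 ((f'(v := deriv (f' v))) b)"
      using f'(2) v by (auto intro: smooth1_deriv)
    ultimately show ?case by blast
  qed
  note * = this
  show ?thesis
    unfolding smooth_fun_def
  proof (intro allI impI conjI ballI)
    fix vs :: "'a list" assume "set vs \<subseteq> Basis"
    with * obtain f' where f': "iter_pderiv vs (tensor f) = tensor f'" "\<forall>b\<in>Basis. smooth1 (f' b)"
      by blast
    then show "continuous_on UNIV (iter_pderiv vs (tensor f))"
      by (auto intro: continuous_on_tensor smooth1_continuous)
    fix v x :: 'a assume v: "v \<in> Basis"
    show "(\<lambda>h. iter_pderiv vs (tensor f) (x + h *\<^sub>R v)) differentiable at 0"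
      unfolding f' real_differentiable_def
      using tensor_line_deriv[of f' v x] f'(2) v by blast
  qed
qed

lemma tensor_eq_0_outside:
  assumes "\<And>b t. b \<in> Basis \<Longrightarrow> t \<notin> {l \<bullet> b..r \<bullet> b} \<Longrightarrow> f b t = 0" "x \<notin> cbox l r"
  shows "tensor f x = 0"
  using assms by (auto simp: tensor_def mem_box intro!: prod_zero)

lemma tsupport_tensor:
  assumes "\<And>b t. b \<in> Basis \<Longrightarrow> t \<notin> {l \<bullet> b..r \<bullet> b} \<Longrightarrow> f b t = 0"
  shows "tsupport (tensor f) \<subseteq> cbox l r" "compact (tsupport (tensor f))"
proof -
  have "{x. tensor f x \<noteq> 0} \<subseteq> cbox l r"
    using tensor_eq_0_outside[of l r f] assms by blast
  then show *: "tsupport (tensor f) \<subseteq> cbox l r"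
    unfolding tsupport_def by (intro closure_minimal closed_cbox)
  then show "compact (tsupport (tensor f))"
    by (metis tsupport_def closed_closure compact_cbox compact_Int_closed inf.absorb_iff2)
qed

lemma tensor_measurable[measurable]:
  assumes "\<And>b. b \<in> Basis \<Longrightarrow> f b \<in> borel_measurable borel"
  shows "tensor f \<in> borel_measurable borel"
  unfolding tensor_def using assms by measurable

text \<open>The basis of the product space consists of (1, 0) and the vectors (0, v). Reading
  \<theta>(t) g(x) as one tensor over it gives smoothness of space-time test functions from
  \<open>smooth_fun_tensor\<close>.\<close>

lemma tensor_prod:
  fixes g :: "'a::euclidean_space \<Rightarrow> real \<Rightarrow> real"
  shows "tensor (\<lambda>b. if b = (1, 0) then \<theta> else g (snd b)) (z :: real \<times> 'a) = \<theta> (fst z) * tensor g (snd z)"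
proof -
  have B: "(Basis :: (real \<times> 'a) set) = insert (1, 0) (Pair 0 ` Basis)"
    by (auto simp: Basis_prod_def)
  have "(1, 0) \<notin> Pair (0::real) ` (Basis :: 'a set)" by auto
  then show ?thesis
    unfolding tensor_def B
    by (subst prod.insert)
      (auto simp: prod.reindex inj_on_def inner_prod_def inner_commute intro!: prod.cong)
qed

section \<open>Testing with bumps and Duhamel's formula\<close>

text \<open>Boxes form an intersection-stable generator of the Borel sets, so vanishing integrals
  spread to all Borel sets by the pi-lambda argument. The complement step needs the integral over
  the whole space, obtained from growing boxes.\<close>

lemma AE_zero_of_box_integrals:
  fixes f :: "'a::euclidean_space \<Rightarrow> real"
  assumes f: "integrable lborel f"
    and box: "\<And>a b. (\<integral>x. indicator (box a b) x * f x \<partial>lborel) = 0"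
  shows "AE x in lborel. f x = 0"
proof -
  have int: "integrable lborel (\<lambda>x. indicator A x * f x)" if "A \<in> sets borel" for A
    using integrable_mult_indicator[OF _ f, of A] that by simp
  let ?G = "range (\<lambda>(a, b). box a b :: 'a set)"
  have "Int_stable ?G"
    by (rule Int_stableI) (auto simp: box_Int_box intro: range_eqI[where x = "(x, y)" for x y])
  have UNIV0: "(\<integral>x. f x \<partial>lborel) = 0"
  proof -
    let ?B = "\<lambda>n::nat. box (- real n *\<^sub>R One) (real n *\<^sub>R One) :: 'a set"
    have "(\<lambda>n. \<integral>x. indicator (?B n) x * f x \<partial>lborel) \<longlonglongrightarrow> (\<integral>x. f x \<partial>lborel)"
    proof (rule integral_dominated_convergence[where w = "\<lambda>x. norm (f x)"])
      show "AE x in lborel. (\<lambda>n. indicator (?B n) x * f x) \<longlonglongrightarrow> f x"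
      proof (rule AE_I2)
        fix x :: 'a
        obtain N :: nat where N: "norm x < real N" using reals_Archimedean2 by blast
        have "x \<in> ?B n" if "n \<ge> N" for n
        proof -
          have "\<bar>x \<bullet> i\<bar> < real n" if "i \<in> Basis" for i
            using Basis_le_norm[OF that, of x] N \<open>n \<ge> N\<close> by linarith
          then show ?thesis by (auto simp: mem_box abs_less_iff minus_less_iff)
        qed
        then have "eventually (\<lambda>n. indicator (?B n) x * f x = f x) sequentially"
          by (auto simp: eventually_sequentially intro!: exI[of _ N])
        then show "(\<lambda>n. indicator (?B n) x * f x) \<longlonglongrightarrow> f x"
          by (rule tendsto_eventually)
      qed
    qed (use f int in \<open>auto simp: indicator_def\<close>)
    then show ?thesis using box by (simp add: LIMSEQ_const_iff)
  qed
  have "(\<integral>x. indicator A x * f x \<partial>lborel) = 0" if A: "A \<in> sets borel" for A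
  proof -
    have "A \<in> sigma_sets UNIV ?G"
      using A by (simp add: borel_eq_box)
    with \<open>Int_stable ?G\<close> subset_UNIV[of ?G, folded Pow_UNIV] show ?thesis
    proof (induction A rule: sigma_sets_induct_disjoint)
      case (compl A)
      then have "A \<in> sets borel" by (simp add: borel_eq_box)
      have "(\<integral>x. indicator (UNIV - A) x * f x \<partial>lborel) = (\<integral>x. f x - indicator A x * f x \<partial>lborel)"
        by (intro Bochner_Integration.integral_cong) (auto simp: indicator_def)
      also have "\<dots> = 0"
        using compl int[OF \<open>A \<in> sets borel\<close>] f UNIV0 by simp
      finally show ?case .
    next
      case (union A)
      then have [measurable]: "A i \<in> sets borel" for i by (auto simp: borel_eq_box)
      have "(LINT x:(\<Union>i. A i)|lborel. f x) = (\<Sum>i. (LINT x:(A i)|lborel. f x))"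
        using union(1) f
        by (intro lebesgue_integral_countable_add)
          (auto simp: disjoint_family_on_def set_integrable_def intro!: integrable_mult_indicator[OF _ f, simplified])
      then show ?case using union(3) by (simp add: set_lebesgue_integral_def)
    qed (auto simp: box)
  qed
  then have "AE x in lborel. f x = (\<lambda>x. 0) x"
    by (intro density_unique_real f) (auto simp: set_lebesgue_integral_def)
  then show ?thesis by simp
qed

lemma tensor_bump_tendsto_indicator:
  "(\<lambda>n. tensor (\<lambda>i. bump (1 / real (Suc n)) (a \<bullet> i) (b \<bullet> i)) x) \<longlonglongrightarrow> indicator (box a b) x"
proof -
  have "(\<lambda>n. tensor (\<lambda>i. bump (1 / real (Suc n)) (a \<bullet> i) (b \<bullet> i)) x) \<longlonglongrightarrow>
     (\<Prod>i\<in>Basis. indicator {a \<bullet> i<..<b \<bullet> i} (x \<bullet> i))"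
    unfolding tensor_def by (intro tendsto_prod bump_tendsto_indicator)
  also have "(\<Prod>i\<in>Basis. indicator {a \<bullet> i<..<b \<bullet> i} (x \<bullet> i)) = (indicator (box a b) x :: real)"
    by (auto simp: indicator_def mem_box prod_eq_1_iff intro!: prod_zero)
  finally show ?thesis .
qed

lemma tensor_bump_bounds:
  "c > 0 \<Longrightarrow> 0 \<le> tensor (\<lambda>i. bump c (a i) (b i)) x \<and> tensor (\<lambda>i. bump c (a i) (b i)) x \<le> 1"
  unfolding tensor_def by (auto intro!: prod_nonneg prod_le_1 bump_nonneg bump_le_1)

lemma bump_measurable[measurable]: "bump c a b \<in> borel_measurable borel"
  unfolding bump_def flat_fun_def poly_1 by measurable

text \<open>As \<open>c\<close> tends to 0 the bumps converge to box indicators, with |f| as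
  dominating function. The restriction to \<open>box l r\<close> keeps all tested bumps inside the
  region where test functions are admissible; it is compatible with the box criterion because the
  intersection of two boxes is a box.\<close>

lemma AE_zero_of_bumps:
  fixes f :: "'a::euclidean_space \<Rightarrow> real"
  assumes f: "integrable lborel f"
    and b: "\<And>c a b. c > 0 \<Longrightarrow> box a b \<subseteq> box l r \<Longrightarrow> box a b \<noteq> {} \<Longrightarrow>
      (\<integral>x. tensor (\<lambda>i. bump c (a \<bullet> i) (b \<bullet> i)) x * f x \<partial>lborel) = 0"
  shows "AE x in lborel. x \<in> box l r \<longrightarrow> f x = 0"
proof -
  have fm[measurable]: "f \<in> borel_measurable borel" using f by (simp add: borel_measurable_integrable)
  have *: "(\<integral>x. indicator (box a b) x * f x \<partial>lborel) = 0" if "box a b \<subseteq> box l r" for a b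
  proof (cases "box a b = {}")
    case False
    have "(\<lambda>n. \<integral>x. tensor (\<lambda>i. bump (1 / real (Suc n)) (a \<bullet> i) (b \<bullet> i)) x * f x \<partial>lborel)
      \<longlonglongrightarrow> (\<integral>x. indicator (box a b) x * f x \<partial>lborel)"
    proof (rule integral_dominated_convergence[where w = "\<lambda>x. norm (f x)"])
      show "AE x in lborel. norm (tensor (\<lambda>i. bump (1 / real (Suc n)) (a \<bullet> i) (b \<bullet> i)) x * f x) \<le> norm (f x)" for n
        using tensor_bump_bounds[of "1 / real (Suc n)" "\<lambda>i. a \<bullet> i" "\<lambda>i. b \<bullet> i"]
        by (intro AE_I2) (auto simp: abs_mult intro!: mult_left_le_one_le)
      show "AE x in lborel. (\<lambda>n. tensor (\<lambda>i. bump (1 / real (Suc n)) (a \<bullet> i) (b \<bullet> i)) x * f x)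
          \<longlonglongrightarrow> indicator (box a b) x * f x"
        by (intro AE_I2 tendsto_mult tensor_bump_tendsto_indicator tendsto_const)
    qed (use f in auto)
    moreover have "(\<integral>x. tensor (\<lambda>i. bump (1 / real (Suc n)) (a \<bullet> i) (b \<bullet> i)) x * f x \<partial>lborel) = 0" for n
      using b[OF _ that False, of "1 / real (Suc n)"] by simp
    ultimately show ?thesis by (simp add: LIMSEQ_const_iff)
  qed simp
  have "AE x in lborel. indicator (box l r) x * f x = 0"
  proof (rule AE_zero_of_box_integrals)
    show "integrable lborel (\<lambda>x. indicator (box l r) x * f x)"
      using integrable_mult_indicator[OF _ f, of "box l r"] by simp
    fix a b :: 'a
    obtain c d where cd: "box a b \<inter> box l r = box c d" 
      by (rule that[OF box_Int_box])
    have "(\<lambda>x. indicator (box a b) x * (indicator (box l r) x * f x)) = (\<lambda>x. indicator (box c d) x * f x)"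
      unfolding cd[symmetric] by (auto simp: indicator_def)
    with *[of c d] cd Int_lower2[of "box a b" "box l r"] show "(\<integral>x. indicator (box a b) x * (indicator (box l r) x * f x) \<partial>lborel) = 0"
      by auto
  qed
  then show ?thesis by eventually_elim (auto simp: indicator_def split: if_splits)
qed

section \<open>Distributional derivatives on a time interval\<close>

definition test1 :: "real \<Rightarrow> (real \<Rightarrow> real) \<Rightarrow> bool" where
  "test1 T \<theta> \<longleftrightarrow> smooth1 \<theta> \<and> (\<exists>a b. 0 < a \<and> a \<le> b \<and> b < T \<and> (\<forall>t. t \<notin> {a..b} \<longrightarrow> \<theta> t = 0))"

lemma smooth1_measurable: "smooth1 f \<Longrightarrow> f \<in> borel_measurable borel"
  by (intro borel_measurable_continuous_onI smooth1_continuous)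

lemma integrable_compact_support:
  fixes f :: "'a::euclidean_space \<Rightarrow> real"
  assumes "continuous_on UNIV f" "\<And>t. t \<notin> cbox a b \<Longrightarrow> f t = 0"
  shows "integrable lborel f" 
proof -
  have "set_integrable lborel (cbox a b) f"
    unfolding set_integrable_def scaleR_conv_of_real
    using borel_integrable_compact[OF compact_cbox continuous_on_subset[OF assms(1)], of a b]
    by (simp add: indicator_def if_distrib cong: if_cong)
  moreover have "(\<lambda>x. indicator (cbox a b) x *\<^sub>R f x) = f"
  proof
    show "indicator (cbox a b) x *\<^sub>R f x = f x" for x
      using assms(2)[of x] by (cases "x \<in> cbox a b") auto
  qed
  ultimately show ?thesis by (simp add: set_integrable_def)
qed

lemma bounded_compact_support:
  fixes f :: "'a::euclidean_space \<Rightarrow> real"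
  assumes "continuous_on UNIV f" "\<And>t. t \<notin> cbox a b \<Longrightarrow> f t = 0"
  shows "\<exists>M\<ge>0. \<forall>t. \<bar>f t\<bar> \<le> M"
proof -
  have "bounded (f ` cbox a b)"
    by (intro compact_imp_bounded compact_continuous_image continuous_on_subset[OF assms(1)] compact_cbox) auto
  then obtain M where "\<forall>x\<in>cbox a b. \<bar>f x\<bar> \<le> M" by (auto simp: bounded_iff)
  then show ?thesis
    by (intro exI[of _ "max M 0"]) (metis abs_zero assms(2) max.cobounded2 max.coboundedI1)
qed

lemma deriv_zero_outside:
  fixes \<theta> :: "real \<Rightarrow> real"
  assumes "\<And>t. t \<notin> {a..b} \<Longrightarrow> \<theta> t = 0" "t \<notin> {a..b}"
  shows "deriv \<theta> t = 0"
proof -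
  have "((\<lambda>t. 0) has_real_derivative 0) (at t)" by simp
  then have "(\<theta> has_real_derivative 0) (at t)"
    by (rule has_field_derivative_transform_within_open[where S = "- {a..b}"]) (use assms in \<open>auto simp: open_Compl\<close>)
  then show ?thesis by (rule DERIV_imp_deriv)
qed

lemma test1_props:
  assumes "test1 T \<theta>"
  shows "integrable lborel \<theta>" "integrable lborel (deriv \<theta>)" "\<exists>M\<ge>0. \<forall>t. \<bar>\<theta> t\<bar> \<le> M" "\<exists>M\<ge>0. \<forall>t. \<bar>deriv \<theta> t\<bar> \<le> M"
    "t \<notin> {0<..<T} \<Longrightarrow> \<theta> t = 0" "t \<notin> {0<..<T} \<Longrightarrow> deriv \<theta> t = 0"
proof -
  from assms obtain a b where ab: "smooth1 \<theta>" "0 < a" "b < T" "\<And>t. t \<notin> {a..b} \<Longrightarrow> \<theta> t = 0"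
    by (auto simp: test1_def)
  note d = deriv_zero_outside[OF ab(4)]
  show "integrable lborel \<theta>" "integrable lborel (deriv \<theta>)" "\<exists>M\<ge>0. \<forall>t. \<bar>\<theta> t\<bar> \<le> M" "\<exists>M\<ge>0. \<forall>t. \<bar>deriv \<theta> t\<bar> \<le> M"
    using ab d by (auto intro!: integrable_compact_support[of _ a b] bounded_compact_support[of _ a b] smooth1_continuous smooth1_deriv)
  show "t \<notin> {0<..<T} \<Longrightarrow> \<theta> t = 0" "t \<notin> {0<..<T} \<Longrightarrow> deriv \<theta> t = 0"
    using ab(2,3) by (auto intro!: ab(4) d)
qed

text \<open>The antiderivative is constant on both sides of [a, b]; the zero mean makes the two
  constants agree, so subtracting \<open>F a\<close> gives a function supported in the same
  interval.\<close>

lemma test1_antiderivative: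
  assumes h: "smooth1 h" and ab: "0 < a" "a \<le> b" "b < T" "\<And>t. t \<notin> {a..b} \<Longrightarrow> h t = 0"
    and int: "(\<integral>t. h t \<partial>lborel) = 0"
  shows "\<exists>\<theta>. test1 T \<theta> \<and> deriv \<theta> = h"
proof -
  obtain F where F: "\<And>x. (F has_real_derivative h x) (at x)"
    using einterval_antiderivative[of "-\<infinity>" "\<infinity>" h] smooth1_continuous[OF h, of UNIV]
    by (auto simp: has_real_derivative_iff_has_vector_derivative continuous_on_eq_continuous_at)
  have eq: "F x = F y" if "x \<le> y" "{x<..<y} \<inter> {a..b} = {}" for x y
  proof (cases "x = y")
    case False
    then have "x < y" using that by simp
    have "F y = F x"
    proof (rule DERIV_isconst_end[OF \<open>x < y\<close>])
      show "continuous_on {x..y} F"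
        by (rule DERIV_continuous_on[of _ F h]) (rule has_field_derivative_at_within[OF F])
      show "DERIV F z :> 0" if "x < z" "z < y" for z
      proof -
        have "z \<notin> {a..b}" using that \<open>{x<..<y} \<inter> {a..b} = {}\<close> by auto
        then show ?thesis using F[of z] ab(4)[of z] by simp
      qed
    qed
    then show ?thesis by simp
  qed simp
  have "(\<integral>x. h x * indicator {a..b} x \<partial>lborel) = F b - F a"
    using integral_FTC_Icc_real[of a b F h] F ab smooth1_continuous[OF h, of UNIV]
    by (auto simp: continuous_on_eq_continuous_at)
  moreover have "(\<lambda>x. h x * indicator {a..b} x) = h"
  proof
    show "h x * indicator {a..b} x = h x" for x
      using ab(4)[of x] by (cases "x \<in> {a..b}") auto
  qed
  ultimately have Fab: "F b = F a" using int by simp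
  have z: "F t - F a = 0" if "t \<notin> {a..b}" for t
  proof (cases "t < a")
    case True
    then have "F t = F a" by (intro eq) auto
    then show ?thesis by simp
  next
    case False
    then have "F b = F t" using that by (intro eq) auto
    then show ?thesis using Fab by simp
  qed
  have d: "((\<lambda>t. F t - F a) has_real_derivative h x) (at x)" for x
    using F by (auto intro!: derivative_eq_intros)
  have "test1 T (\<lambda>t. F t - F a)"
    unfolding test1_def
    using smooth1I[of "\<lambda>t. F t - F a" h, OF d h] ab z by blast
  moreover have "deriv (\<lambda>t. F t - F a) = h"
    using d by (auto simp: fun_eq_iff intro: DERIV_imp_deriv)
  ultimately show ?thesis by blast
qed

lemma bump_integral_pos:
  assumes "c > 0" "a < b" shows "(\<integral>t. bump c a b t \<partial>lborel) > 0"
proof -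
  have i: "integrable lborel (bump c a b)"
    by (rule integrable_compact_support[of _ a b]) (auto intro!: smooth1_continuous smooth1_bump assms simp: bump_eq_0_iff)
  have "(\<integral>t. bump c a b t \<partial>lborel) \<noteq> 0"
  proof
    assume "(\<integral>t. bump c a b t \<partial>lborel) = 0"
    then have "AE t in lborel. bump c a b t = 0"
      using integral_nonneg_eq_0_iff_AE[OF i] bump_nonneg by auto
    then have "AE t in lborel. t \<notin> {a<..<b}" by (simp add: bump_eq_0_iff)
    then have "emeasure lborel {a<..<b} = 0"
      by (subst (asm) AE_iff_measurable[where N = "{a<..<b}"]) auto
    then show False using assms by simp
  qed
  moreover have "(\<integral>t. bump c a b t \<partial>lborel) \<ge> 0" by (simp add: bump_nonneg)
  ultimately show ?thesis by linarith
qed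

text \<open>Du Bois-Reymond's lemma. A bump minus a multiple of the fixed \<open>b0\<close> has mean
  zero and is therefore the derivative of an admissible test function; the constant is then the
  \<open>b0\<close>-average of \<open>f\<close>.\<close>

lemma weak_derivative_zero_const:
  assumes f: "integrable lborel f" and T: "T > 0"
    and w: "\<And>\<theta>. test1 T \<theta> \<Longrightarrow> (\<integral>t. f t * deriv \<theta> t \<partial>lborel) = 0"
  shows "\<exists>k::real. AE t in lborel. t \<in> {0<..<T} \<longrightarrow> f t = k"
proof -
  define b0 where "b0 = bump 1 (T/3) (2*T/3)"
  define I0 where "I0 = (\<integral>t. b0 t \<partial>lborel)"
  define k where "k = (\<integral>t. f t * b0 t \<partial>lborel) / I0"
  have I0: "I0 > 0" unfolding I0_def b0_def using T by (intro bump_integral_pos) auto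
  have fm[measurable]: "f \<in> borel_measurable borel" using f by (simp add: borel_measurable_integrable)
  have bi: "integrable lborel (bump c a b)" if "c > 0" for c a b
    by (rule integrable_compact_support[of _ a b]) (auto intro!: smooth1_continuous smooth1_bump that simp: bump_eq_0_iff)
  have fbi: "integrable lborel (\<lambda>t. f t * bump c a b t)" if "c > 0" for c a b
    by (rule Bochner_Integration.integrable_bound[OF f])
      (auto simp: abs_mult bump_nonneg bump_le_1[OF that] intro!: mult_left_le)
  have *: "AE t in lborel. t \<in> box l r \<longrightarrow> indicator {0<..<T} t * (f t - k) = 0" if lr: "0 < l" "l < r" "r < T" for l r
  proof (rule AE_zero_of_bumps)
    show "integrable lborel (\<lambda>t. indicator {0<..<T} t * (f t - k))"
    proof -
      have "integrable lborel (\<lambda>t. indicator {0<..<T} t * f t - k * indicator {0<..<T} t)"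
        using integrable_mult_indicator[OF _ f, of "{0<..<T}"] T by auto
      then show ?thesis by (simp add: algebra_simps)
    qed
    fix c a b :: real assume c: "c > 0" and ab: "box a b \<subseteq> box l r" "box a b \<noteq> {}"
    then have ab': "a < b" "l \<le> a" "b \<le> r"
      by (auto simp: box_real greaterThanLessThan_subseteq_greaterThanLessThan)
    define I where "I = (\<integral>t. bump c a b t \<partial>lborel)"
    define h where "h = (\<lambda>t. bump c a b t - (I / I0) * b0 t)"
    have "\<exists>\<theta>. test1 T \<theta> \<and> deriv \<theta> = h"
    proof (rule test1_antiderivative[of _ "min a (T/3)" "max b (2*T/3)"])
      show "smooth1 h" unfolding h_def b0_def
        by (intro smooth1_diff smooth1_mult smooth1_const smooth1_bump c) simp
      show "h t = 0" if "t \<notin> {min a (T/3)..max b (2*T/3)}" for t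
      proof -
        have "bump c a b t = 0" "b0 t = 0" using that T ab' unfolding b0_def by (auto simp: bump_eq_0_iff)
        then show ?thesis by (simp add: h_def)
      qed
      show "(\<integral>t. h t \<partial>lborel) = 0"
        using bi[OF c, of a b] bi[of 1 "T/3" "2*T/3"] I0 unfolding h_def
        by (subst Bochner_Integration.integral_diff) (auto simp: I_def I0_def b0_def)
    qed (use lr ab' T in auto)
    then have "0 = (\<integral>t. f t * h t \<partial>lborel)" using w by metis
    also have "\<dots> = (\<integral>t. f t * bump c a b t - (I / I0) * (f t * b0 t) \<partial>lborel)"
      by (simp add: h_def algebra_simps)
    also have "\<dots> = (\<integral>t. f t * bump c a b t \<partial>lborel) - (I / I0) * (\<integral>t. f t * b0 t \<partial>lborel)"
      using fbi[OF c] fbi[of 1] unfolding b0_def by simp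
    also have "\<dots> = (\<integral>t. f t * bump c a b t \<partial>lborel) - k * I" by (simp add: k_def)
    finally have e: "(\<integral>t. f t * bump c a b t \<partial>lborel) = k * I" by simp
    have "tensor (\<lambda>i. bump c (a \<bullet> i) (b \<bullet> i)) t * (indicator {0<..<T} t * (f t - k)) = f t * bump c a b t - k * bump c a b t" for t
    proof (cases "t \<in> {0<..<T}")
      case False
      then have "bump c a b t = 0" using lr ab' by (auto simp: bump_eq_0_iff)
      then show ?thesis by (simp add: tensor_def)
    qed (simp add: tensor_def algebra_simps)
    then show "(\<integral>t. tensor (\<lambda>i. bump c (a \<bullet> i) (b \<bullet> i)) t * (indicator {0<..<T} t * (f t - k)) \<partial>lborel) = 0"
      using fbi[OF c] bi[OF c] e by (simp add: I_def)
  qed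
  \<comment> \<open>Countably many intervals exhaust (0, T); the 3 keeps them nonempty already for n
    = 0.\<close>
  have "AE t in lborel. \<forall>n::nat. t \<in> {T / (real n + 3)<..<T - T / (real n + 3)} \<longrightarrow> indicator {0<..<T} t * (f t - k) = 0"
    unfolding AE_all_countable
  proof
    fix n :: nat
    have "T / (real n + 3) \<le> T / 3" using T by (intro divide_left_mono) auto
    then have "T / (real n + 3) < T - T / (real n + 3)" using T by linarith
    from *[OF _ this] T show "AE t in lborel. t \<in> {T / (real n + 3)<..<T - T / (real n + 3)} \<longrightarrow> indicator {0<..<T} t * (f t - k) = 0"
      by (simp add: box_real)
  qed
  then have "AE t in lborel. t \<in> {0<..<T} \<longrightarrow> f t = k"
  proof eventually_elim
    case (elim t)
    show ?case
    proof
      assume t: "t \<in> {0<..<T}"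
      obtain n :: nat where n: "T / min t (T - t) < real n" using reals_Archimedean2 by blast
      then have "T / min t (T - t) < real n + 3" by simp
      then have "T / (real n + 3) < min t (T - t)"
        using t by (subst (asm) pos_divide_less_eq, force) (subst pos_divide_less_eq, auto simp: mult.commute)
      then have "t \<in> {T / (real n + 3)<..<T - T / (real n + 3)}" by auto
      with elim t show "f t = k" by auto
    qed
  qed
  then show ?thesis by blast
qed

text \<open>The hypothesis \<open>w\<close> says f' = - K f + q in the sense of distributions.
  Multiplying by e^(K t) removes the damping: \<open>e f\<close> and the primitive \<open>qt\<close>
  of \<open>e q\<close> have the same derivative, hence differ by a constant, and the limit at 0
  forces this constant to vanish.\<close>

lemma duhamel_bound:
  fixes f q :: "real \<Rightarrow> real"
  assumes f: "integrable lborel f" and q: "integrable lborel q" and T: "T > 0"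
    and E: "E \<in> null_sets lborel"
    and w: "\<And>\<theta>. test1 T \<theta> \<Longrightarrow>
      (\<integral>t. f t * deriv \<theta> t \<partial>lborel) = (\<integral>t. (K * f t - q t) * \<theta> t \<partial>lborel)"
    and lim: "(f \<longlongrightarrow> 0) (at 0 within ({0<..} - E))"
  shows "AE t in lborel. t \<in> {0<..<T} \<longrightarrow>
    ennreal \<bar>f t\<bar> \<le> (\<integral>\<^sup>+r. indicator {0<..<t} r * ennreal (exp (- (K * (t - r))) * \<bar>q r\<bar>) \<partial>lborel)"
proof -
  have [measurable]: "f \<in> borel_measurable borel" "q \<in> borel_measurable borel"
    using f q by (simp_all add: borel_measurable_integrable)
  \<comment> \<open>Cut off outside (0, T): exp (K t) is unbounded on the line, while
    \<open>f\<close> and \<open>q\<close> are merely integrable. Test functions do not see the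
    cut.\<close>
  define e where "e = (\<lambda>t. indicator {0<..<T} t * exp (K * t) :: real)"
  have [measurable]: "e \<in> borel_measurable borel" unfolding e_def by measurable
  have e_bound: "\<bar>e t\<bar> \<le> exp (\<bar>K\<bar> * T)" for t
  proof (cases "t \<in> {0<..<T}")
    case True
    then have "K * t \<le> \<bar>K\<bar> * T" by (intro mult_mono) auto
    then show ?thesis using True by (simp add: e_def)
  qed (simp add: e_def)
  have ei: "integrable lborel (\<lambda>t. e t * g t)" if g: "integrable lborel g" for g :: "real \<Rightarrow> real"
  proof (rule Bochner_Integration.integrable_bound[where f = "\<lambda>t. exp (\<bar>K\<bar> * T) * g t"])
    show "AE t in lborel. norm (e t * g t) \<le> norm (exp (\<bar>K\<bar> * T) * g t)"
      using e_bound by (auto simp: abs_mult intro!: mult_right_mono)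
  qed (use g in \<open>auto simp: borel_measurable_integrable\<close>)
  define qt where "qt = (\<lambda>t. \<integral>r. indicator {..t} r * (e r * q r) \<partial>lborel)"
  have qi: "integrable lborel (\<lambda>r. indicator {..t} r * (e r * q r))" for t
    using integrable_mult_indicator[OF _ ei[OF q], of "{..t}"] by simp
  have ind: "indicator {..t} r = (if r \<le> t then 1 else 0 :: real)" for t r :: real
    by (simp add: indicator_def)
  have [measurable]: "qt \<in> borel_measurable borel"
    unfolding qt_def ind by measurable
  have qt_bound: "\<bar>qt t\<bar> \<le> (\<integral>r. \<bar>e r * q r\<bar> \<partial>lborel)" for t
    unfolding qt_def
    by (rule Bochner_Integration.integral_abs_bound_integral) (use qi ei[OF q] in \<open>auto simp: indicator_def\<close>)
  define d where "d = (\<lambda>t. e t * f t - indicator {0<..<T} t * qt t)"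
  have qti: "integrable lborel (\<lambda>t. indicator {0<..<T} t * qt t)"
  proof (rule Bochner_Integration.integrable_bound[where f = "\<lambda>t. indicator {0<..<T} t * (\<integral>r. \<bar>e r * q r\<bar> \<partial>lborel)"])
    show "AE t in lborel. norm (indicator {0<..<T} t * qt t) \<le> norm (indicator {0<..<T} t * (\<integral>r. \<bar>e r * q r\<bar> \<partial>lborel))"
      using qt_bound by (auto simp: indicator_def)
  qed (use T in auto)
  have di: "integrable lborel d"
    unfolding d_def using ei[OF f] qti by auto
  have "\<exists>k. AE t in lborel. t \<in> {0<..<T} \<longrightarrow> d t = k"
  proof (rule weak_derivative_zero_const[OF di T])
    fix \<theta> assume th: "test1 T \<theta>"
    note thp = test1_props[OF th]
    have sm: "smooth1 \<theta>" using th by (simp add: test1_def)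
    note [measurable] = smooth1_measurable[OF sm] smooth1_measurable[OF smooth1_deriv(2)[OF sm]]
    obtain M where M: "M \<ge> 0" "\<And>t. \<bar>\<theta> t\<bar> \<le> M" using thp(3) by blast
    obtain M' where M': "M' \<ge> 0" "\<And>t. \<bar>deriv \<theta> t\<bar> \<le> M'" using thp(4) by blast
    have bi: "integrable lborel (\<lambda>t. g t * h t)" if "integrable lborel g" "h \<in> borel_measurable borel" "\<And>t. \<bar>h t\<bar> \<le> C"
      for g h :: "real \<Rightarrow> real" and C
    proof (rule Bochner_Integration.integrable_bound[where f = "\<lambda>t. g t * C"])
      have "C \<ge> 0" using that(3)[of 0] by linarith
      then show "AE t in lborel. norm (g t * h t) \<le> norm (g t * C)"
        using that(3) by (auto simp: abs_mult intro!: mult_left_mono)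
    qed (use that in \<open>auto simp: borel_measurable_integrable\<close>)
    \<comment> \<open>e^(K t) \<theta> is again a test function; its derivative contributes the term
      that cancels K f.\<close>
    define \<theta>e where "\<theta>e = (\<lambda>t. exp (K * t) * \<theta> t)"
    have the: "test1 T \<theta>e"
    proof -
      obtain a b where ab: "0 < a" "a \<le> b" "b < T" "\<forall>t. t \<notin> {a..b} \<longrightarrow> \<theta> t = 0" using th by (auto simp: test1_def)
      then have "\<forall>t. t \<notin> {a..b} \<longrightarrow> exp (K * t) * \<theta> t = 0" by simp
      with ab show ?thesis unfolding test1_def \<theta>e_def
        using smooth1_mult[OF smooth1_exp sm] by blast
    qed
    have de: "deriv \<theta>e t = exp (K * t) * deriv \<theta> t + K * exp (K * t) * \<theta> t" for t
      unfolding \<theta>e_def by (rule DERIV_imp_deriv) (auto intro!: derivative_eq_intros smooth1_deriv(1)[OF sm])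
    have e\<theta>: "e t * \<theta> t = \<theta>e t" "e t * deriv \<theta> t = exp (K * t) * deriv \<theta> t" for t
      using thp(5,6)[of t] by (auto simp: e_def \<theta>e_def indicator_def)
    have 1: "(\<integral>t. (e t * f t) * deriv \<theta> t \<partial>lborel) = - (\<integral>t. (e t * q t) * \<theta> t \<partial>lborel)"
    proof -
      have i1: "integrable lborel (\<lambda>t. (e t * f t) * deriv \<theta> t)" "integrable lborel (\<lambda>t. (e t * f t) * \<theta> t)"
          "integrable lborel (\<lambda>t. (e t * q t) * \<theta> t)"
        using bi[OF ei[OF f] _ M'(2)] bi[OF ei[OF f] _ M(2)] bi[OF ei[OF q] _ M(2)] by auto
      have "(\<integral>t. (e t * f t) * deriv \<theta> t \<partial>lborel) + K * (\<integral>t. (e t * f t) * \<theta> t \<partial>lborel)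
        = (\<integral>t. (e t * f t) * deriv \<theta> t + K * ((e t * f t) * \<theta> t) \<partial>lborel)"
        using i1 by simp
      also have "\<dots> = (\<integral>t. f t * deriv \<theta>e t \<partial>lborel)"
      proof (rule Bochner_Integration.integral_cong[OF refl])
        fix t
        have "(e t * f t) * deriv \<theta> t + K * ((e t * f t) * \<theta> t) = f t * (e t * deriv \<theta> t) + f t * (K * (e t * \<theta> t))"
          by (simp add: algebra_simps)
        also have "\<dots> = f t * deriv \<theta>e t"
          unfolding e\<theta> de by (simp add: \<theta>e_def algebra_simps)
        finally show "(e t * f t) * deriv \<theta> t + K * ((e t * f t) * \<theta> t) = f t * deriv \<theta>e t" .
      qed
      also have "\<dots> = (\<integral>t. (K * f t - q t) * \<theta>e t \<partial>lborel)" by (rule w[OF the])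
      also have "\<dots> = (\<integral>t. K * ((e t * f t) * \<theta> t) - (e t * q t) * \<theta> t \<partial>lborel)"
        by (intro Bochner_Integration.integral_cong) (auto simp: e\<theta>(1)[symmetric] algebra_simps)
      also have "\<dots> = K * (\<integral>t. (e t * f t) * \<theta> t \<partial>lborel) - (\<integral>t. (e t * q t) * \<theta> t \<partial>lborel)"
        using i1 by simp
      finally show ?thesis by simp
    qed
    have ftc: "(\<integral>t. indicator {r..} t * deriv \<theta> t \<partial>lborel) = - \<theta> r" for r
    proof -
      \<comment> \<open>\<theta> vanishes from T on, so the integral may stop at T; the maximum
        covers r > T, where both sides are 0.\<close>
      define B where "B = max r T"
      have "(\<integral>x. deriv \<theta> x * indicator {r..B} x \<partial>lborel) = \<theta> B - \<theta> r"
        using smooth1_deriv(1)[OF sm] smooth1_continuous[OF smooth1_deriv(2)[OF sm], of UNIV]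
        by (intro integral_FTC_Icc_real) (auto simp: B_def continuous_on_eq_continuous_at)
      moreover have "deriv \<theta> x * indicator {r..B} x = indicator {r..} x * deriv \<theta> x" for x
        using thp(6)[of x] by (cases "x \<le> T") (auto simp: indicator_def B_def)
      moreover have "\<theta> B = 0" by (rule thp(5)) (auto simp: B_def)
      ultimately show ?thesis by simp
    qed
    \<comment> \<open>Fubini's theorem turns the primitive into integrals of \<theta>' over the
      half-lines from r on, which \<open>ftc\<close> evaluates to - \<theta> r.\<close>
    have 2: "(\<integral>t. (indicator {0<..<T} t * qt t) * deriv \<theta> t \<partial>lborel) = - (\<integral>t. (e t * q t) * \<theta> t \<partial>lborel)"
    proof -
      let ?F = "\<lambda>t r. indicator {..t} r * (e r * q r) * deriv \<theta> t"
      have [measurable]: "(\<lambda>(t, r). ?F t r) \<in> borel_measurable (lborel \<Otimes>\<^sub>M lborel)"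
        unfolding ind by measurable
      have pi: "integrable (lborel \<Otimes>\<^sub>M lborel) (\<lambda>(t, r). ?F t r)"
      proof (rule lborel_pair.Fubini_integrable)
        show "AE t in lborel. integrable lborel (\<lambda>r. case (t, r) of (t, r) \<Rightarrow> ?F t r)"
          using qi by (intro AE_I2) auto
        have "integrable lborel (\<lambda>t. deriv \<theta> t * (\<integral>r. \<bar>indicator {..t} r * (e r * q r)\<bar> \<partial>lborel))"
        proof (rule bi[OF thp(2)])
          show "\<bar>\<integral>r. \<bar>indicator {..t} r * (e r * q r)\<bar> \<partial>lborel\<bar> \<le> (\<integral>r. \<bar>e r * q r\<bar> \<partial>lborel)" for t
            by (rule Bochner_Integration.integral_abs_bound_integral) (use qi ei[OF q] in \<open>auto simp: indicator_def\<close>)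
        qed (unfold ind, measurable)
        from integrable_norm[OF this]
        show "integrable lborel (\<lambda>t. \<integral>r. norm (case (t, r) of (t, r) \<Rightarrow> ?F t r) \<partial>lborel)"
          by (simp add: abs_mult mult.commute)
      qed measurable
      have "(\<integral>t. (indicator {0<..<T} t * qt t) * deriv \<theta> t \<partial>lborel) = (\<integral>t. (\<integral>r. ?F t r \<partial>lborel) \<partial>lborel)"
      proof (rule Bochner_Integration.integral_cong[OF refl])
        fix t
        have "(indicator {0<..<T} t * qt t) * deriv \<theta> t = qt t * deriv \<theta> t"
          using thp(6)[of t] by (auto simp: indicator_def)
        then show "(indicator {0<..<T} t * qt t) * deriv \<theta> t = (\<integral>r. ?F t r \<partial>lborel)"
          by (simp add: qt_def)
      qed
      also have "\<dots> = (\<integral>r. (\<integral>t. ?F t r \<partial>lborel) \<partial>lborel)"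
        using lborel_pair.Fubini_integral[OF pi] by simp
      also have "\<dots> = (\<integral>r. (e r * q r) * (- \<theta> r) \<partial>lborel)"
      proof (rule Bochner_Integration.integral_cong[OF refl])
        fix r
        have "(\<integral>t. ?F t r \<partial>lborel) = (\<integral>t. (e r * q r) * (indicator {r..} t * deriv \<theta> t) \<partial>lborel)"
          by (intro Bochner_Integration.integral_cong) (auto simp: indicator_def)
        then show "(\<integral>t. ?F t r \<partial>lborel) = (e r * q r) * (- \<theta> r)"
          by (simp add: ftc)
      qed
      finally show ?thesis by simp
    qed
    have "(\<integral>t. d t * deriv \<theta> t \<partial>lborel) = (\<integral>t. (e t * f t) * deriv \<theta> t - (indicator {0<..<T} t * qt t) * deriv \<theta> t \<partial>lborel)"
      by (simp add: d_def algebra_simps)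
    also have "\<dots> = 0"
      using bi[OF ei[OF f] _ M'(2)] bi[OF qti _ M'(2)] 1 2 by simp
    finally show "(\<integral>t. d t * deriv \<theta> t \<partial>lborel) = 0" .
  qed
  then obtain k where k: "AE t in lborel. t \<in> {0<..<T} \<longrightarrow> d t = k" by blast
  then obtain N where N: "{t. \<not> (t \<in> {0<..<T} \<longrightarrow> d t = k)} \<subseteq> N" "N \<in> null_sets lborel"
    unfolding eventually_ae_filter by auto
  \<comment> \<open>The limit is taken off \<open>E\<close>, and \<open>d = k\<close> holds off
    \<open>N\<close>. Both are null, so arbitrarily small times avoid them, and the constant can be
    evaluated along such a sequence.\<close>
  have ex: "\<exists>t. t \<in> {0<..<min T (1 / real (Suc n))} - (E \<union> N)" for n
  proof (rule ccontr)
    assume "\<nexists>t. t \<in> {0<..<min T (1 / real (Suc n))} - (E \<union> N)"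
    then have "{0<..<min T (1 / real (Suc n))} \<subseteq> E \<union> N" by blast
    moreover have "E \<union> N \<in> null_sets lborel" using E N by blast
    ultimately have "{0<..<min T (1 / real (Suc n))} \<in> null_sets lborel"
      by (rule null_sets_subset[rotated 2]) auto
    moreover have "0 < min T (1 / real (Suc n))" using T by simp
    ultimately show False by (simp add: null_sets_def del: of_nat_Suc)
  qed
  then obtain \<tau> where \<tau>: "\<And>n. \<tau> n \<in> {0<..<min T (1 / real (Suc n))} - (E \<union> N)" by metis
  have \<tau>0: "\<tau> \<longlonglongrightarrow> 0"
    by (rule tendsto_sandwich[OF _ _ tendsto_const LIMSEQ_Suc[OF lim_1_over_n]])
      (use \<tau> in \<open>auto intro!: always_eventually less_imp_le\<close>)
  have "k = 0"
  proof -
    have "filterlim \<tau> (at 0 within ({0<..} - E)) sequentially"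
    proof -
      have "\<tau> n \<in> {0<..} - E \<and> \<tau> n \<noteq> 0" for n using \<tau>[of n] by auto
      then show ?thesis using \<tau>0 by (simp add: filterlim_at)
    qed
    from filterlim_compose[OF lim this] have "(\<lambda>n. exp (K * \<tau> n) * f (\<tau> n)) \<longlonglongrightarrow> exp (K * 0) * 0"
      by (intro tendsto_intros \<tau>0)
    moreover have "e (\<tau> n) = exp (K * \<tau> n)" for n
      using \<tau>[of n] by (auto simp: e_def)
    ultimately have l1: "(\<lambda>n. e (\<tau> n) * f (\<tau> n)) \<longlonglongrightarrow> 0" by simp
    have "(\<lambda>n. qt (\<tau> n)) \<longlonglongrightarrow> (\<integral>r. 0 \<partial>(lborel :: real measure))"
      unfolding qt_def
    proof (rule integral_dominated_convergence[where w = "\<lambda>r. \<bar>e r * q r\<bar>"])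
      show "AE r in lborel. (\<lambda>n. indicator {..\<tau> n} r * (e r * q r)) \<longlonglongrightarrow> 0"
      proof (rule AE_I2)
        fix r :: real
        show "(\<lambda>n. indicator {..\<tau> n} r * (e r * q r)) \<longlonglongrightarrow> 0"
        proof (cases "r > 0")
          case True
          then have "eventually (\<lambda>n. \<tau> n < r) sequentially" using \<tau>0 by (simp add: order_tendsto_iff)
          then have "eventually (\<lambda>n. indicator {..\<tau> n} r * (e r * q r) = 0) sequentially"
            by eventually_elim auto
          then show ?thesis by (rule tendsto_eventually)
        qed (simp add: e_def)
      qed
    qed (use ei[OF q] in \<open>auto simp: indicator_def\<close>)
    then have "(\<lambda>n. e (\<tau> n) * f (\<tau> n) - qt (\<tau> n)) \<longlonglongrightarrow> 0 - 0"
      using l1 by (intro tendsto_diff) auto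
    moreover have "e (\<tau> n) * f (\<tau> n) - qt (\<tau> n) = k" for n
      using \<tau>[of n] N(1) by (auto simp: d_def)
    ultimately show "k = 0" by (simp add: LIMSEQ_const_iff)
  qed
  from k show ?thesis
  proof eventually_elim
    case (elim t)
    show ?case
    proof
      assume t: "t \<in> {0<..<T}"
      with elim \<open>k = 0\<close> have "exp (K * t) * f t = qt t" by (auto simp: d_def e_def)
      then have "f t = exp (- (K * t)) * qt t" by (simp add: exp_minus field_simps)
      then have "\<bar>f t\<bar> = exp (- (K * t)) * \<bar>qt t\<bar>" by (simp add: abs_mult)
      also have "ennreal \<dots> = ennreal (exp (- (K * t))) * ennreal \<bar>qt t\<bar>" by (simp add: ennreal_mult)
      also have "ennreal \<bar>qt t\<bar> \<le> (\<integral>\<^sup>+r. ennreal \<bar>indicator {..t} r * (e r * q r)\<bar> \<partial>lborel)"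
        unfolding qt_def using integral_norm_bound_ennreal[OF qi[of t]] by simp
      also have "ennreal (exp (- (K * t))) * \<dots> = (\<integral>\<^sup>+r. ennreal (exp (- (K * t))) * ennreal \<bar>indicator {..t} r * (e r * q r)\<bar> \<partial>lborel)"
        by (rule nn_integral_cmult[symmetric]) measurable
      also have "\<dots> = (\<integral>\<^sup>+r. indicator {0<..<t} r * ennreal (exp (- (K * (t - r))) * \<bar>q r\<bar>) \<partial>lborel)"
      proof (rule nn_integral_cong_AE)
        \<comment> \<open>Where \<open>e\<close> is nonzero, the sets \<open>{..t}\<close> and
          \<open>{0<..<t}\<close> differ only at r = t.\<close>
        show "AE r in lborel. ennreal (exp (- (K * t))) * ennreal \<bar>indicator {..t} r * (e r * q r)\<bar>
            = indicator {0<..<t} r * ennreal (exp (- (K * (t - r))) * \<bar>q r\<bar>)"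
          using AE_lborel_singleton[of t]
        proof eventually_elim
          case (elim r)
          then show ?case using t
            by (auto simp: e_def indicator_def abs_mult algebra_simps exp_add exp_diff exp_minus field_simps
                simp flip: ennreal_mult'')
        qed
      qed
      finally show "ennreal \<bar>f t\<bar> \<le> (\<integral>\<^sup>+r. indicator {0<..<t} r * ennreal (exp (- (K * (t - r))) * \<bar>q r\<bar>) \<partial>lborel)"
        by (simp add: mult_left_mono)
    qed
  qed
qed

section \<open>The heat kernel and the weight\<close>

text \<open>Variance \<open>2 * l\<close> per coordinate makes this the kernel of \<open>exp (l \<Delta>)\<close>. The operator \<open>jump\<close> is the
  positive part \<open>P\<close> of the truncated fractional Laplacian without the factor \<open>\<kappa>\<close>, and \<open>wgt\<close> is \<open>\<zeta>\<close>.\<close>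

definition heat_ker :: "real \<Rightarrow> 'a::euclidean_space \<Rightarrow> real" where
  "heat_ker l x = tensor (\<lambda>_. normal_density 0 (sqrt (2 * l))) x"

definition heat :: "real \<Rightarrow> ('a::euclidean_space \<Rightarrow> ennreal) \<Rightarrow> 'a \<Rightarrow> ennreal" where
  "heat l f x = (\<integral>\<^sup>+y. ennreal (heat_ker l (x - y)) * f y \<partial>lborel)"

definition jump :: "real \<Rightarrow> real \<Rightarrow> ('a::euclidean_space \<Rightarrow> ennreal) \<Rightarrow> 'a \<Rightarrow> ennreal" where
  "jump s \<delta> f x = (\<integral>\<^sup>+l. indicator {\<delta>..} l * ennreal (l powr (-1 - s)) * heat l f x \<partial>lborel)"

definition wgt :: "real \<Rightarrow> 'a::euclidean_space \<Rightarrow> ennreal" where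
  "wgt s x = (\<integral>\<^sup>+l. indicator {1..} l * ennreal (l powr (-1 - s)) * ennreal (heat_ker l x) \<partial>lborel)"

lemma heat_ker_nonneg[simp]: "0 \<le> heat_ker l x"
  by (simp add: heat_ker_def tensor_def prod_nonneg)

lemma heat_ker_measurable[measurable (raw)]:
  assumes [measurable]: "f \<in> borel_measurable M" "g \<in> borel_measurable M"
  shows "(\<lambda>z. heat_ker (f z) (g z)) \<in> borel_measurable M"
  unfolding heat_ker_def tensor_def normal_density_def by measurable

lemma heat_measurable[measurable (raw)]:
  fixes h :: "'b \<Rightarrow> 'a::euclidean_space"
  assumes [measurable]: "l \<in> borel_measurable M" "h \<in> borel_measurable M" "(\<lambda>(z, y). f z y) \<in> borel_measurable (M \<Otimes>\<^sub>M borel)"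
  shows "(\<lambda>z. heat (l z) (f z) (h z)) \<in> borel_measurable M"
  unfolding heat_def by measurable

lemma wgt_measurable[measurable]: "wgt s \<in> borel_measurable borel"
  unfolding wgt_def by measurable

lemma jump_measurable[measurable (raw)]:
  fixes h :: "'b \<Rightarrow> 'a::euclidean_space"
  assumes [measurable]: "h \<in> borel_measurable M" "(\<lambda>(z, y). f z y) \<in> borel_measurable (M \<Otimes>\<^sub>M borel)"
  shows "(\<lambda>z. jump s \<delta> (f z) (h z)) \<in> borel_measurable M"
  unfolding jump_def by measurable

lemma heat_ker_minus: "heat_ker l (- x) = heat_ker l x"
  by (simp add: heat_ker_def tensor_def normal_density_def)

lemma heat_ker_minus_commute: "heat_ker l (x - y) = heat_ker l (y - x)"
  using heat_ker_minus[of l "x - y"] by simp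

lemma heat_ker_eq:
  assumes "l > 0"
  shows "heat_ker l (x::'a::euclidean_space) = (1 / sqrt (4 * pi * l)) ^ DIM('a) * exp (- ((norm x)\<^sup>2 / (4 * l)))"
proof -
  have "heat_ker l x = (\<Prod>b\<in>(Basis::'a set). 1 / sqrt (4 * pi * l) * exp (- ((x \<bullet> b)\<^sup>2 / (4 * l))))"
    using assms by (simp add: heat_ker_def tensor_def normal_density_def ac_simps)
  also have "\<dots> = (1 / sqrt (4 * pi * l)) ^ DIM('a) * exp (\<Sum>b\<in>(Basis::'a set). - ((x \<bullet> b)\<^sup>2 / (4 * l)))"
    by (simp only: prod.distrib prod_constant exp_sum[OF finite_Basis])
  also have "(\<Sum>b\<in>(Basis::'a set). - ((x \<bullet> b)\<^sup>2 / (4 * l))) = - ((norm x)\<^sup>2 / (4 * l))"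
    unfolding power2_norm_eq_inner euclidean_inner[of x x]
    by (simp add: sum_negf sum_divide_distrib power2_eq_square)
  finally show ?thesis .
qed

lemma nn_integral_tensor:
  fixes f :: "'a::euclidean_space \<Rightarrow> real \<Rightarrow> real"
  assumes [measurable]: "\<And>b. b \<in> Basis \<Longrightarrow> f b \<in> borel_measurable borel"
    and nn: "\<And>b x. b \<in> Basis \<Longrightarrow> 0 \<le> f b x"
  shows "(\<integral>\<^sup>+x. ennreal (tensor f x) \<partial>lborel) = (\<Prod>b\<in>Basis. \<integral>\<^sup>+x. ennreal (f b x) \<partial>lborel)"
proof -
  have "(\<integral>\<^sup>+x. ennreal (tensor f x) \<partial>lborel) = (\<integral>\<^sup>+x. (\<Prod>b\<in>Basis. ennreal (f b (x \<bullet> b))) \<partial>lborel)"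
    unfolding tensor_def using nn by (simp add: prod_ennreal)
  also have "\<dots> = (\<Prod>b\<in>Basis. \<integral>\<^sup>+x. ennreal (f b x) \<partial>lborel)"
    by (rule nn_integral_lborel_prod) simp_all
  finally show ?thesis .
qed

lemma nn_integral_heat_ker: "l > 0 \<Longrightarrow> (\<integral>\<^sup>+x. ennreal (heat_ker l x) \<partial>lborel) = 1"
  unfolding heat_ker_def by (subst nn_integral_tensor) (auto simp: nn_integral_eq_integral)

lemma heat_tensor:
  fixes f :: "'a::euclidean_space \<Rightarrow> real \<Rightarrow> real"
  assumes [measurable]: "\<And>b. b \<in> Basis \<Longrightarrow> f b \<in> borel_measurable borel"
    and nn: "\<And>b x. b \<in> Basis \<Longrightarrow> 0 \<le> f b x"
  shows "heat l (\<lambda>y. ennreal (tensor f y)) x =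
    (\<Prod>b\<in>Basis. \<integral>\<^sup>+y. ennreal (normal_density 0 (sqrt (2 * l)) (x \<bullet> b - y) * f b y) \<partial>lborel)"
proof -
  have "heat l (\<lambda>y. ennreal (tensor f y)) x =
    (\<integral>\<^sup>+y. ennreal (tensor (\<lambda>b y. normal_density 0 (sqrt (2 * l)) (x \<bullet> b - y) * f b y) y) \<partial>lborel)"
    unfolding heat_def heat_ker_def
    by (intro nn_integral_cong)
      (auto simp: tensor_def prod.distrib prod_nonneg nn inner_diff_left simp flip: ennreal_mult)
  also have "\<dots> = (\<Prod>b\<in>Basis. \<integral>\<^sup>+y. ennreal (normal_density 0 (sqrt (2 * l)) (x \<bullet> b - y) * f b y) \<partial>lborel)"
    by (rule nn_integral_tensor) (auto simp: nn)
  finally show ?thesis .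
qed

text \<open>Sums of independent Gaussians add variances, here 2 l + 2 m per coordinate, so the
  kernels form a convolution semigroup; the claim factors over the coordinates.\<close>

lemma heat_heat_ker:
  assumes "l > 0" "m > 0"
  shows "heat l (\<lambda>y. ennreal (heat_ker m y)) x = ennreal (heat_ker (l + m) x)"
proof -
  have "sqrt ((sqrt (2 * l))\<^sup>2 + (sqrt (2 * m))\<^sup>2) = sqrt (2 * (l + m))"
    using assms by (simp add: algebra_simps)
  then have *: "(\<integral>\<^sup>+y. ennreal (normal_density 0 (sqrt (2 * l)) (t - y) * normal_density 0 (sqrt (2 * m)) y) \<partial>lborel)
      = ennreal (normal_density 0 (sqrt (2 * (l + m))) t)" for t
    using fun_cong[OF conv_normal_density_zero_mean[of "sqrt (2 * l)" "sqrt (2 * m)"], of t] assms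
    by simp
  show ?thesis
    unfolding heat_ker_def by (subst heat_tensor) (auto simp: * tensor_def prod_ennreal)
qed

section \<open>The weight under the heat flow and under the jump operator\<close>

lemma nn_integral_powr_tail:
  assumes "a > 0" "p > (0::real)"
  shows "(\<integral>\<^sup>+l. indicator {a..} l * ennreal (l powr (-1 - p)) \<partial>lborel) = ennreal (a powr (- p) / p)"
proof -
  have "((\<lambda>x. x powr (-1 - p)) has_integral - (a powr (-1 - p + 1)) / (-1 - p + 1)) {a..}"
    by (rule has_integral_powr_to_inf) (use assms in auto)
  from nn_integral_has_integral_lebesgue[OF _ this] assms
  have "(\<integral>\<^sup>+l. ennreal (indicator {a..} l * l powr (-1 - p)) \<partial>lborel) = ennreal (a powr (- p) / p)"
    by (simp add: indicator_def)
  then show ?thesis by (simp add: ennreal_mult' ennreal_indicator)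
qed

lemma nn_integral_powr_head:
  assumes "b > 0" "s < (1::real)"
  shows "(\<integral>\<^sup>+l. indicator {0..b} l * ennreal (l powr (- s)) \<partial>lborel) = ennreal (b powr (1 - s) / (1 - s))"
proof -
  have "((\<lambda>x. x powr (- s)) has_integral (b powr (- s + 1)) / (- s + 1)) {0..b}"
    by (rule has_integral_powr_from_0) (use assms in auto)
  from nn_integral_has_integral_lebesgue[OF _ this] assms
  have "(\<integral>\<^sup>+l. ennreal (indicator {0..b} l * l powr (- s)) \<partial>lborel) = ennreal (b powr (1 - s) / (1 - s))"
    by (simp add: indicator_def)
  then show ?thesis by (simp add: ennreal_mult' ennreal_indicator)
qed

text \<open>By the semigroup law the flow acts on the weight only by shifting the kernel parameter.
  What remains is to compare the densities l^(-1-s) and (m + l)^(-1-s).\<close>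

lemma heat_wgt:
  assumes "m > 0"
  shows "heat m (wgt s) x = (\<integral>\<^sup>+l. indicator {1..} l * ennreal (l powr (-1 - s)) * ennreal (heat_ker (m + l) x) \<partial>lborel)"
proof -
  have "heat m (wgt s) x = (\<integral>\<^sup>+y. (\<integral>\<^sup>+l. indicator {1..} l * ennreal (l powr (-1 - s)) * (ennreal (heat_ker m (x - y)) * ennreal (heat_ker l y)) \<partial>lborel) \<partial>lborel)"
    unfolding heat_def wgt_def
    by (subst nn_integral_cmult[symmetric]) (auto simp: ac_simps)
  also have "\<dots> = (\<integral>\<^sup>+l. (\<integral>\<^sup>+y. indicator {1..} l * ennreal (l powr (-1 - s)) * (ennreal (heat_ker m (x - y)) * ennreal (heat_ker l y)) \<partial>lborel) \<partial>lborel)"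
    by (rule lborel_pair.Fubini') measurable
  also have "\<dots> = (\<integral>\<^sup>+l. indicator {1..} l * ennreal (l powr (-1 - s)) * heat m (\<lambda>y. ennreal (heat_ker l y)) x \<partial>lborel)"
    unfolding heat_def by (intro nn_integral_cong nn_integral_cmult) measurable
  also have "\<dots> = (\<integral>\<^sup>+l. indicator {1..} l * ennreal (l powr (-1 - s)) * ennreal (heat_ker (m + l) x) \<partial>lborel)"
    using assms by (intro nn_integral_cong) (auto simp: heat_heat_ker indicator_def)
  finally show ?thesis .
qed

lemma nn_integral_shift_real:
  fixes f :: "real \<Rightarrow> ennreal"
  assumes "f \<in> borel_measurable borel"
  shows "(\<integral>\<^sup>+l. f (m + l) \<partial>lborel) = (\<integral>\<^sup>+l. f l \<partial>lborel)"
  using nn_integral_real_affine[of f 1 m] assms by simp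

text \<open>Since l \<ge> 1, m + l \<le> (1 + m) l; the exponent 1 + s is rounded up to 2.\<close>

lemma powr_shift_le:
  assumes "l \<ge> 1" "m > 0" "0 < s" "s < (1::real)"
  shows "l powr (-1 - s) \<le> (1 + m)\<^sup>2 * (m + l) powr (-1 - s)"
proof -
  have "m + l \<le> (1 + m) * l"
    using mult_left_mono[of 1 l m] assms by (simp add: algebra_simps)
  then have "((1 + m) * l) powr (-1 - s) \<le> (m + l) powr (-1 - s)"
    using assms by (intro powr_mono2') auto
  then have *: "(1 + m) powr (1 + s) * ((1 + m) * l) powr (-1 - s) \<le> (1 + m) powr (1 + s) * (m + l) powr (-1 - s)"
    by (intro mult_left_mono) auto
  have "(1 + m) powr (1 + s) * (1 + m) powr (-1 - s) = 1"
    using assms by (simp flip: powr_add)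
  then have "(1 + m) powr (1 + s) * ((1 + m) * l) powr (-1 - s) = l powr (-1 - s)"
    using assms by (simp add: powr_mult mult.assoc[symmetric])
  moreover have "(1 + m) powr (1 + s) \<le> (1 + m) powr 2"
    using assms by (intro powr_mono) auto
  moreover have "(1 + m) powr 2 = (1 + m)\<^sup>2"
    using assms by simp
  ultimately show ?thesis
    using * mult_right_mono[of "(1 + m) powr (1 + s)" "(1 + m)\<^sup>2" "(m + l) powr (-1 - s)"] by simp
qed

lemma wgt_shift_le:
  assumes "m > 0"
  shows "(\<integral>\<^sup>+l. indicator {1..} l * ennreal ((m + l) powr (-1 - s)) * ennreal (heat_ker (m + l) x) \<partial>lborel) \<le> wgt s x"
proof -
  have "(\<integral>\<^sup>+l. indicator {1..} l * ennreal ((m + l) powr (-1 - s)) * ennreal (heat_ker (m + l) x) \<partial>lborel)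
    \<le> (\<integral>\<^sup>+l. indicator {1..} (m + l) * ennreal ((m + l) powr (-1 - s)) * ennreal (heat_ker (m + l) x) \<partial>lborel)"
    using assms by (intro nn_integral_mono) (auto simp: indicator_def)
  also have "\<dots> = wgt s x"
    unfolding wgt_def by (rule nn_integral_shift_real) measurable
  finally show ?thesis .
qed

text \<open>The excess of the factor over 1 is of order m for small m, which makes it integrable
  against m^(-1-s) near 0. This is why the bound for the truncated operator loses only a constant
  beyond its leading term.\<close>

lemma heat_wgt_le:
  assumes "m > 0" "0 < s" "s < 1"
  shows "heat m (wgt s) x \<le> ennreal ((1 + m)\<^sup>2) * wgt s x"
proof -
  have "heat m (wgt s) x \<le> (\<integral>\<^sup>+l. ennreal ((1 + m)\<^sup>2) * (indicator {1..} l * ennreal ((m + l) powr (-1 - s)) * ennreal (heat_ker (m + l) x)) \<partial>lborel)"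
    unfolding heat_wgt[OF assms(1)]
  proof (rule nn_integral_mono)
    fix l :: real
    have "ennreal (l powr (-1 - s)) \<le> ennreal ((1 + m)\<^sup>2) * ennreal ((m + l) powr (-1 - s))" if "l \<ge> 1"
      using powr_shift_le[OF that assms] by (simp add: ennreal_leI flip: ennreal_mult)
    then show "indicator {1..} l * ennreal (l powr (-1 - s)) * ennreal (heat_ker (m + l) x)
        \<le> ennreal ((1 + m)\<^sup>2) * (indicator {1..} l * ennreal ((m + l) powr (-1 - s)) * ennreal (heat_ker (m + l) x))"
      by (auto simp: indicator_def mult.assoc[symmetric] intro!: mult_right_mono)
  qed
  also have "\<dots> = ennreal ((1 + m)\<^sup>2) * (\<integral>\<^sup>+l. indicator {1..} l * ennreal ((m + l) powr (-1 - s)) * ennreal (heat_ker (m + l) x) \<partial>lborel)"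
    by (rule nn_integral_cmult) measurable
  also have "\<dots> \<le> ennreal ((1 + m)\<^sup>2) * wgt s x"
    by (intro mult_left_mono wgt_shift_le assms) auto
  finally show ?thesis .
qed

text \<open>The larger of l and m is at least half of m + l, and 2^(1+s) \<le> 4.\<close>

lemma powr_mult_le_sum:
  assumes "l \<ge> 1" "m \<ge> 1" "0 < s" "s < (1::real)"
  shows "m powr (-1 - s) * l powr (-1 - s) \<le> 4 * ((m + l) powr (-1 - s) * (m powr (-1 - s) + l powr (-1 - s)))"
proof -
  have *: "m powr (-1 - s) * l powr (-1 - s) \<le> 4 * ((m + l) powr (-1 - s) * m powr (-1 - s))"
    if "m \<le> l" "m \<ge> 1" for l m :: real
  proof -
    have "(2 * l) powr (-1 - s) \<le> (m + l) powr (-1 - s)"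
      using that assms by (intro powr_mono2') auto
    then have "2 powr (-1 - s) * l powr (-1 - s) \<le> (m + l) powr (-1 - s)"
      using that by (simp add: powr_mult)
    moreover have "1 / 4 \<le> 2 powr (-1 - s)"
    proof -
      have "2 powr (-2) \<le> 2 powr (-1 - s)" using assms by (intro powr_mono) auto
      then show ?thesis by (simp add: powr_minus powr_numeral)
    qed
    ultimately have "1 / 4 * l powr (-1 - s) \<le> (m + l) powr (-1 - s)"
      by (meson mult_right_mono order_trans powr_ge_zero)
    then have "l powr (-1 - s) \<le> 4 * (m + l) powr (-1 - s)" by simp
    then have "m powr (-1 - s) * l powr (-1 - s) \<le> m powr (-1 - s) * (4 * (m + l) powr (-1 - s))"
      by (intro mult_left_mono) auto
    then show ?thesis by (simp add: ac_simps)
  qed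
  have p: "0 \<le> (m + l) powr (-1 - s) * m powr (-1 - s)" "0 \<le> (m + l) powr (-1 - s) * l powr (-1 - s)" by auto
  show ?thesis
  proof (cases "m \<le> l")
    case True
    from *[OF this assms(2)] p show ?thesis unfolding distrib_left by linarith
  next
    case False
    then have "l powr (-1 - s) * m powr (-1 - s) \<le> 4 * ((l + m) powr (-1 - s) * l powr (-1 - s))"
      using assms by (intro *) auto
    then have "m powr (-1 - s) * l powr (-1 - s) \<le> 4 * ((m + l) powr (-1 - s) * l powr (-1 - s))"
      by (simp only: ac_simps)
    with p show ?thesis unfolding distrib_left by linarith
  qed
qed

text \<open>The kernel of \<open>jump s 1\<close> is \<open>wgt s\<close>, so this bounds the
  convolution of the weight with itself. It is a double integral over l, m \<ge> 1 of the heat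
  kernel at m + l; splitting the product of powers into two symmetric terms and integrating out one
  parameter gives 4 / s twice.\<close>

lemma jump_wgt_1_le:
  assumes "0 < s" "s < 1"
  shows "jump s 1 (wgt s) x \<le> ennreal (8 / s) * wgt s x"
proof -
  let ?p = "\<lambda>l::real. indicator {1..} l * ennreal (l powr (-1 - s))"
  let ?q = "\<lambda>m l. ennreal ((m + l) powr (-1 - s)) * ennreal (heat_ker (m + l) x)"
  have "jump s 1 (wgt s) x = (\<integral>\<^sup>+m. (\<integral>\<^sup>+l. ?p m * (?p l * ennreal (heat_ker (m + l) x)) \<partial>lborel) \<partial>lborel)"
    unfolding jump_def by (intro nn_integral_cong) (auto simp: heat_wgt nn_integral_cmult indicator_def)
  also have "\<dots> \<le> (\<integral>\<^sup>+m. (\<integral>\<^sup>+l. 4 * (?p m * (indicator {1..} l * ?q m l)) + 4 * (?p l * (indicator {1..} m * ?q l m)) \<partial>lborel) \<partial>lborel)"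
  proof (intro nn_integral_mono)
    fix m l :: real
    show "?p m * (?p l * ennreal (heat_ker (m + l) x)) \<le> 4 * (?p m * (indicator {1..} l * ?q m l)) + 4 * (?p l * (indicator {1..} m * ?q l m))"
    proof (cases "l \<ge> 1 \<and> m \<ge> 1")
      case True
      have e4: "(4::ennreal) = ennreal 4" by simp
      have "m powr (-1 - s) * (l powr (-1 - s) * heat_ker (m + l) x) \<le>
          4 * ((m + l) powr (-1 - s) * (m powr (-1 - s) + l powr (-1 - s))) * heat_ker (m + l) x"
        using mult_right_mono[OF powr_mult_le_sum[of l m s] heat_ker_nonneg[of "m + l" x]] True assms by (simp add: mult.assoc)
      also have "\<dots> = 4 * (m powr (-1 - s) * ((m + l) powr (-1 - s) * heat_ker (m + l) x)) +
          4 * (l powr (-1 - s) * ((l + m) powr (-1 - s) * heat_ker (l + m) x))"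
        by (simp add: algebra_simps)
      finally have "ennreal (m powr (-1 - s) * (l powr (-1 - s) * heat_ker (m + l) x)) \<le> ennreal (4 * (m powr (-1 - s) * ((m + l) powr (-1 - s) * heat_ker (m + l) x)) +
          4 * (l powr (-1 - s) * ((l + m) powr (-1 - s) * heat_ker (l + m) x)))"
        by (rule ennreal_leI)
      then show ?thesis using True unfolding e4
        by (simp add: ennreal_mult ennreal_plus)
    qed (auto simp: indicator_def)
  qed
  also have "\<dots> = (\<integral>\<^sup>+m. (\<integral>\<^sup>+l. 4 * (?p m * (indicator {1..} l * ?q m l)) \<partial>lborel) \<partial>lborel) +
      (\<integral>\<^sup>+m. (\<integral>\<^sup>+l. 4 * (?p l * (indicator {1..} m * ?q l m)) \<partial>lborel) \<partial>lborel)"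
    by (subst nn_integral_add[symmetric], measurable, intro nn_integral_cong nn_integral_add) measurable
  also have "(\<integral>\<^sup>+m. (\<integral>\<^sup>+l. 4 * (?p l * (indicator {1..} m * ?q l m)) \<partial>lborel) \<partial>lborel) =
      (\<integral>\<^sup>+m. (\<integral>\<^sup>+l. 4 * (?p m * (indicator {1..} l * ?q m l)) \<partial>lborel) \<partial>lborel)"
    by (rule lborel_pair.Fubini') measurable
  also have "(\<integral>\<^sup>+m. (\<integral>\<^sup>+l. 4 * (?p m * (indicator {1..} l * ?q m l)) \<partial>lborel) \<partial>lborel) \<le> (\<integral>\<^sup>+m. ?p m * (4 * wgt s x) \<partial>lborel)"
  proof (rule nn_integral_mono)
    fix m :: real
    show "(\<integral>\<^sup>+l. 4 * (?p m * (indicator {1..} l * ?q m l)) \<partial>lborel) \<le> ?p m * (4 * wgt s x)"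
    proof (cases "m \<ge> 1")
      case True
      have "(\<integral>\<^sup>+l. 4 * (?p m * (indicator {1..} l * ?q m l)) \<partial>lborel) =
          (\<integral>\<^sup>+l. (4 * ?p m) * (indicator {1..} l * ennreal ((m + l) powr (-1 - s)) * ennreal (heat_ker (m + l) x)) \<partial>lborel)"
        by (simp add: mult.assoc)
      also have "\<dots> = (4 * ?p m) * (\<integral>\<^sup>+l. indicator {1..} l * ennreal ((m + l) powr (-1 - s)) * ennreal (heat_ker (m + l) x) \<partial>lborel)"
        by (rule nn_integral_cmult) measurable
      also have "\<dots> \<le> (4 * ?p m) * wgt s x"
        using True by (intro mult_left_mono wgt_shift_le) auto
      finally show ?thesis by (simp add: ac_simps)
    qed simp
  qed
  also have "(\<integral>\<^sup>+m. ?p m * (4 * wgt s x) \<partial>lborel) = ennreal (1 / s) * (4 * wgt s x)"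
    by (subst nn_integral_multc) (use nn_integral_powr_tail[of 1 s] assms in auto)
  also have "\<dots> + \<dots> = ennreal (8 / s) * wgt s x"
  proof -
    have "ennreal (8 / s) = ennreal (1 / s) * 4 + ennreal (1 / s) * 4"
      using assms by (simp flip: ennreal_mult'' ennreal_plus ennreal_numeral)
    then show ?thesis by (simp add: distrib_right mult.assoc)
  qed
  finally show ?thesis by (simp add: add_mono)
qed

text \<open>For l < 1 the flow costs (1 + l)^2 \<le> 1 + 3 l: the 1 is charged to the full mass
  \<delta>^(-s) / s of the truncated measure, the 3 l gives 3 / (1 - s). For l \<ge> 1 the
  convolution bound 8 / s is used. Only the first term depends on \<delta>, and it is exactly the
  mass that the truncation produces as K.\<close>

lemma jump_wgt_le:
  assumes "0 < s" "s < 1" "0 < \<delta>" "\<delta> \<le> 1"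
  shows "jump s \<delta> (wgt s) x \<le> ennreal (\<delta> powr (- s) / s + (3 / (1 - s) + 8 / s)) * wgt s x"
proof -
  have "jump s \<delta> (wgt s) x \<le> (\<integral>\<^sup>+l. (indicator {\<delta>..} l * ennreal (l powr (-1 - s)) + ennreal 3 * (indicator {0..1} l * ennreal (l powr (- s)))) * wgt s x
       + indicator {1..} l * ennreal (l powr (-1 - s)) * heat l (wgt s) x \<partial>lborel)"
    unfolding jump_def
  proof (rule nn_integral_mono)
    fix l :: real
    show "indicator {\<delta>..} l * ennreal (l powr (-1 - s)) * heat l (wgt s) x \<le>
      (indicator {\<delta>..} l * ennreal (l powr (-1 - s)) + ennreal 3 * (indicator {0..1} l * ennreal (l powr (- s)))) * wgt s x
       + indicator {1..} l * ennreal (l powr (-1 - s)) * heat l (wgt s) x"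
    proof (cases "l \<ge> \<delta> \<and> l < 1")
      case True
      then have l: "l > 0" using assms by simp
      have "(1 + l)\<^sup>2 \<le> 1 + 3 * l"
        using True l mult_right_mono[of l 1 l] by (simp add: power2_eq_square algebra_simps)
      then have "l powr (-1 - s) * (1 + l)\<^sup>2 \<le> l powr (-1 - s) * (1 + 3 * l)" by (intro mult_left_mono) auto
      also have "\<dots> = l powr (-1 - s) + 3 * l powr (- s)"
        using l powr_mult_base[of l "-1 - s"] by (simp add: algebra_simps)
      finally have "ennreal (l powr (-1 - s) * (1 + l)\<^sup>2) \<le> ennreal (l powr (-1 - s) + 3 * l powr (- s))"
        by (rule ennreal_leI)
      then have *: "ennreal (l powr (-1 - s)) * ennreal ((1 + l)\<^sup>2) \<le> ennreal (l powr (-1 - s)) + ennreal 3 * ennreal (l powr (- s))"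
        by (simp add: ennreal_mult)
      have "ennreal (l powr (-1 - s)) * heat l (wgt s) x \<le> ennreal (l powr (-1 - s)) * (ennreal ((1 + l)\<^sup>2) * wgt s x)"
        by (intro mult_left_mono heat_wgt_le l assms) auto
      also have "\<dots> \<le> (ennreal (l powr (-1 - s)) + ennreal 3 * ennreal (l powr (- s))) * wgt s x"
        unfolding mult.assoc[symmetric] by (intro mult_right_mono *) auto
      finally show ?thesis using True l by (simp add: indicator_def)
    qed (auto simp: indicator_def)
  qed
  also have "\<dots> = (\<integral>\<^sup>+l. (indicator {\<delta>..} l * ennreal (l powr (-1 - s)) + ennreal 3 * (indicator {0..1} l * ennreal (l powr (- s)))) * wgt s x \<partial>lborel)
      + jump s 1 (wgt s) x"
    unfolding jump_def by (rule nn_integral_add) measurable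
  also have "(\<integral>\<^sup>+l. (indicator {\<delta>..} l * ennreal (l powr (-1 - s)) + ennreal 3 * (indicator {0..1} l * ennreal (l powr (- s)))) * wgt s x \<partial>lborel)
      = (ennreal (\<delta> powr (- s) / s) + ennreal 3 * ennreal (1 / (1 - s))) * wgt s x"
    using assms nn_integral_powr_tail[of \<delta> s] nn_integral_powr_head[of 1 s]
    by (subst nn_integral_multc, measurable) (subst nn_integral_add, auto simp: nn_integral_cmult)
  also have "\<dots> + jump s 1 (wgt s) x \<le> \<dots> + ennreal (8 / s) * wgt s x"
    by (intro add_left_mono jump_wgt_1_le assms)
  also have "\<dots> = ennreal (\<delta> powr (- s) / s + (3 / (1 - s) + 8 / s)) * wgt s x"
  proof -
    have "ennreal (\<delta> powr (- s) / s + (3 / (1 - s) + 8 / s)) = ennreal (\<delta> powr (- s) / s) + (ennreal (3 * (1 / (1 - s))) + ennreal (8 / s))"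
      using assms by (simp flip: ennreal_plus)
    also have "ennreal (3 * (1 / (1 - s))) = ennreal 3 * ennreal (1 / (1 - s))"
      using assms by (intro ennreal_mult) auto
    finally show ?thesis by (simp only: distrib_right add.assoc)
  qed
  finally show ?thesis .
qed

lemma heat_symmetric:
  fixes f g :: "'a::euclidean_space \<Rightarrow> ennreal"
  assumes [measurable]: "f \<in> borel_measurable borel" "g \<in> borel_measurable borel"
  shows "(\<integral>\<^sup>+x. f x * heat l g x \<partial>lborel) = (\<integral>\<^sup>+x. g x * heat l f x \<partial>lborel)"
proof -
  have "(\<integral>\<^sup>+x. f x * heat l g x \<partial>lborel) = (\<integral>\<^sup>+x. (\<integral>\<^sup>+y. f x * (ennreal (heat_ker l (x - y)) * g y) \<partial>lborel) \<partial>lborel)"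
    unfolding heat_def by (intro nn_integral_cong nn_integral_cmult[symmetric]) measurable
  also have "\<dots> = (\<integral>\<^sup>+y. (\<integral>\<^sup>+x. f x * (ennreal (heat_ker l (x - y)) * g y) \<partial>lborel) \<partial>lborel)"
    by (rule lborel_pair.Fubini') measurable
  also have "\<dots> = (\<integral>\<^sup>+y. (\<integral>\<^sup>+x. g y * (ennreal (heat_ker l (y - x)) * f x) \<partial>lborel) \<partial>lborel)"
    by (intro nn_integral_cong) (subst heat_ker_minus_commute, simp add: ac_simps)
  also have "\<dots> = (\<integral>\<^sup>+y. g y * heat l f y \<partial>lborel)"
    unfolding heat_def by (intro nn_integral_cong nn_integral_cmult) measurable
  finally show ?thesis .
qed

lemma jump_symmetric:
  fixes f g :: "'a::euclidean_space \<Rightarrow> ennreal"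
  assumes [measurable]: "f \<in> borel_measurable borel" "g \<in> borel_measurable borel"
  shows "(\<integral>\<^sup>+x. f x * jump s \<delta> g x \<partial>lborel) = (\<integral>\<^sup>+x. g x * jump s \<delta> f x \<partial>lborel)"
proof -
  have *: "(\<integral>\<^sup>+x. f x * jump s \<delta> g x \<partial>lborel) = (\<integral>\<^sup>+l. indicator {\<delta>..} l * ennreal (l powr (-1 - s)) * (\<integral>\<^sup>+x. f x * heat l g x \<partial>lborel) \<partial>lborel)"
    if [measurable]: "f \<in> borel_measurable borel" "g \<in> borel_measurable borel" for f g :: "'a \<Rightarrow> ennreal"
  proof -
    have "(\<integral>\<^sup>+x. f x * jump s \<delta> g x \<partial>lborel) = (\<integral>\<^sup>+x. (\<integral>\<^sup>+l. f x * (indicator {\<delta>..} l * ennreal (l powr (-1 - s)) * heat l g x) \<partial>lborel) \<partial>lborel)"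
      unfolding jump_def by (intro nn_integral_cong nn_integral_cmult[symmetric]) measurable
    also have "\<dots> = (\<integral>\<^sup>+l. (\<integral>\<^sup>+x. f x * (indicator {\<delta>..} l * ennreal (l powr (-1 - s)) * heat l g x) \<partial>lborel) \<partial>lborel)"
      by (rule lborel_pair.Fubini') measurable
    also have "\<dots> = (\<integral>\<^sup>+l. (\<integral>\<^sup>+x. (indicator {\<delta>..} l * ennreal (l powr (-1 - s))) * (f x * heat l g x) \<partial>lborel) \<partial>lborel)"
      by (simp add: ac_simps)
    also have "\<dots> = (\<integral>\<^sup>+l. indicator {\<delta>..} l * ennreal (l powr (-1 - s)) * (\<integral>\<^sup>+x. f x * heat l g x \<partial>lborel) \<partial>lborel)"
      by (intro nn_integral_cong nn_integral_cmult) measurable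
    finally show ?thesis .
  qed
  show ?thesis
    using *[OF assms] *[OF assms(2,1)] heat_symmetric[OF assms] by simp
qed

text \<open>Keep only l in [m, m + 1] of the integral defining \<open>wgt\<close>: there the
  exponential is at least that of \<open>heat_ker m\<close>, and the prefactors lose a bounded
  amount. Gaussian bounds can thus be traded for the weight.\<close>

lemma heat_ker_le_wgt:
  assumes m: "m \<ge> 1" and s: "0 < s" "s < 1"
  shows "\<exists>C\<ge>0. \<forall>x::'a::euclidean_space. ennreal (heat_ker m x) \<le> ennreal C * wgt s x"
proof -
  define c where "c = (m + 1) powr (-1 - s) * sqrt (m / (m + 1)) ^ DIM('a)"
  have c: "c > 0" using m by (auto simp: c_def)
  have "ennreal (heat_ker m x) \<le> ennreal (1 / c) * wgt s x" for x :: 'a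
  proof -
    have lb: "c * heat_ker m x \<le> l powr (-1 - s) * heat_ker l x" if l: "l \<in> {m..m+1}" for l
    proof -
      have "sqrt (m / (m + 1)) ^ DIM('a) * heat_ker m x = (1 / sqrt (4 * pi * (m + 1))) ^ DIM('a) * exp (- ((norm x)\<^sup>2 / (4 * m)))"
      proof -
        have "sqrt (m / (m + 1)) * (1 / sqrt (4 * pi * m)) = 1 / sqrt (4 * pi * (m + 1))"
          using m by (simp add: real_sqrt_divide real_sqrt_mult)
        then have "sqrt (m / (m + 1)) ^ DIM('a) * (1 / sqrt (4 * pi * m)) ^ DIM('a) = (1 / sqrt (4 * pi * (m + 1))) ^ DIM('a)"
          by (simp only: power_mult_distrib[symmetric])
        then show ?thesis using m by (simp add: heat_ker_eq mult.assoc[symmetric])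
      qed
      also have "\<dots> \<le> (1 / sqrt (4 * pi * l)) ^ DIM('a) * exp (- ((norm x)\<^sup>2 / (4 * l)))"
        using l m by (intro mult_mono power_mono) (auto simp: frac_le divide_left_mono)
      also have "\<dots> = heat_ker l x" using l m by (simp add: heat_ker_eq)
      finally have "sqrt (m / (m + 1)) ^ DIM('a) * heat_ker m x \<le> heat_ker l x" .
      moreover have "(m + 1) powr (-1 - s) \<le> l powr (-1 - s)"
        using l m s by (intro powr_mono2') auto
      ultimately have "(m + 1) powr (-1 - s) * (sqrt (m / (m + 1)) ^ DIM('a) * heat_ker m x) \<le> l powr (-1 - s) * heat_ker l x"
        using m by (intro mult_mono) auto
      then show ?thesis by (simp add: c_def)
    qed
    have "ennreal (c * heat_ker m x) = (\<integral>\<^sup>+l. ennreal (c * heat_ker m x) * indicator {m..m+1} l \<partial>lborel)"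
      by (simp add: nn_integral_cmult_indicator)
    also have "\<dots> \<le> wgt s x"
      unfolding wgt_def
    proof (rule nn_integral_mono)
      fix l :: real
      show "ennreal (c * heat_ker m x) * indicator {m..m+1} l \<le> indicator {1..} l * ennreal (l powr (-1 - s)) * ennreal (heat_ker l x)"
        using lb[of l] m by (auto simp: indicator_def ennreal_leI simp flip: ennreal_mult)
    qed
    finally have "ennreal (1 / c) * ennreal (c * heat_ker m x) \<le> ennreal (1 / c) * wgt s x"
      by (intro mult_left_mono) auto
    then show ?thesis using c by (simp flip: ennreal_mult)
  qed
  then show ?thesis using c by (intro exI[of _ "1 / c"]) auto
qed

section \<open>Comparison of the weight with \<Phi>\<close>

lemma Phi_pos: "0 < Phi s x"
proof -
  have "0 < 1 + ((norm x)\<^sup>2 - 1) ^ 4"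
    by (rule add_pos_nonneg) (simp_all add: zero_le_even_power)
  then show ?thesis by (simp add: Phi_def)
qed

lemma power_powr: "r > 0 \<Longrightarrow> (r ^ n) powr a = r powr (real n * a)" for r :: real
  by (metis powr_powr powr_realpow)

text \<open>Outside the unit ball 1 + (|x|^2 - 1)^4 \<le> 2 |x|^8, and the negative power (N + 2 s)
  / 8 turns this into a lower bound for \<Phi>.\<close>

lemma Phi_lower:
  assumes "norm (x::'a::euclidean_space) > 1" "s > 0"
  shows "norm x powr (- (real DIM('a) + 2 * s)) \<le> 2 powr ((real DIM('a) + 2 * s) / 8) * Phi s x"
proof -
  define r where "r = norm x"
  define a where "a = real DIM('a) + 2 * s"
  have r: "r > 1" and a: "a > 0" using assms by (auto simp: r_def a_def add_nonneg_pos)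
  have "(r\<^sup>2 - 1) ^ 4 \<le> (r\<^sup>2) ^ 4" using r by (intro power_mono) auto
  moreover have "(r\<^sup>2) ^ 4 = r ^ 8" by (simp flip: power_mult)
  moreover have "1 \<le> r ^ 8" using r by simp
  ultimately have "1 + (r\<^sup>2 - 1) ^ 4 \<le> 2 * r ^ 8" by linarith
  then have "(2 * r ^ 8) powr (- a / 8) \<le> (1 + (r\<^sup>2 - 1) ^ 4) powr (- a / 8)"
    using a r by (intro powr_mono2') (auto intro!: add_pos_nonneg)
  moreover have "(2 * r ^ 8) powr (- a / 8) = 2 powr (- a / 8) * r powr (- a)"
    using r by (simp add: powr_mult power_powr)
  ultimately have "2 powr (a / 8) * (2 powr (- a / 8) * r powr (- a)) \<le> 2 powr (a / 8) * Phi s x"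
    using r by (intro mult_left_mono) (auto simp: Phi_def r_def a_def)
  moreover have "2 powr (a / 8) * (2 powr (- a / 8) * r powr (- a)) = r powr (- a)"
    by (simp add: mult.assoc[symmetric] flip: powr_add)
  ultimately have "r powr (- a) \<le> 2 powr (a / 8) * Phi s x" by (simp only:)
  then show ?thesis by (simp only: r_def a_def)
qed

text \<open>For an integer n \<ge> a, z^n is (4 n)^n times the n-th power of z / (4 n) \<le> e^(z /
  (4 n)).\<close>

lemma powr_exp_bounded:
  assumes "a > 0"
  shows "\<exists>C\<ge>0. \<forall>z\<ge>1. z powr a * exp (- (z / 4)) \<le> (C::real)"
proof -
  define n where "n = nat \<lceil>a\<rceil>"
  have n: "real n > 0" using assms by (simp add: n_def)
  have "z powr a * exp (- (z / 4)) \<le> (4 * real n) ^ n" if z: "z \<ge> 1" for z :: real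
  proof -
    have "z powr a \<le> z powr (real n)" using z by (intro powr_mono) (auto simp: n_def real_nat_ceiling_ge)
    also have "\<dots> = z ^ n" using z by (simp add: powr_realpow)
    also have "\<dots> = (4 * real n) ^ n * (z / (4 * real n)) ^ n"
      using n by (simp add: power_divide power_mult_distrib)
    also have "\<dots> \<le> (4 * real n) ^ n * exp (z / (4 * real n)) ^ n"
    proof (intro mult_left_mono power_mono)
      show "z / (4 * real n) \<le> exp (z / (4 * real n))"
        using exp_ge_add_one_self[of "z / (4 * real n)"] by linarith
    qed (use z n in auto)
    also have "exp (z / (4 * real n)) ^ n = exp (z / 4)"
      using n by (simp flip: exp_of_nat_mult)
    finally have "z powr a * exp (- (z / 4)) \<le> (4 * real n) ^ n * exp (z / 4) * exp (- (z / 4))"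
      by (intro mult_right_mono) auto
    also have "\<dots> = (4 * real n) ^ n"
      unfolding mult.assoc exp_add[symmetric] by simp
    finally show ?thesis .
  qed
  then show ?thesis by (intro exI[of _ "(4 * real n) ^ n"]) auto
qed

text \<open>Split at l = |x|^2. Below, e^(-z/4) with z = |x|^2 / l beats z^a, so the integrand is at
  most C |x|^(-2 a) on an interval of length |x|^2; above, the exponential is dropped and a power
  tail remains. Both pieces have the order of \<Phi>.\<close>

lemma wgt_le_Phi:
  assumes s: "0 < s" "s < 1"
  shows "\<exists>C\<ge>0. \<forall>x::'a::euclidean_space. wgt s x \<le> ennreal (C * Phi s x)"
proof -
  \<comment> \<open>Half the dimension: the power of l in the prefactor of the heat kernel.\<close>
  define N where "N = real DIM('a) / 2"
  define a where "a = 1 + s + N"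
  have N: "N \<ge> 0" by (simp add: N_def)
  have a: "a > 0" using s N by (simp add: a_def)
  obtain C where C: "C \<ge> 0" "\<And>z. z \<ge> 1 \<Longrightarrow> z powr a * exp (- (z / 4)) \<le> C"
    using powr_exp_bounded[OF a] by blast
  have heat_ker_le: "heat_ker l x \<le> l powr (- N) * exp (- ((norm x)\<^sup>2 / (4 * l)))" if "l > 0" for l and x :: 'a
  proof -
    have "1 / sqrt (4 * pi * l) \<le> 1 / sqrt l"
    proof (rule divide_left_mono)
      show "sqrt l \<le> sqrt (4 * pi * l)"
        using that pi_gt3 mult_right_mono[of 1 "4 * pi" l] by (intro real_sqrt_le_mono) auto
    qed (use that in auto)
    then have "(1 / sqrt (4 * pi * l)) ^ DIM('a) \<le> (1 / sqrt l) ^ DIM('a)"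
      using that by (intro power_mono) auto
    also have "(1 / sqrt l) = l powr (- 1 / 2)"
      using powr_minus[of l "1 / 2"] powr_half_sqrt[of l] that by (simp add: inverse_eq_divide)
    also have "(l powr (- 1 / 2)) ^ DIM('a) = l powr (- N)"
      using that by (subst powr_power) (simp_all add: N_def)
    finally show ?thesis using that by (auto simp: heat_ker_eq intro!: mult_right_mono)
  qed
  define B where "B = max (1 / s) (2 powr ((real DIM('a) + 2 * s) / 8) * (C + 1 / (s + N)))"
  have B: "B \<ge> 0" using s by (simp add: B_def le_max_iff_disj)
  have "wgt s x \<le> ennreal (B * Phi s x)" for x :: 'a
  proof (cases "norm x \<le> 1")
    case True
    have "wgt s x \<le> (\<integral>\<^sup>+l. indicator {1..} l * ennreal (l powr (-1 - s)) \<partial>lborel)"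
      unfolding wgt_def
    proof (rule nn_integral_mono)
      fix l :: real
      have "heat_ker l x \<le> 1" if "l \<ge> 1"
      proof -
        have "heat_ker l x \<le> l powr (- N) * exp (- ((norm x)\<^sup>2 / (4 * l)))" using heat_ker_le that by auto
        also have "\<dots> \<le> l powr 0 * exp 0" using that N by (intro mult_mono powr_mono) auto
        finally show ?thesis using that by simp
      qed
      then show "indicator {1..} l * ennreal (l powr (-1 - s)) * ennreal (heat_ker l x) \<le> indicator {1..} l * ennreal (l powr (-1 - s))"
        by (auto simp: indicator_def intro!: ennreal_leI mult_left_le simp flip: ennreal_mult)
    qed
    also have "\<dots> = ennreal (1 / s)" using nn_integral_powr_tail[of 1 s] s by simp
    also have "\<dots> \<le> ennreal (B * Phi s x)" using True by (intro ennreal_leI) (simp add: Phi_def B_def)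
    finally show ?thesis .
  next
    case False
    define r where "r = norm x"
    have r: "r > 1" using False by (simp add: r_def)
    have "wgt s x \<le> (\<integral>\<^sup>+l. ennreal (C * r powr (- (2 * a))) * indicator {0..r\<^sup>2} l + indicator {r\<^sup>2..} l * ennreal (l powr (-1 - (s + N))) \<partial>lborel)"
      unfolding wgt_def
    proof (rule nn_integral_mono)
      fix l :: real
      show "indicator {1..} l * ennreal (l powr (-1 - s)) * ennreal (heat_ker l x) \<le>
        ennreal (C * r powr (- (2 * a))) * indicator {0..r\<^sup>2} l + indicator {r\<^sup>2..} l * ennreal (l powr (-1 - (s + N)))"
      proof (cases "l \<ge> 1")
        case True
        have "l powr (-1 - s) * heat_ker l x \<le> l powr (-1 - s) * (l powr (- N) * exp (- ((norm x)\<^sup>2 / (4 * l))))"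
          using heat_ker_le[of l x] True by (intro mult_left_mono) auto
        also have "\<dots> = l powr (- a) * exp (- (r\<^sup>2 / (4 * l)))"
          using True by (simp add: a_def r_def mult.assoc[symmetric] algebra_simps flip: powr_add)
        finally have 1: "l powr (-1 - s) * heat_ker l x \<le> l powr (- a) * exp (- (r\<^sup>2 / (4 * l)))" .
        show ?thesis
        proof (cases "l \<ge> r\<^sup>2")
          case True
          have "l powr (- a) * exp (- (r\<^sup>2 / (4 * l))) \<le> l powr (-1 - (s + N))"
            using \<open>l \<ge> 1\<close> by (simp add: a_def mult_left_le algebra_simps)
          with 1 True \<open>l \<ge> 1\<close> show ?thesis
            by (auto simp: indicator_def simp flip: ennreal_mult ennreal_plus intro!: ennreal_leI order_trans[OF ennreal_leI add_increasing])
        next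
          case False
          have "(r\<^sup>2 / l) powr a * exp (- ((r\<^sup>2 / l) / 4)) \<le> C"
            using False \<open>l \<ge> 1\<close> by (intro C) (auto simp: field_simps)
          then have "r powr (- (2 * a)) * ((r\<^sup>2 / l) powr a * exp (- ((r\<^sup>2 / l) / 4))) \<le> r powr (- (2 * a)) * C"
            by (intro mult_left_mono) auto
          moreover have "r powr (- (2 * a)) * ((r\<^sup>2 / l) powr a * exp (- ((r\<^sup>2 / l) / 4))) = l powr (- a) * exp (- (r\<^sup>2 / (4 * l)))"
          proof -
            have "(r\<^sup>2 / l) powr a = r powr (2 * a) * l powr (- a)"
              using r \<open>l \<ge> 1\<close> by (simp add: powr_divide powr_minus_divide power_powr)
            moreover have "r powr (- (2 * a)) * r powr (2 * a) = 1" using r by (simp flip: powr_add)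
            moreover have "r powr (- (2 * a)) * ((r powr (2 * a) * l powr (- a)) * exp (- ((r\<^sup>2 / l) / 4)))
                = (r powr (- (2 * a)) * r powr (2 * a)) * (l powr (- a) * exp (- ((r\<^sup>2 / l) / 4)))"
              by (simp only: ac_simps)
            moreover have "(r\<^sup>2 / l) / 4 = r\<^sup>2 / (4 * l)" by simp
            ultimately show ?thesis by (simp only: mult_1)
          qed
          ultimately have "l powr (- a) * exp (- (r\<^sup>2 / (4 * l))) \<le> r powr (- (2 * a)) * C" by (simp only:)
          with 1 have "l powr (-1 - s) * heat_ker l x \<le> C * r powr (- (2 * a))" unfolding mult.commute[of C] by (rule order_trans)
          then show ?thesis using False \<open>l \<ge> 1\<close>
            by (auto simp: indicator_def simp flip: ennreal_mult intro!: ennreal_leI)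
        qed
      qed simp
    qed
    also have "\<dots> = ennreal (C * r powr (- (2 * a))) * ennreal (r\<^sup>2) + ennreal ((r\<^sup>2) powr (- (s + N)) / (s + N))"
      using nn_integral_powr_tail[of "r\<^sup>2" "s + N"] r s N
      by (subst nn_integral_add) (auto simp: nn_integral_cmult_indicator)
    also have "\<dots> = ennreal ((C + 1 / (s + N)) * r powr (- (real DIM('a) + 2 * s)))"
    proof -
      have "r powr (- (2 * a)) * r\<^sup>2 = r powr (- (real DIM('a) + 2 * s))"
      proof -
        have "r powr (- (2 * a)) * r powr 2 = r powr (- (real DIM('a) + 2 * s))"
          unfolding powr_add[symmetric] by (rule arg_cong[where f = "\<lambda>p. r powr p"]) (simp add: a_def N_def field_simps)
        then show ?thesis using r by simp
      qed
      moreover have "(r\<^sup>2) powr (- (s + N)) = r powr (- (real DIM('a) + 2 * s))"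
      proof -
        have e: "real 2 * - (s + N) = - (real DIM('a) + 2 * s)" by (simp add: N_def)
        show ?thesis using r power_powr[of r 2 "- (s + N)"] unfolding e by simp
      qed
      ultimately have "C * r powr (- (2 * a)) * r\<^sup>2 + (r\<^sup>2) powr (- (s + N)) / (s + N) = (C + 1 / (s + N)) * r powr (- (real DIM('a) + 2 * s))"
        by (simp only: mult.assoc) (simp add: distrib_right)
      then show ?thesis using C(1) s N
        by (simp flip: ennreal_mult ennreal_plus)
    qed
    also have "\<dots> \<le> ennreal (B * Phi s x)"
    proof (rule ennreal_leI)
      have "(C + 1 / (s + N)) * r powr (- (real DIM('a) + 2 * s)) \<le> (C + 1 / (s + N)) * (2 powr ((real DIM('a) + 2 * s) / 8) * Phi s x)"
        using Phi_lower[of x s] r s N C(1) by (intro mult_left_mono) (auto simp: r_def)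
      also have "\<dots> = (2 powr ((real DIM('a) + 2 * s) / 8) * (C + 1 / (s + N))) * Phi s x" by simp
      also have "\<dots> \<le> B * Phi s x"
        using Phi_pos[of s x] by (intro mult_right_mono) (auto simp: B_def)
      finally show "(C + 1 / (s + N)) * r powr (- (real DIM('a) + 2 * s)) \<le> B * Phi s x" .
    qed
    finally show ?thesis .
  qed
  then show ?thesis using B by blast
qed

section \<open>Heat flow of bumps\<close>

text \<open>Real-valued counterpart of \<open>heat\<close>, for the signed difference g - H l g and
  for the Fourier formulas.\<close>

definition heatr :: "real \<Rightarrow> ('a::euclidean_space \<Rightarrow> real) \<Rightarrow> 'a \<Rightarrow> real" where
  "heatr l g x = (\<integral>y. heat_ker l (x - y) * g y \<partial>lborel)"

lemma nn_integral_lborel_reflect: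
  fixes f :: "'a::euclidean_space \<Rightarrow> ennreal"
  assumes [measurable]: "f \<in> borel_measurable borel"
  shows "(\<integral>\<^sup>+y. f (x - y) \<partial>lborel) = (\<integral>\<^sup>+y. f y \<partial>lborel)"
proof -
  have "(\<integral>\<^sup>+y. f y \<partial>lborel) = (\<integral>\<^sup>+y. f y \<partial>(density (distr lborel borel (\<lambda>y. x + (-1) *\<^sub>R y)) (\<lambda>_. \<bar>(-1)::real\<bar> ^ DIM('a))))"
    by (subst lborel_affine[of "-1" x]) auto
  also have "\<dots> = (\<integral>\<^sup>+y. f (x - y) \<partial>lborel)"
    by (simp add: nn_integral_density nn_integral_distr)
  finally show ?thesis by simp
qed

lemma heatr_heat:
  fixes g :: "'a::euclidean_space \<Rightarrow> real"
  assumes [measurable]: "g \<in> borel_measurable borel" and g: "\<And>y. 0 \<le> g y" "\<And>y. g y \<le> M" and l: "l > 0"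
  shows "integrable lborel (\<lambda>y. heat_ker l (x - y) * g y)"
    "ennreal (heatr l g x) = heat l (\<lambda>y. ennreal (g y)) x" "0 \<le> heatr l g x" "heatr l g x \<le> M"
proof -
  have M: "0 \<le> M" using g[of 0] by linarith
  have "(\<integral>\<^sup>+y. ennreal (heat_ker l (x - y) * g y) \<partial>lborel) \<le> (\<integral>\<^sup>+y. ennreal M * ennreal (heat_ker l (x - y)) \<partial>lborel)"
    using g M by (intro nn_integral_mono) (auto simp: mult.commute intro!: ennreal_leI mult_right_mono simp flip: ennreal_mult)
  also have "\<dots> = ennreal M"
    using nn_integral_lborel_reflect[of "\<lambda>y. ennreal (heat_ker l y)" x] nn_integral_heat_ker[OF l, where 'a = 'a] by (simp add: nn_integral_cmult)
  finally have le: "(\<integral>\<^sup>+y. ennreal (heat_ker l (x - y) * g y) \<partial>lborel) \<le> ennreal M" .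
  show i: "integrable lborel (\<lambda>y. heat_ker l (x - y) * g y)"
    using le_less_trans[OF le ennreal_less_top] g by (intro integrableI_nonneg) auto
  have e: "ennreal (heatr l g x) = (\<integral>\<^sup>+y. ennreal (heat_ker l (x - y) * g y) \<partial>lborel)"
    unfolding heatr_def using g by (intro nn_integral_eq_integral[symmetric] i) auto
  then show "ennreal (heatr l g x) = heat l (\<lambda>y. ennreal (g y)) x"
    unfolding heat_def using g by (simp add: ennreal_mult)
  show "0 \<le> heatr l g x" unfolding heatr_def using g by (intro Bochner_Integration.integral_nonneg) auto
  show "heatr l g x \<le> M" using le unfolding e[symmetric] using M by simp
qed

text \<open>For l \<le> 1, half of the exponent y^2 / (4 l) absorbs y^2 / 16, and the other half is
  a Gaussian of twice the variance; the factor 2 exceeds the loss sqrt 2 in the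
  normalisation.\<close>

lemma normal_density_gauss_le:
  assumes "0 < l" "l \<le> 1"
  shows "normal_density 0 (sqrt (2 * l)) y * exp (y\<^sup>2 / 16) \<le> 2 * normal_density 0 (2 * sqrt l) y"
proof -
  have "exp (- (y\<^sup>2 / (4 * l))) * exp (y\<^sup>2 / 16) \<le> exp (- (y\<^sup>2 / (8 * l)))"
  proof -
    have "y\<^sup>2 / 16 \<le> y\<^sup>2 / (8 * l)" using assms by (intro divide_left_mono) auto
    then have "- (y\<^sup>2 / (4 * l)) + y\<^sup>2 / 16 \<le> - (y\<^sup>2 / (8 * l))" using assms by (simp add: field_simps)
    then show ?thesis by (simp flip: exp_add)
  qed
  moreover have "1 / sqrt (4 * pi * l) \<le> 2 * (1 / sqrt (8 * pi * l))"
  proof -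
    have "sqrt (8 * pi * l) \<le> sqrt (16 * pi * l)" using assms by (intro real_sqrt_le_mono) auto
    also have "\<dots> = 2 * sqrt (4 * pi * l)" using real_sqrt_mult[of 4 "4 * pi * l"] by (simp add: mult.assoc)
    finally show ?thesis using assms by (simp add: field_simps)
  qed
  ultimately have "1 / sqrt (4 * pi * l) * (exp (- (y\<^sup>2 / (4 * l))) * exp (y\<^sup>2 / 16)) \<le> 2 * (1 / sqrt (8 * pi * l)) * exp (- (y\<^sup>2 / (8 * l)))"
    using assms by (intro mult_mono) auto
  moreover have "normal_density 0 (sqrt (2 * l)) y = 1 / sqrt (4 * pi * l) * exp (- (y\<^sup>2 / (4 * l)))"
    "normal_density 0 (2 * sqrt l) y = 1 / sqrt (8 * pi * l) * exp (- (y\<^sup>2 / (8 * l)))"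
    using assms by (simp_all add: normal_density_def power_mult_distrib ac_simps)
  ultimately show ?thesis by (simp add: mult.assoc)
qed

text \<open>The mean value inequality for f' and then for the even function z \<mapsto> f(x + z) +
  f(x - z), whose derivative is therefore at most 2 M |z|.\<close>

lemma second_difference_bound:
  assumes f: "smooth1 f" and M: "\<And>t. \<bar>deriv (deriv f) t\<bar> \<le> M"
  shows "\<bar>f (x + y) + f (x - y) - 2 * f x\<bar> \<le> 2 * M * y\<^sup>2"
proof -
  note d1 = smooth1_deriv(1)[OF f] and d2 = smooth1_deriv(1)[OF smooth1_deriv(2)[OF f]]
  have M0: "M \<ge> 0" using M[of 0] by linarith
  have b1: "\<bar>deriv f (x + z) - deriv f (x - z)\<bar> \<le> M * (2 * \<bar>z\<bar>)" for z
    using field_differentiable_bound[of UNIV "deriv f" "deriv (deriv f)" M "x + z" "x - z"] d2 M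
    by (auto simp: abs_mult)
  have "norm ((f (x + y) + f (x - y)) - (f (x + 0) + f (x - 0))) \<le> (M * (2 * \<bar>y\<bar>)) * norm (y - 0)"
  proof (rule field_differentiable_bound[of "{- \<bar>y\<bar>..\<bar>y\<bar>}" "\<lambda>z. f (x + z) + f (x - z)" "\<lambda>z. deriv f (x + z) - deriv f (x - z)"])
    fix z assume z: "z \<in> {- \<bar>y\<bar>..\<bar>y\<bar>}"
    have "((\<lambda>z. f (x + z)) has_real_derivative deriv f (x + z) * 1) (at z)"
      by (rule DERIV_chain2[OF d1]) (auto intro!: derivative_eq_intros)
    moreover have "((\<lambda>z. f (x - z)) has_real_derivative deriv f (x - z) * (- 1)) (at z)"
      by (rule DERIV_chain2[OF d1]) (auto intro!: derivative_eq_intros)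
    ultimately show "((\<lambda>z. f (x + z) + f (x - z)) has_real_derivative deriv f (x + z) - deriv f (x - z)) (at z within {- \<bar>y\<bar>..\<bar>y\<bar>})"
      by (auto intro!: derivative_eq_intros intro: has_field_derivative_at_within)
    have "M * (2 * \<bar>z\<bar>) \<le> M * (2 * \<bar>y\<bar>)" using z M0 by (intro mult_left_mono) auto
    with b1[of z] show "norm (deriv f (x + z) - deriv f (x - z)) \<le> M * (2 * \<bar>y\<bar>)" by simp
  qed auto
  then show ?thesis by (simp add: power2_eq_square ac_simps flip: abs_mult)
qed

lemma bounded_compact_support1:
  assumes "smooth1 f" "\<And>t. t \<notin> {a..b} \<Longrightarrow> f t = 0"
  shows "\<exists>M\<ge>0. \<forall>t. \<bar>f t\<bar> \<le> M"
  using bounded_compact_support[OF smooth1_continuous[OF assms(1)], of a b] assms(2) by simp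

text \<open>Symmetrising in y replaces f(x - y) - f(x) by half the second difference, which is
  O(y^2), and the second moment of the Gaussian supplies the factor l. The decay in x holds because
  a second difference centred far from the support vanishes unless the step y is large.\<close>

lemma heat1_estimate:
  assumes f: "smooth1 f" and supp: "\<And>t. t \<notin> {-R..R} \<Longrightarrow> f t = 0" and R: "R \<ge> 0"
  shows "\<exists>C\<ge>0. \<forall>l x. 0 < l \<longrightarrow> l \<le> 1 \<longrightarrow>
    \<bar>(\<integral>y. normal_density 0 (sqrt (2 * l)) (x - y) * f y \<partial>lborel) - f x\<bar> \<le> C * l * exp (- (x\<^sup>2 / 64))"
proof -
  have [measurable]: "f \<in> borel_measurable borel"
    by (intro borel_measurable_continuous_onI smooth1_continuous f)
  obtain M0 where M0: "\<And>t. \<bar>f t\<bar> \<le> M0" using bounded_compact_support1[OF f supp] by blast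
  have "\<exists>M\<ge>0. \<forall>t. \<bar>deriv (deriv f) t\<bar> \<le> M"
  proof (rule bounded_compact_support1[of _ "-R" R])
    show "t \<notin> {-R..R} \<Longrightarrow> deriv (deriv f) t = 0" for t
      by (rule deriv_zero_outside[OF deriv_zero_outside[OF supp]])
  qed (intro smooth1_deriv f)
  then obtain M where M: "M \<ge> 0" "\<And>t. \<bar>deriv (deriv f) t\<bar> \<le> M" by blast
  \<comment> \<open>Half of 2 A times the second moment 4 l, for the \<open>A\<close> chosen below,
    without its factor depending on x.\<close>
  define C where "C = 8 * M * exp (R\<^sup>2 / 16)"
  have "\<bar>(\<integral>y. normal_density 0 (sqrt (2 * l)) (x - y) * f y \<partial>lborel) - f x\<bar> \<le> C * l * exp (- (x\<^sup>2 / 64))"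
    if l: "0 < l" "l \<le> 1" for l x
  proof -
    let ?n = "normal_density 0 (sqrt (2 * l))"
    have n_even: "?n (- y) = ?n y" for y by (simp add: normal_density_def)
    have ni: "integrable lborel ?n" using l by (intro integrable_normal_density) simp
    have bi: "integrable lborel (\<lambda>y. ?n y * h y)" if [measurable]: "h \<in> borel_measurable borel" and "\<And>y. \<bar>h y\<bar> \<le> M0" for h
    proof (rule Bochner_Integration.integrable_bound[of _ "\<lambda>y. M0 * ?n y"])
      show "AE y in lborel. norm (?n y * h y) \<le> norm (M0 * ?n y)"
      proof (rule AE_I2)
        fix y
        have "\<bar>h y\<bar> \<le> \<bar>M0\<bar>" using that(2)[of y] by linarith
        from mult_right_mono[OF this, of "?n y"] show "norm (?n y * h y) \<le> norm (M0 * ?n y)"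
          by (simp add: abs_mult mult.commute)
      qed
    qed (use ni in auto)
    have i1: "integrable lborel (\<lambda>y. ?n y * f (x + y))" "integrable lborel (\<lambda>y. ?n y * f (x - y))"
      by (rule bi, measurable, rule M0)+
    have i2: "integrable lborel (\<lambda>y. ?n y * f x)" using ni by auto
    have e1: "(\<integral>y. ?n (x - y) * f y \<partial>lborel) = (\<integral>y. ?n y * f (x - y) \<partial>lborel)"
      using lborel_integral_real_affine[of "-1" "\<lambda>y. ?n (x - y) * f y" x] by (simp add: n_even)
    have e2: "(\<integral>y. ?n (x - y) * f y \<partial>lborel) = (\<integral>y. ?n y * f (x + y) \<partial>lborel)"
      using lborel_integral_real_affine[of "1" "\<lambda>y. ?n (x - y) * f y" x] by (simp add: n_even)
    have e3: "(\<integral>y. ?n y * f x \<partial>lborel) = f x" using l by simp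
    have "2 * ((\<integral>y. ?n (x - y) * f y \<partial>lborel) - f x) = (\<integral>y. ?n y * f (x + y) + ?n y * f (x - y) - 2 * (?n y * f x) \<partial>lborel)"
      using i1 i2 e1 e2 e3 by simp
    also have "\<dots> = (\<integral>y. ?n y * (f (x + y) + f (x - y) - 2 * f x) \<partial>lborel)"
      by (simp add: algebra_simps)
    finally have eq: "2 * ((\<integral>y. ?n (x - y) * f y \<partial>lborel) - f x) = (\<integral>y. ?n y * (f (x + y) + f (x - y) - 2 * f x) \<partial>lborel)" .
    define A where "A = 2 * M * (exp (R\<^sup>2 / 16) * exp (- (x\<^sup>2 / 64)))"
    have A: "A \<ge> 0" using M by (simp add: A_def)
    have sd: "\<bar>f (x + y) + f (x - y) - 2 * f x\<bar> \<le> A * (y\<^sup>2 * exp (y\<^sup>2 / 16))" for y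
    proof (cases "f (x + y) + f (x - y) - 2 * f x = 0")
      case False
      have "1 \<le> exp (R\<^sup>2 / 16) * exp (- (x\<^sup>2 / 64)) * exp (y\<^sup>2 / 16)"
      proof -
        \<comment> \<open>One of the three points lies in [-R, R], so x^2 \<le> 4 R^2 or x^2 \<le> 4
          y^2; hence 64 = 4 * 16 in the exponent.\<close>
        have "\<bar>x\<bar> \<le> R \<or> \<bar>x + y\<bar> \<le> R \<or> \<bar>x - y\<bar> \<le> R"
        proof (rule ccontr)
          assume "\<not> ?thesis"
          then have "f x = 0" "f (x + y) = 0" "f (x - y) = 0" by (auto intro!: supp)
          then show False using False by simp
        qed
        then have "\<bar>x\<bar> \<le> 2 * R \<or> \<bar>x\<bar> \<le> 2 * \<bar>y\<bar>" using R by linarith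
        then have "x\<^sup>2 \<le> (2 * R)\<^sup>2 \<or> x\<^sup>2 \<le> (2 * y)\<^sup>2"
          using abs_le_square_iff[of x "2 * R"] abs_le_square_iff[of x "2 * y"] R by auto
        then have "x\<^sup>2 \<le> 4 * R\<^sup>2 \<or> x\<^sup>2 \<le> 4 * y\<^sup>2" by (simp add: power_mult_distrib)
        moreover have "0 \<le> y\<^sup>2" "0 \<le> R\<^sup>2" by simp_all
        ultimately have "0 \<le> R\<^sup>2 / 16 + - (x\<^sup>2 / 64) + y\<^sup>2 / 16" by linarith
        then show ?thesis by (simp flip: exp_add)
      qed
      then have "2 * M * y\<^sup>2 * 1 \<le> 2 * M * y\<^sup>2 * (exp (R\<^sup>2 / 16) * exp (- (x\<^sup>2 / 64)) * exp (y\<^sup>2 / 16))"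
        using M by (intro mult_left_mono) auto
      with second_difference_bound[OF f M(2), of x y] show ?thesis by (simp add: A_def ac_simps)
    qed (use A in auto)
    have mom: "integrable lborel (\<lambda>y. normal_density 0 (2 * sqrt l) y * y\<^sup>2)" "(\<integral>y. normal_density 0 (2 * sqrt l) y * y\<^sup>2 \<partial>lborel) = 4 * l"
      using integrable_normal_moment[of "2 * sqrt l" 0 2] integral_normal_moment_even[of "2 * sqrt l" 0 1] l
      by (simp_all add: power_mult_distrib)
    have "\<bar>\<integral>y. ?n y * (f (x + y) + f (x - y) - 2 * f x) \<partial>lborel\<bar> \<le> (\<integral>y. 2 * A * (normal_density 0 (2 * sqrt l) y * y\<^sup>2) \<partial>lborel)"
    proof (rule Bochner_Integration.integral_abs_bound_integral)
      show "integrable lborel (\<lambda>y. ?n y * (f (x + y) + f (x - y) - 2 * f x))"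
      proof -
        have "integrable lborel (\<lambda>y. ?n y * f (x + y) + ?n y * f (x - y) - 2 * (?n y * f x))" using i1 i2 by auto
        then show ?thesis by (simp add: algebra_simps)
      qed
      show "integrable lborel (\<lambda>y. 2 * A * (normal_density 0 (2 * sqrt l) y * y\<^sup>2))" using mom by auto
      fix y
      have "\<bar>?n y * (f (x + y) + f (x - y) - 2 * f x)\<bar> \<le> ?n y * (A * (y\<^sup>2 * exp (y\<^sup>2 / 16)))"
        using sd[of y] by (auto simp: abs_mult intro!: mult_left_mono)
      also have "\<dots> = (A * y\<^sup>2) * (?n y * exp (y\<^sup>2 / 16))" by simp
      also have "\<dots> \<le> (A * y\<^sup>2) * (2 * normal_density 0 (2 * sqrt l) y)"
        using A normal_density_gauss_le[OF l] by (intro mult_left_mono) auto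
      finally show "\<bar>?n y * (f (x + y) + f (x - y) - 2 * f x)\<bar> \<le> 2 * A * (normal_density 0 (2 * sqrt l) y * y\<^sup>2)"
        by (simp add: ac_simps)
    qed
    also have "\<dots> = 8 * A * l" using mom by simp
    finally have "\<bar>2 * ((\<integral>y. ?n (x - y) * f y \<partial>lborel) - f x)\<bar> \<le> 8 * A * l" unfolding eq .
    then show ?thesis by (simp add: C_def A_def abs_mult ac_simps)
  qed
  then show ?thesis using M by (intro exI[of _ C]) (auto simp: C_def)
qed

text \<open>One radius \<open>R\<close> serves all coordinates. Nonnegativity allows these functions
  to be fed to \<open>heat\<close> and \<open>jump\<close>, which act on
  \<open>ennreal\<close>-valued functions.\<close>

definition bumplike :: "('a::euclidean_space \<Rightarrow> real \<Rightarrow> real) \<Rightarrow> bool" where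
  "bumplike f \<longleftrightarrow> (\<forall>b\<in>Basis. smooth1 (f b) \<and> (\<forall>t. 0 \<le> f b t)) \<and> (\<exists>R\<ge>0. \<forall>b\<in>Basis. \<forall>t. t \<notin> {-R..R} \<longrightarrow> f b t = 0)"

lemma bumplike_nonneg: "bumplike f \<Longrightarrow> 0 \<le> tensor f x"
  by (auto simp: bumplike_def tensor_def intro!: prod_nonneg)

lemma bumplike_measurable: "bumplike f \<Longrightarrow> tensor f \<in> borel_measurable borel"
  by (intro tensor_measurable borel_measurable_continuous_onI smooth1_continuous) (auto simp: bumplike_def)

text \<open>Both the bump and its flow factor over the coordinates. Dividing each factor by
  \<open>A E\<close> makes all of them at most 1, so the difference of the two products is at most
  the sum of the one-dimensional differences; the product of the \<open>E\<close> is the Gaussian in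
  x.\<close>

lemma bumplike_heat:
  fixes f :: "'a::euclidean_space \<Rightarrow> real \<Rightarrow> real"
  assumes f: "bumplike f"
  shows "\<exists>C\<ge>0. \<forall>x. tensor f x \<le> C * exp (- ((norm x)\<^sup>2 / 64)) \<and>
     (\<forall>l. 0 < l \<longrightarrow> l \<le> 1 \<longrightarrow> \<bar>tensor f x - heatr l (tensor f) x\<bar> \<le> C * l * exp (- ((norm x)\<^sup>2 / 64)))"
proof -
  from f obtain R where R: "R \<ge> 0" "\<And>b t. b \<in> Basis \<Longrightarrow> t \<notin> {-R..R} \<Longrightarrow> f b t = 0"
    by (auto simp: bumplike_def)
  have sm: "smooth1 (f b)" and nn: "0 \<le> f b t" if "b \<in> Basis" for b t
    using f that by (auto simp: bumplike_def)
  have [measurable]: "f b \<in> borel_measurable borel" if "b \<in> Basis" for b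
    by (intro borel_measurable_continuous_onI smooth1_continuous sm that)
  define F where "F = (\<lambda>l b x. \<integral>y. normal_density 0 (sqrt (2 * l)) (x - y) * f b y \<partial>lborel)"
  define E where "E = (\<lambda>t::real. exp (- (t\<^sup>2 / 64)))"
  have "\<exists>C\<ge>0. (\<forall>l x. 0 < l \<longrightarrow> l \<le> 1 \<longrightarrow> \<bar>F l b x - f b x\<bar> \<le> C * l * E x)" if "b \<in> Basis" for b
    unfolding F_def E_def using heat1_estimate[OF sm[OF that] _ R(1)] R(2)[OF that] by blast
  then obtain C1 where C1: "\<And>b. b \<in> Basis \<Longrightarrow> C1 b \<ge> 0"
      "\<And>b l x. b \<in> Basis \<Longrightarrow> 0 < l \<Longrightarrow> l \<le> 1 \<Longrightarrow> \<bar>F l b x - f b x\<bar> \<le> C1 b * l * E x" by metis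
  have "\<exists>M\<ge>0. \<forall>t. \<bar>f b t\<bar> \<le> M" if "b \<in> Basis" for b
    using bounded_compact_support1[OF sm[OF that] R(2)[OF that]] by blast
  then obtain M where M: "\<And>b. b \<in> Basis \<Longrightarrow> M b \<ge> 0" "\<And>b t. b \<in> Basis \<Longrightarrow> \<bar>f b t\<bar> \<le> M b" by metis
  \<comment> \<open>\<open>A\<close> bounds each factor and its flow relative to \<open>E\<close>;
    the 1 keeps it positive for the later division.\<close>
  define A where "A = 1 + (\<Sum>b\<in>Basis. C1 b + M b * exp (R\<^sup>2 / 64))"
  have Ab: "C1 b + M b * exp (R\<^sup>2 / 64) \<le> A" if "b \<in> Basis" for b
    unfolding A_def using C1(1) M(1) member_le_sum[OF that, of "\<lambda>b. C1 b + M b * exp (R\<^sup>2 / 64)"] by auto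
  have A: "A > 0" unfolding A_def using C1(1) M(1) by (intro add_pos_nonneg sum_nonneg) auto
  have E: "E t > 0" for t by (simp add: E_def)
  have fE: "f b t \<le> M b * exp (R\<^sup>2 / 64) * E t" if b: "b \<in> Basis" for b t
  proof (cases "t \<in> {-R..R}")
    case True
    then have "t\<^sup>2 \<le> R\<^sup>2" using abs_le_square_iff[of t R] R by auto
    then have "1 \<le> exp (R\<^sup>2 / 64) * E t" by (simp add: E_def flip: exp_add)
    then have "M b * 1 \<le> M b * (exp (R\<^sup>2 / 64) * E t)" using M(1)[OF b] by (intro mult_left_mono) auto
    with M(2)[OF b, of t] show ?thesis by (simp add: mult.assoc)
  next
    case False
    then show ?thesis using R(2)[OF b False] M(1)[OF b] E[of t] by auto
  qed
  have prodE: "(\<Prod>b\<in>Basis. A * E (x \<bullet> b)) = A ^ DIM('a) * exp (- ((norm x)\<^sup>2 / 64))" for x :: 'a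
  proof -
    have "(\<Prod>b\<in>Basis. A * E (x \<bullet> b)) = A ^ DIM('a) * exp (\<Sum>b\<in>(Basis::'a set). - ((x \<bullet> b)\<^sup>2 / 64))"
      unfolding E_def by (simp only: prod.distrib prod_constant exp_sum[OF finite_Basis])
    also have "(\<Sum>b\<in>(Basis::'a set). - ((x \<bullet> b)\<^sup>2 / 64)) = - ((norm x)\<^sup>2 / 64)"
      unfolding power2_norm_eq_inner euclidean_inner[of x x]
      by (simp add: sum_negf sum_divide_distrib power2_eq_square)
    finally show ?thesis .
  qed
  have fA: "f b t \<le> A * E t" if b: "b \<in> Basis" for b t
  proof -
    have "M b * exp (R\<^sup>2 / 64) * E t \<le> A * E t"
      using Ab[OF b] C1(1)[OF b] E[of t] by (intro mult_right_mono) auto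
    with fE[OF b, of t] show ?thesis by linarith
  qed
  have FA: "F l b t \<le> A * E t" if b: "b \<in> Basis" and l: "0 < l" "l \<le> 1" for l b t
  proof -
    have "C1 b * l * E t \<le> C1 b * 1 * E t" using C1(1)[OF b] E[of t] l by (intro mult_right_mono mult_left_mono) auto
    with C1(2)[OF b l, of t] fE[OF b, of t] have "F l b t \<le> (C1 b + M b * exp (R\<^sup>2 / 64)) * E t"
      by (simp add: distrib_right)
    also have "\<dots> \<le> A * E t" using Ab[OF b] E[of t] by (intro mult_right_mono) auto
    finally show ?thesis .
  qed
  have Fnn: "0 \<le> F l b t" if "b \<in> Basis" for l b t
    unfolding F_def using nn[OF that] by (intro Bochner_Integration.integral_nonneg) auto
  have hrF: "heatr l (tensor f) x = (\<Prod>b\<in>Basis. F l b (x \<bullet> b))" if l: "0 < l" "l \<le> 1" for l x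
  proof -
    have bd: "tensor f y \<le> (\<Prod>b\<in>(Basis::'a set). M b)" for y
      unfolding tensor_def using M nn by (intro prod_mono) (auto simp: abs_le_iff)
    have "ennreal (heatr l (tensor f) x) = heat l (\<lambda>y. ennreal (tensor f y)) x"
      by (rule heatr_heat[OF bumplike_measurable[OF f] bumplike_nonneg[OF f] bd l(1)])
    also have "\<dots> = (\<Prod>b\<in>Basis. \<integral>\<^sup>+y. ennreal (normal_density 0 (sqrt (2 * l)) (x \<bullet> b - y) * f b y) \<partial>lborel)"
      by (rule heat_tensor) (auto simp: nn)
    also have "\<dots> = (\<Prod>b\<in>Basis. ennreal (F l b (x \<bullet> b)))"
    proof (rule prod.cong[OF refl])
      fix b :: 'a assume b: "b \<in> Basis"
      have "integrable lborel (\<lambda>y. normal_density 0 (sqrt (2 * l)) (x \<bullet> b - y) * f b y)"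
      proof (rule Bochner_Integration.integrable_bound[of _ "\<lambda>y. M b * normal_density (x \<bullet> b) (sqrt (2 * l)) y"])
        show "integrable lborel (\<lambda>y. M b * normal_density (x \<bullet> b) (sqrt (2 * l)) y)" using l by auto
        have "normal_density 0 (sqrt (2 * l)) (x \<bullet> b - y) = normal_density (x \<bullet> b) (sqrt (2 * l)) y" for y
          by (simp add: normal_density_def power2_commute)
        then show "AE y in lborel. norm (normal_density 0 (sqrt (2 * l)) (x \<bullet> b - y) * f b y) \<le> norm (M b * normal_density (x \<bullet> b) (sqrt (2 * l)) y)"
          using M[OF b] by (auto simp: abs_mult mult.commute[of "M b"] intro!: mult_left_mono)
      qed (use b in measurable)
      then show "(\<integral>\<^sup>+y. ennreal (normal_density 0 (sqrt (2 * l)) (x \<bullet> b - y) * f b y) \<partial>lborel) = ennreal (F l b (x \<bullet> b))"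
        unfolding F_def using nn[OF b] by (intro nn_integral_eq_integral) auto
    qed
    also have "\<dots> = ennreal (\<Prod>b\<in>Basis. F l b (x \<bullet> b))" using Fnn by (intro prod_ennreal) auto
    finally show ?thesis
      using heatr_heat(3)[OF bumplike_measurable[OF f] bumplike_nonneg[OF f] bd l(1)] Fnn by (simp add: prod_nonneg)
  qed
  define B where "B = A ^ DIM('a) * (1 + real DIM('a))"
  show ?thesis
  proof (intro exI[of _ B] conjI allI impI)
    show "B \<ge> 0" using A by (simp add: B_def)
    fix x :: 'a
    let ?X = "exp (- ((norm x)\<^sup>2 / 64))"
    have "tensor f x \<le> (\<Prod>b\<in>Basis. A * E (x \<bullet> b))"
      unfolding tensor_def using nn fA by (intro prod_mono) auto
    also have "\<dots> = A ^ DIM('a) * ?X" by (rule prodE)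
    also have "\<dots> \<le> B * ?X" using A by (auto simp: B_def intro!: mult_right_mono mult_left_le[of _ _, THEN order_trans, rotated])
    finally show "tensor f x \<le> B * ?X" .
    fix l :: real assume l: "0 < l" "l \<le> 1"
    let ?z = "\<lambda>b. f b (x \<bullet> b) / (A * E (x \<bullet> b))" and ?w = "\<lambda>b. F l b (x \<bullet> b) / (A * E (x \<bullet> b))"
    have AE: "A * E t > 0" for t using A E[of t] by simp
    have "norm ((\<Prod>b\<in>Basis. ?z b) - (\<Prod>b\<in>Basis. ?w b)) \<le> (\<Sum>b\<in>Basis. norm (?z b - ?w b))"
      using fA FA[OF _ l] nn Fnn AE by (intro norm_prod_diff) (auto simp: pos_divide_le_eq abs_of_pos)
    also have "\<dots> \<le> (\<Sum>b\<in>(Basis::'a set). l)"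
    proof (rule sum_mono)
      fix b :: 'a assume b: "b \<in> Basis"
      have "\<bar>f b (x \<bullet> b) - F l b (x \<bullet> b)\<bar> \<le> C1 b * l * E (x \<bullet> b)" using C1(2)[OF b l, of "x \<bullet> b"] by (simp add: abs_minus_commute)
      also have "\<dots> \<le> A * l * E (x \<bullet> b)"
      proof -
        have "C1 b \<le> A" using Ab[OF b] M(1)[OF b] by (smt (verit) mult_nonneg_nonneg exp_ge_zero)
        then show ?thesis using l E[of "x \<bullet> b"] by (intro mult_right_mono) auto
      qed
      finally have "\<bar>f b (x \<bullet> b) - F l b (x \<bullet> b)\<bar> \<le> l * (A * E (x \<bullet> b))" by (simp add: ac_simps)
      then show "norm (?z b - ?w b) \<le> l"
        using AE[of "x \<bullet> b"] by (simp add: diff_divide_distrib[symmetric] pos_divide_le_eq)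
    qed
    finally have "\<bar>(\<Prod>b\<in>Basis. ?z b) - (\<Prod>b\<in>Basis. ?w b)\<bar> \<le> real DIM('a) * l" by simp
    moreover have "(\<Prod>b\<in>Basis. ?z b) = tensor f x / (A ^ DIM('a) * ?X)" "(\<Prod>b\<in>Basis. ?w b) = heatr l (tensor f) x / (A ^ DIM('a) * ?X)"
      unfolding prod_dividef prodE by (simp_all add: tensor_def hrF[OF l])
    moreover have "0 < A ^ DIM('a) * ?X" using A by simp
    ultimately have "\<bar>tensor f x - heatr l (tensor f) x\<bar> \<le> real DIM('a) * l * (A ^ DIM('a) * ?X)"
      by (simp add: diff_divide_distrib[symmetric] pos_divide_le_eq)
    also have "\<dots> \<le> B * l * ?X"
      using A l by (auto simp: B_def algebra_simps)
    finally show "\<bar>tensor f x - heatr l (tensor f) x\<bar> \<le> B * l * ?X" .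
  qed
qed

text \<open>e^(-|x|^2 / 64) is a multiple of \<open>heat_ker 16\<close>, as 4 l = 64, and
  \<open>heat_ker_le_wgt\<close> puts this kernel below a multiple of the weight.\<close>

lemma bumplike_wgt:
  fixes f :: "'a::euclidean_space \<Rightarrow> real \<Rightarrow> real"
  assumes f: "bumplike f" and s: "0 < s" "s < 1"
  shows "\<exists>C\<ge>0. (\<forall>x. ennreal (tensor f x) \<le> ennreal C * wgt s x) \<and>
     (\<forall>l x. 0 < l \<longrightarrow> l \<le> 1 \<longrightarrow> ennreal \<bar>tensor f x - heatr l (tensor f) x\<bar> \<le> ennreal (C * l) * wgt s x)"
proof -
  obtain B where B: "B \<ge> 0" "\<And>x. tensor f x \<le> B * exp (- ((norm x)\<^sup>2 / 64))"
     "\<And>l x. 0 < l \<Longrightarrow> l \<le> 1 \<Longrightarrow> \<bar>tensor f x - heatr l (tensor f) x\<bar> \<le> B * l * exp (- ((norm x)\<^sup>2 / 64))"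
    using bumplike_heat[OF f] by blast
  obtain C where C: "C \<ge> 0" "\<And>x::'a. ennreal (heat_ker 16 x) \<le> ennreal C * wgt s x"
    using heat_ker_le_wgt[of 16 s] s by auto
  define K where "K = sqrt (64 * pi) ^ DIM('a)"
  have K: "K \<ge> 0" by (simp add: K_def)
  have e: "exp (- ((norm x)\<^sup>2 / 64)) = K * heat_ker 16 x" for x :: 'a
    by (simp add: heat_ker_eq K_def power_divide)
  have *: "ennreal t \<le> ennreal (B * K * C * l) * wgt s x" if "t \<le> B * l * exp (- ((norm x)\<^sup>2 / 64))" "l \<ge> 0" for t l and x :: 'a
  proof -
    have "ennreal t \<le> ennreal ((B * K * l) * heat_ker 16 x)" using that(1) unfolding e by (intro ennreal_leI) (simp add: ac_simps)
    also have "\<dots> = ennreal (B * K * l) * ennreal (heat_ker 16 x)" using B K that by (intro ennreal_mult) auto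
    also have "\<dots> \<le> ennreal (B * K * l) * (ennreal C * wgt s x)" by (intro mult_left_mono C) auto
    also have "\<dots> = ennreal (B * K * C * l) * wgt s x"
    proof -
      have "ennreal (B * K * C * l) = ennreal (B * K * l * C)" by (simp only: ac_simps)
      also have "\<dots> = ennreal (B * K * l) * ennreal C" using B K C(1) that by (intro ennreal_mult) auto
      finally show ?thesis by (simp only: mult.assoc)
    qed
    finally show ?thesis .
  qed
  show ?thesis
    using *[of _ 1] * B K C(1) by (intro exI[of _ "B * K * C"]) auto
qed

section \<open>The fractional Laplacian as a subordinated heat semigroup\<close>

lemma lborel_integral_prod:
  fixes f :: "'a::euclidean_space \<Rightarrow> real \<Rightarrow> 'b::{real_normed_field,banach,second_countable_topology}"
  assumes f: "\<And>b. b \<in> Basis \<Longrightarrow> integrable lborel (f b)"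
  shows "integrable lborel (\<lambda>x::'a. \<Prod>b\<in>Basis. f b (x \<bullet> b))"
    "(\<integral>x. (\<Prod>b\<in>Basis. f b (x \<bullet> b)) \<partial>(lborel :: 'a measure)) = (\<Prod>b\<in>Basis. \<integral>t. f b t \<partial>lborel)"
proof -
  interpret product_sigma_finite "\<lambda>_::'a. lborel :: real measure" ..
  have [measurable]: "f b \<in> borel_measurable borel" if "b \<in> Basis" for b
    using f[OF that] by (simp add: borel_measurable_integrable)
  have L: "(lborel :: 'a measure) = distr (\<Pi>\<^sub>M b\<in>Basis. lborel) borel (\<lambda>f. \<Sum>b\<in>Basis. f b *\<^sub>R b)"
    unfolding lborel_def[where 'a = 'a] lborel_eq_real ..
  have [measurable]: "(\<lambda>f. \<Sum>b\<in>Basis. f b *\<^sub>R b :: 'a) \<in> measurable (\<Pi>\<^sub>M b\<in>Basis. lborel) borel"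
    by measurable
  have e: "(\<Prod>b\<in>Basis. f b ((\<Sum>b\<in>Basis. x b *\<^sub>R b :: 'a) \<bullet> b)) = (\<Prod>b\<in>Basis. f b (x b))" for x
    by (intro prod.cong refl) simp
  show "integrable lborel (\<lambda>x::'a. \<Prod>b\<in>Basis. f b (x \<bullet> b))"
    unfolding L by (subst integrable_distr_eq) (auto simp: e intro!: product_integrable_prod f)
  show "(\<integral>x. (\<Prod>b\<in>Basis. f b (x \<bullet> b)) \<partial>(lborel :: 'a measure)) = (\<Prod>b\<in>Basis. \<integral>t. f b t \<partial>lborel)"
    unfolding L by (subst integral_distr) (auto simp: e intro!: product_integral_prod f)
qed

lemma cis_sum: "finite A \<Longrightarrow> cis (sum f A) = (\<Prod>a\<in>A. cis (f a))"
  by (induction A rule: finite_induct) (simp_all add: cis_mult[symmetric])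

definition fourier1 :: "(real \<Rightarrow> real) \<Rightarrow> real \<Rightarrow> complex" where
  "fourier1 f t = (\<integral>y. cis (- (y * t)) * complex_of_real (f y) \<partial>lborel)"

lemma smooth1_compact_integrable:
  assumes "smooth1 f" "\<And>t. t \<notin> {a..b} \<Longrightarrow> f t = 0"
  shows "integrable lborel f"
  using integrable_compact_support[OF smooth1_continuous[OF assms(1)], of a b] assms(2) by simp

lemma cis_integrable:
  assumes "integrable lborel f"
  shows "integrable lborel (\<lambda>y. cis (- (y * t)) * complex_of_real (f y))"
proof (rule Bochner_Integration.integrable_bound[OF assms])
  have [measurable]: "f \<in> borel_measurable borel" using assms by (simp add: borel_measurable_integrable)
  have [measurable]: "cis \<in> borel_measurable borel"
    by (intro borel_measurable_continuous_onI continuous_on_cis continuous_on_id)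
  show "(\<lambda>y. cis (- (y * t)) * complex_of_real (f y)) \<in> borel_measurable lborel" by measurable
qed (simp add: norm_mult)

lemma fourier1_norm_le:
  assumes "integrable lborel f" shows "norm (fourier1 f t) \<le> (\<integral>y. \<bar>f y\<bar> \<partial>lborel)"
proof -
  have "norm (fourier1 f t) \<le> (\<integral>y. norm (cis (- (y * t)) * complex_of_real (f y)) \<partial>lborel)"
    unfolding fourier1_def by (rule integral_norm_bound)
  then show ?thesis by (simp add: norm_mult)
qed

lemma fourier1_deriv:
  assumes f: "smooth1 f" and supp: "\<And>t. t \<notin> {a..b} \<Longrightarrow> f t = 0" and ab: "a \<le> b"
  shows "fourier1 (deriv f) t = \<i> * of_real t * fourier1 f t"
proof -
  note f' = smooth1_deriv[OF f]
  let ?c = "\<lambda>y. cis (- (y * t))"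
  let ?G = "\<lambda>y. ?c y * complex_of_real (deriv f y) - \<i> * of_real t * (?c y * complex_of_real (f y))"
  have cd: "(?c has_vector_derivative (- \<i> * of_real t * ?c y)) (at y within A)" for y A
  proof -
    have "((\<lambda>z. exp (- (\<i> * of_real t) * z)) has_field_derivative exp (- (\<i> * of_real t) * of_real y) * (- (\<i> * of_real t))) (at (of_real y))"
      by (auto intro!: derivative_eq_intros)
    from has_vector_derivative_real_field[OF this] show ?thesis
      by (simp add: cis_conv_exp mult.commute mult.left_commute mult.assoc)
  qed
  have Gd: "((\<lambda>y. ?c y * complex_of_real (f y)) has_vector_derivative ?G y) (at y within A)" for y A
  proof -
    have "((\<lambda>y. complex_of_real (f y)) has_vector_derivative of_real (deriv f y)) (at y within A)"
      by (rule has_vector_derivative_of_real[OF has_field_derivative_at_within[OF f'(1)]])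
    from has_vector_derivative_mult[OF cd this] show ?thesis by (simp add: algebra_simps)
  qed
  have Gc: "continuous_on A ?G" for A
    by (intro continuous_intros continuous_on_cis smooth1_continuous f f')
  have i1: "integrable lborel (deriv f)" "integrable lborel f"
    using f f' supp deriv_zero_outside[OF supp] by (auto intro!: smooth1_compact_integrable[of _ a b])
  \<comment> \<open>The interval is widened by 1 so that both boundary values are taken outside the
    support.\<close>
  have "(\<integral>y. indicator {a - 1..b + 1} y *\<^sub>R ?G y \<partial>lborel) = ?c (b + 1) * complex_of_real (f (b + 1)) - ?c (a - 1) * complex_of_real (f (a - 1))"
    using ab by (intro integral_FTC_Icc Gd Gc) auto
  also have "\<dots> = 0" by (simp add: supp)
  also have "(\<integral>y. indicator {a - 1..b + 1} y *\<^sub>R ?G y \<partial>lborel) = (\<integral>y. ?G y \<partial>lborel)"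
  proof (rule Bochner_Integration.integral_cong[OF refl])
    fix y show "indicator {a - 1..b + 1} y *\<^sub>R ?G y = ?G y"
      using supp[of y] deriv_zero_outside[of a b f y] supp by (cases "y \<in> {a..b}") auto
  qed
  also have "\<dots> = fourier1 (deriv f) t - \<i> * of_real t * fourier1 f t"
    unfolding fourier1_def using cis_integrable[OF i1(1), of t] cis_integrable[OF i1(2), of t]
    by (subst Bochner_Integration.integral_diff) auto
  finally show ?thesis by simp
qed

text \<open>Four derivatives give t^4. One factor 1 + t^2 will be spent on the growth of the symbol,
  the other on integrability.\<close>

lemma fourier1_decay:
  assumes f: "smooth1 f" and supp: "\<And>t. t \<notin> {a..b} \<Longrightarrow> f t = 0" and ab: "a \<le> b"
  shows "\<exists>C\<ge>0. \<forall>t. norm (fourier1 f t) * (1 + t\<^sup>2)\<^sup>2 \<le> C"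
proof -
  have sm: "smooth1 ((deriv ^^ n) f)" for n by (rule smooth1_deriv_iter[OF f])
  have su: "t \<notin> {a..b} \<Longrightarrow> (deriv ^^ n) f t = 0" for t n
  proof (induction n arbitrary: t)
    case (Suc n)
    show ?case using deriv_zero_outside[of a b "(deriv ^^ n) f" t] Suc by simp
  qed (simp add: supp)
  have it: "fourier1 ((deriv ^^ n) f) t = (\<i> * of_real t) ^ n * fourier1 f t" for n t
  proof (induction n)
    case (Suc n)
    have "fourier1 ((deriv ^^ Suc n) f) t = \<i> * of_real t * fourier1 ((deriv ^^ n) f) t"
      using fourier1_deriv[OF sm[of n] su[of _ n] ab, of t] by simp
    then show ?case using Suc by simp
  qed simp
  define C where "C = 2 * (\<integral>y. \<bar>f y\<bar> \<partial>lborel) + 2 * (\<integral>y. \<bar>(deriv ^^ 4) f y\<bar> \<partial>lborel)"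
  have "norm (fourier1 f t) * (1 + t\<^sup>2)\<^sup>2 \<le> C" for t
  proof -
    have "(1 + t\<^sup>2)\<^sup>2 \<le> 2 + 2 * t ^ 4"
      using zero_le_power2[of "1 - t\<^sup>2"] by (simp add: power2_eq_square power4_eq_xxxx algebra_simps)
    then have "norm (fourier1 f t) * (1 + t\<^sup>2)\<^sup>2 \<le> norm (fourier1 f t) * (2 + 2 * t ^ 4)" by (intro mult_left_mono) auto
    also have "\<dots> = 2 * norm (fourier1 f t) + 2 * norm (fourier1 ((deriv ^^ 4) f) t)"
      unfolding it by (simp add: norm_mult norm_power algebra_simps)
    also have "\<dots> \<le> C"
      unfolding C_def
      by (intro add_mono mult_left_mono fourier1_norm_le smooth1_compact_integrable[of _ a b] f sm su supp) auto
    finally show ?thesis .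
  qed
  moreover have "C \<ge> 0" by (simp add: C_def)
  ultimately show ?thesis by blast
qed

lemma bumplike_props:
  assumes "bumplike f"
  obtains R where "R \<ge> 0" "\<And>b t. b \<in> Basis \<Longrightarrow> t \<notin> {-R..R} \<Longrightarrow> f b t = 0" "\<And>b. b \<in> Basis \<Longrightarrow> smooth1 (f b)"
    "\<And>b t. b \<in> Basis \<Longrightarrow> 0 \<le> f b t" "\<And>b. b \<in> Basis \<Longrightarrow> integrable lborel (f b)"
proof -
  from assms obtain R where R: "R \<ge> 0" "\<And>b t. b \<in> Basis \<Longrightarrow> t \<notin> {-R..R} \<Longrightarrow> f b t = 0" "\<And>b. b \<in> Basis \<Longrightarrow> smooth1 (f b)"
    "\<And>b t. b \<in> Basis \<Longrightarrow> 0 \<le> f b t"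
    by (auto simp: bumplike_def)
  moreover have "integrable lborel (f b)" if "b \<in> Basis" for b
    by (rule smooth1_compact_integrable[OF R(3)[OF that] R(2)[OF that]])
  ultimately show ?thesis using that by blast
qed

lemma bumplike_integrable: "bumplike f \<Longrightarrow> integrable lborel (tensor f)"
  unfolding tensor_def by (rule lborel_integral_prod) (auto elim: bumplike_props)

lemma fourier_tensor:
  assumes f: "bumplike f"
  shows "fourier (tensor f) \<xi> = (\<Prod>b\<in>Basis. fourier1 (f b) (\<xi> \<bullet> b))"
proof -
  have "fourier (tensor f) \<xi> = (\<integral>y. (\<Prod>b\<in>Basis. cis (- ((y \<bullet> b) * (\<xi> \<bullet> b))) * complex_of_real (f b (y \<bullet> b))) \<partial>lborel)"
    unfolding fourier_def tensor_def
    by (intro Bochner_Integration.integral_cong refl)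
      (simp add: euclidean_inner[of _ \<xi>] sum_negf[symmetric] cis_sum prod.distrib)
  also have "\<dots> = (\<Prod>b\<in>Basis. fourier1 (f b) (\<xi> \<bullet> b))"
    unfolding fourier1_def using bumplike_props[OF f]
    by (subst lborel_integral_prod(2)[of "\<lambda>b y. cis (- (y * (\<xi> \<bullet> b))) * complex_of_real (f b y)"])
      (auto intro!: cis_integrable elim: bumplike_props[OF f])
  finally show ?thesis .
qed

lemma one_plus_sum_le_prod:
  fixes a :: "'i \<Rightarrow> real"
  assumes "finite A" "\<And>i. i \<in> A \<Longrightarrow> 0 \<le> a i"
  shows "1 + sum a A \<le> (\<Prod>i\<in>A. 1 + a i)"
  using assms
proof (induction A rule: finite_induct)
  case (insert i A)
  have "1 + sum a (insert i A) \<le> (1 + a i) * (1 + sum a A)"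
    using insert by (simp add: algebra_simps sum_nonneg)
  also have "\<dots> \<le> (1 + a i) * (\<Prod>i\<in>A. 1 + a i)"
    using insert by (intro mult_left_mono) auto
  finally show ?case using insert by simp
qed simp

lemma integrable_inverse_one_plus_square: "integrable lborel (\<lambda>t::real. 1 / (1 + t\<^sup>2))"
  using integrable_I0i_1_div_plus_square integrable_inverse_1_plus_square
  by (simp add: set_integrable_def einterval_eq_UNIV divide_inverse)

text \<open>1 + |\<xi>|^2 is at most the product of the 1 + (\<xi> \<bullet> b)^2, so the bound
  factors over the coordinates. The extra factor 1 + |\<xi>|^2 is there to dominate the symbol
  |\<xi>|^(2 s).\<close>

lemma fourier_decay:
  fixes f :: "'a::euclidean_space \<Rightarrow> real \<Rightarrow> real"
  assumes f: "bumplike f"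
  shows "\<exists>w. integrable lborel w \<and> (\<forall>\<xi>. (1 + (norm \<xi>)\<^sup>2) * norm (fourier (tensor f) \<xi>) \<le> w \<xi>)"
proof -
  obtain R where R: "R \<ge> 0" "\<And>b t. b \<in> Basis \<Longrightarrow> t \<notin> {-R..R} \<Longrightarrow> f b t = 0" "\<And>b. b \<in> Basis \<Longrightarrow> smooth1 (f b)"
    by (rule bumplike_props[OF f]) blast
  have "\<exists>C\<ge>0. \<forall>t. norm (fourier1 (f b) t) * (1 + t\<^sup>2)\<^sup>2 \<le> C" if "b \<in> Basis" for b
    using fourier1_decay[OF R(3)[OF that] R(2)[OF that]] R(1) by auto
  then obtain C where C: "\<And>b. b \<in> Basis \<Longrightarrow> C b \<ge> 0" "\<And>b t. b \<in> Basis \<Longrightarrow> norm (fourier1 (f b) t) * (1 + t\<^sup>2)\<^sup>2 \<le> C b"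
    by metis
  define w where "w = (\<lambda>\<xi>::'a. \<Prod>b\<in>Basis. C b * (1 / (1 + (\<xi> \<bullet> b)\<^sup>2)))"
  have "integrable lborel w"
    unfolding w_def
    by (rule lborel_integral_prod(1)[of "\<lambda>b t. C b * (1 / (1 + t\<^sup>2))"]) (intro integrable_mult_right integrable_inverse_one_plus_square)
  moreover have "(1 + (norm \<xi>)\<^sup>2) * norm (fourier (tensor f) \<xi>) \<le> w \<xi>" for \<xi>
  proof -
    have n2: "(norm \<xi>)\<^sup>2 = (\<Sum>b\<in>Basis. (\<xi> \<bullet> b)\<^sup>2)"
      unfolding power2_norm_eq_inner euclidean_inner[of \<xi> \<xi>] by (simp add: power2_eq_square)
    have "1 + (norm \<xi>)\<^sup>2 \<le> (\<Prod>b\<in>Basis. 1 + (\<xi> \<bullet> b)\<^sup>2)"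
      unfolding n2 by (rule one_plus_sum_le_prod) auto
    then have "(1 + (norm \<xi>)\<^sup>2) * norm (fourier (tensor f) \<xi>) \<le> (\<Prod>b\<in>Basis. 1 + (\<xi> \<bullet> b)\<^sup>2) * norm (fourier (tensor f) \<xi>)"
      by (intro mult_right_mono) auto
    also have "\<dots> = (\<Prod>b\<in>Basis. (1 + (\<xi> \<bullet> b)\<^sup>2) * norm (fourier1 (f b) (\<xi> \<bullet> b)))"
      unfolding fourier_tensor[OF f] by (simp add: prod_norm prod.distrib)
    also have "\<dots> \<le> w \<xi>"
      unfolding w_def
    proof (rule prod_mono)
      fix b :: 'a assume b: "b \<in> Basis"
      have p: "1 + (\<xi> \<bullet> b)\<^sup>2 > 0" by (intro add_pos_nonneg) auto
      have "(1 + (\<xi> \<bullet> b)\<^sup>2) * norm (fourier1 (f b) (\<xi> \<bullet> b)) \<le> C b * (1 / (1 + (\<xi> \<bullet> b)\<^sup>2))"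
        using C(2)[OF b, of "\<xi> \<bullet> b"] p by (simp add: pos_le_divide_eq power2_eq_square[of "1 + _"] ac_simps)
      then show "0 \<le> (1 + (\<xi> \<bullet> b)\<^sup>2) * norm (fourier1 (f b) (\<xi> \<bullet> b)) \<and> (1 + (\<xi> \<bullet> b)\<^sup>2) * norm (fourier1 (f b) (\<xi> \<bullet> b)) \<le> C b * (1 / (1 + (\<xi> \<bullet> b)\<^sup>2))"
        using p by simp
    qed
    finally show ?thesis .
  qed
  ultimately show ?thesis by blast
qed

lemma integrable_gauss: "l > 0 \<Longrightarrow> integrable lborel (\<lambda>t::real. exp (- (l * t\<^sup>2)))"
proof -
  assume l: "l > 0"
  have "integrable lborel (\<lambda>t. sqrt (pi / l) * normal_density 0 (sqrt (1 / (2 * l))) t)"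
    using l by (intro integrable_mult_right integrable_normal_density) simp
  moreover have "sqrt (pi / l) * normal_density 0 (sqrt (1 / (2 * l))) t = exp (- (l * t\<^sup>2))" for t
  proof -
    have "(sqrt (1 / (2 * l)))\<^sup>2 = 1 / (2 * l)" using l by simp
    moreover have "2 * pi * (1 / (2 * l)) = pi / l" using l by simp
    moreover have "sqrt (pi / l) > 0" using l by simp
    ultimately show ?thesis
      using l unfolding normal_density_def by (simp add: mult.commute)
  qed
  ultimately show ?thesis by simp
qed

lemma cis_measurable[measurable]: "cis \<in> borel_measurable borel"
  by (intro borel_measurable_continuous_onI continuous_on_cis continuous_on_id)

text \<open>The characteristic function of the standard normal law, rescaled by c = sqrt (2
  l).\<close>

lemma gauss_fourier1:
  assumes l: "l > 0"
  shows "(\<integral>t. cis (z * t) * complex_of_real (exp (- (l * t\<^sup>2))) \<partial>lborel) = complex_of_real (2 * pi * normal_density 0 (sqrt (2 * l)) z)"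
proof -
  define c where "c = sqrt (2 * l)"
  have c: "c > 0" "c\<^sup>2 = 2 * l" using l by (auto simp: c_def)
  have "complex_of_real (exp (- ((z / c)\<^sup>2 / 2))) = char std_normal_distribution (z / c)"
    by (simp add: char_std_normal_distribution)
  also have "\<dots> = (\<integral>x. std_normal_density x *\<^sub>R cis ((z / c) * x) \<partial>lborel)"
    unfolding char_def by (subst integral_density) (auto simp: cis_conv_exp)
  also have "\<dots> = c *\<^sub>R (\<integral>x. std_normal_density (c * x) *\<^sub>R cis ((z / c) * (c * x)) \<partial>lborel)"
    using c lborel_integral_real_affine[of c "\<lambda>x. std_normal_density x *\<^sub>R cis ((z / c) * x)" 0] by simp
  also have "(\<integral>x. std_normal_density (c * x) *\<^sub>R cis ((z / c) * (c * x)) \<partial>lborel) =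
      (\<integral>x. complex_of_real (1 / sqrt (2 * pi)) * (cis (z * x) * complex_of_real (exp (- (l * x\<^sup>2)))) \<partial>lborel)"
    using c by (intro Bochner_Integration.integral_cong refl) (simp add: std_normal_density_def power_mult_distrib scaleR_conv_of_real ac_simps)
  also have "\<dots> = complex_of_real (1 / sqrt (2 * pi)) * (\<integral>t. cis (z * t) * complex_of_real (exp (- (l * t\<^sup>2))) \<partial>lborel)"
    by simp
  finally have "complex_of_real (sqrt (2 * pi) / c) * complex_of_real (exp (- ((z / c)\<^sup>2 / 2))) = (\<integral>t. cis (z * t) * complex_of_real (exp (- (l * t\<^sup>2))) \<partial>lborel)"
    using c by (simp add: scaleR_conv_of_real)
  moreover have "sqrt (2 * pi) / c * exp (- ((z / c)\<^sup>2 / 2)) = 2 * pi * normal_density 0 (sqrt (2 * l)) z"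
  proof -
    have "sqrt (2 * pi) / c = 2 * pi * (1 / sqrt (4 * pi * l))"
    proof -
      have "sqrt (2 * pi) * sqrt (4 * pi * l) = sqrt ((2 * pi) * (4 * pi * l))"
        by (simp only: real_sqrt_mult)
      also have "(2 * pi) * (4 * pi * l) = (2 * pi)\<^sup>2 * (2 * l)"
        by (simp add: power2_eq_square)
      also have "sqrt ((2 * pi)\<^sup>2 * (2 * l)) = 2 * pi * c"
      proof -
        have "sqrt ((2 * pi)\<^sup>2) = 2 * pi" by (rule real_sqrt_unique) auto
        then show ?thesis unfolding real_sqrt_mult[of "(2 * pi)\<^sup>2"] c_def by (simp only:)
      qed
      finally show ?thesis using c l by (simp add: field_simps)
    qed
    moreover have "(z / c)\<^sup>2 / 2 = z\<^sup>2 / (4 * l)" using c by (simp add: power_divide)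
    ultimately show ?thesis using l by (simp add: normal_density_def ac_simps)
  qed
  ultimately show ?thesis by (metis of_real_mult)
qed

lemma gauss_ft:
  fixes z :: "'a::euclidean_space"
  assumes l: "l > 0"
  shows "integrable lborel (\<lambda>\<xi>::'a. exp (- (l * (norm \<xi>)\<^sup>2)))"
    "(\<integral>\<xi>. cis (z \<bullet> \<xi>) * complex_of_real (exp (- (l * (norm \<xi>)\<^sup>2))) \<partial>lborel) = complex_of_real ((2 * pi) ^ DIM('a) * heat_ker l z)"
proof -
  have e: "exp (- (l * (norm \<xi>)\<^sup>2)) = (\<Prod>b\<in>Basis. exp (- (l * (\<xi> \<bullet> b)\<^sup>2)))" for \<xi> :: 'a
    unfolding power2_norm_eq_inner euclidean_inner[of \<xi> \<xi>] exp_sum[OF finite_Basis, symmetric]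
    by (simp add: sum_negf sum_distrib_left power2_eq_square)
  show "integrable lborel (\<lambda>\<xi>::'a. exp (- (l * (norm \<xi>)\<^sup>2)))"
    unfolding e by (rule lborel_integral_prod(1)[of "\<lambda>_ t. exp (- (l * t\<^sup>2))"]) (rule integrable_gauss[OF l])
  have c: "cis (z \<bullet> \<xi>) = (\<Prod>b\<in>Basis. cis ((z \<bullet> b) * (\<xi> \<bullet> b)))" for \<xi>
    by (subst euclidean_inner) (rule cis_sum[OF finite_Basis])
  have "(\<integral>\<xi>. cis (z \<bullet> \<xi>) * complex_of_real (exp (- (l * (norm \<xi>)\<^sup>2))) \<partial>lborel) =
      (\<integral>\<xi>. (\<Prod>b\<in>Basis. cis ((z \<bullet> b) * (\<xi> \<bullet> b)) * complex_of_real (exp (- (l * (\<xi> \<bullet> b)\<^sup>2)))) \<partial>(lborel :: 'a measure))"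
    unfolding e c by (intro Bochner_Integration.integral_cong refl) (simp add: prod.distrib)
  also have "\<dots> = (\<Prod>b\<in>Basis. (\<integral>t. cis ((z \<bullet> b) * t) * complex_of_real (exp (- (l * t\<^sup>2))) \<partial>lborel))"
  proof (rule lborel_integral_prod(2)[of "\<lambda>b t. cis ((z \<bullet> b) * t) * complex_of_real (exp (- (l * t\<^sup>2)))"])
    show "integrable lborel (\<lambda>t. cis ((z \<bullet> b) * t) * complex_of_real (exp (- (l * t\<^sup>2))))" for b
      by (rule Bochner_Integration.integrable_bound[OF integrable_gauss[OF l]]) (measurable, simp add: norm_mult)
  qed
  also have "\<dots> = complex_of_real ((2 * pi) ^ DIM('a) * heat_ker l z)"
    unfolding gauss_fourier1[OF l] heat_ker_def tensor_def by (simp add: prod.distrib)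
  finally show "(\<integral>\<xi>. cis (z \<bullet> \<xi>) * complex_of_real (exp (- (l * (norm \<xi>)\<^sup>2))) \<partial>lborel) = complex_of_real ((2 * pi) ^ DIM('a) * heat_ker l z)" .
qed

lemma fourier_measurable[measurable]:
  assumes [measurable]: "g \<in> borel_measurable borel"
  shows "fourier g \<in> borel_measurable borel"
  unfolding fourier_def by measurable

text \<open>Insert the definition of \<open>fourier\<close> and exchange the integrals; the
  frequency integral is then \<open>gauss_ft\<close> at x - y.\<close>

lemma heat_fourier:
  fixes f :: "'a::euclidean_space \<Rightarrow> real \<Rightarrow> real"
  assumes f: "bumplike f" and l: "l > 0"
  shows "(\<integral>\<xi>. cis (x \<bullet> \<xi>) * complex_of_real (exp (- (l * (norm \<xi>)\<^sup>2))) * fourier (tensor f) \<xi> \<partial>lborel)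
    = complex_of_real ((2 * pi) ^ DIM('a) * heatr l (tensor f) x)"
proof -
  let ?g = "tensor f"
  note [measurable] = bumplike_measurable[OF f]
  let ?F = "\<lambda>\<xi> y. cis (x \<bullet> \<xi>) * complex_of_real (exp (- (l * (norm \<xi>)\<^sup>2))) * (cis (- (y \<bullet> \<xi>)) * complex_of_real (?g y))"
  have gi: "integrable lborel ?g" by (rule bumplike_integrable[OF f])
  have Fi: "integrable lborel (\<lambda>y. cis (- (y \<bullet> \<xi>)) * complex_of_real (?g y))" for \<xi>
    by (rule Bochner_Integration.integrable_bound[OF gi]) (measurable, simp add: norm_mult)
  have pi: "integrable (lborel \<Otimes>\<^sub>M lborel) (\<lambda>(\<xi>, y). ?F \<xi> y)"
  proof (rule lborel_pair.Fubini_integrable)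
    show "AE \<xi> in lborel. integrable lborel (\<lambda>y. case (\<xi>, y) of (\<xi>, y) \<Rightarrow> ?F \<xi> y)"
      using Fi by (intro AE_I2) auto
    have "integrable lborel (\<lambda>\<xi>::'a. exp (- (l * (norm \<xi>)\<^sup>2)) * (\<integral>y. \<bar>?g y\<bar> \<partial>lborel))"
      by (intro integrable_mult_left gauss_ft l)
    then show "integrable lborel (\<lambda>\<xi>. \<integral>y. norm (case (\<xi>, y) of (\<xi>, y) \<Rightarrow> ?F \<xi> y) \<partial>lborel)"
      by (simp add: norm_mult)
  qed measurable
  have "(\<integral>\<xi>. cis (x \<bullet> \<xi>) * complex_of_real (exp (- (l * (norm \<xi>)\<^sup>2))) * fourier ?g \<xi> \<partial>lborel) = (\<integral>\<xi>. (\<integral>y. ?F \<xi> y \<partial>lborel) \<partial>lborel)"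
    unfolding fourier_def by simp
  also have "\<dots> = (\<integral>y. (\<integral>\<xi>. ?F \<xi> y \<partial>lborel) \<partial>lborel)"
    using lborel_pair.Fubini_integral[OF pi] by simp
  also have "\<dots> = (\<integral>y. complex_of_real ((2 * pi) ^ DIM('a) * (heat_ker l (x - y) * ?g y)) \<partial>lborel)"
  proof (rule Bochner_Integration.integral_cong[OF refl])
    fix y
    have "(\<integral>\<xi>. ?F \<xi> y \<partial>lborel) = (\<integral>\<xi>. (cis ((x - y) \<bullet> \<xi>) * complex_of_real (exp (- (l * (norm \<xi>)\<^sup>2)))) * complex_of_real (?g y) \<partial>lborel)"
    proof (rule Bochner_Integration.integral_cong[OF refl])
      fix \<xi>
      have "cis (x \<bullet> \<xi>) * cis (- (y \<bullet> \<xi>)) = cis ((x - y) \<bullet> \<xi>)" by (simp add: cis_mult inner_diff_left)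
      then show "?F \<xi> y = (cis ((x - y) \<bullet> \<xi>) * complex_of_real (exp (- (l * (norm \<xi>)\<^sup>2)))) * complex_of_real (?g y)"
        by (metis mult.assoc mult.commute)
    qed
    also have "\<dots> = complex_of_real ((2 * pi) ^ DIM('a) * heat_ker l (x - y)) * complex_of_real (?g y)"
      by (simp only: integral_mult_left_zero gauss_ft(2)[OF l])
    finally show "(\<integral>\<xi>. ?F \<xi> y \<partial>lborel) = complex_of_real ((2 * pi) ^ DIM('a) * (heat_ker l (x - y) * ?g y))"
      by (simp only: of_real_mult mult.assoc)
  qed
  also have "\<dots> = complex_of_real ((2 * pi) ^ DIM('a) * heatr l ?g x)"
    unfolding heatr_def integral_complex_of_real by simp
  finally show ?thesis .
qed

text \<open>Gaussian regularisation: as l \<rightarrow> 0 the left side of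
  \<open>heat_fourier\<close> converges by domination through \<open>fourier_decay\<close>, and the
  right side because g - H l g = O(l).\<close>

lemma fourier_inversion:
  fixes f :: "'a::euclidean_space \<Rightarrow> real \<Rightarrow> real"
  assumes f: "bumplike f"
  shows "(\<integral>\<xi>. cis (x \<bullet> \<xi>) * fourier (tensor f) \<xi> \<partial>lborel) = complex_of_real ((2 * pi) ^ DIM('a) * tensor f x)"
proof -
  let ?g = "tensor f"
  note [measurable] = bumplike_measurable[OF f]
  obtain w where w: "integrable lborel w" "\<And>\<xi>. (1 + (norm \<xi>)\<^sup>2) * norm (fourier ?g \<xi>) \<le> w \<xi>"
    using fourier_decay[OF f] by blast
  have w': "norm (fourier ?g \<xi>) \<le> w \<xi>" for \<xi>
    using w(2)[of \<xi>] mult_right_mono[of 1 "1 + (norm \<xi>)\<^sup>2" "norm (fourier ?g \<xi>)"] by simp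
  obtain C where C: "\<And>l. 0 < l \<Longrightarrow> l \<le> 1 \<Longrightarrow> \<bar>?g x - heatr l ?g x\<bar> \<le> C * l * exp (- ((norm x)\<^sup>2 / 64))"
    using bumplike_heat[OF f] by blast
  let ?l = "\<lambda>n. 1 / real (Suc n)"
  have l0: "?l \<longlonglongrightarrow> 0" by (rule LIMSEQ_Suc[OF lim_1_over_n])
  have l1: "0 < ?l n" "?l n \<le> 1" for n by auto
  have "(\<lambda>n. \<integral>\<xi>. cis (x \<bullet> \<xi>) * complex_of_real (exp (- (?l n * (norm \<xi>)\<^sup>2))) * fourier ?g \<xi> \<partial>lborel)
      \<longlonglongrightarrow> (\<integral>\<xi>. cis (x \<bullet> \<xi>) * fourier ?g \<xi> \<partial>lborel)"
  proof (rule integral_dominated_convergence[OF _ _ w(1)])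
    show "AE \<xi> in lborel. (\<lambda>n. cis (x \<bullet> \<xi>) * complex_of_real (exp (- (?l n * (norm \<xi>)\<^sup>2))) * fourier ?g \<xi>) \<longlonglongrightarrow> cis (x \<bullet> \<xi>) * fourier ?g \<xi>"
    proof (rule AE_I2)
      fix \<xi>
      have "(\<lambda>n. cis (x \<bullet> \<xi>) * complex_of_real (exp (- (?l n * (norm \<xi>)\<^sup>2))) * fourier ?g \<xi>) \<longlonglongrightarrow> cis (x \<bullet> \<xi>) * complex_of_real (exp (- (0 * (norm \<xi>)\<^sup>2))) * fourier ?g \<xi>"
        by (intro tendsto_intros l0)
      then show "(\<lambda>n. cis (x \<bullet> \<xi>) * complex_of_real (exp (- (?l n * (norm \<xi>)\<^sup>2))) * fourier ?g \<xi>) \<longlonglongrightarrow> cis (x \<bullet> \<xi>) * fourier ?g \<xi>" by simp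
    qed
    show "AE \<xi> in lborel. norm (cis (x \<bullet> \<xi>) * complex_of_real (exp (- (?l n * (norm \<xi>)\<^sup>2))) * fourier ?g \<xi>) \<le> w \<xi>" for n
    proof (rule AE_I2)
      fix \<xi>
      have "norm (cis (x \<bullet> \<xi>) * complex_of_real (exp (- (?l n * (norm \<xi>)\<^sup>2))) * fourier ?g \<xi>) = exp (- (?l n * (norm \<xi>)\<^sup>2)) * norm (fourier ?g \<xi>)"
        by (simp add: norm_mult)
      also have "\<dots> \<le> 1 * norm (fourier ?g \<xi>)" by (intro mult_right_mono) auto
      finally show "norm (cis (x \<bullet> \<xi>) * complex_of_real (exp (- (?l n * (norm \<xi>)\<^sup>2))) * fourier ?g \<xi>) \<le> w \<xi>" using w'[of \<xi>] by simp
    qed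
  qed measurable
  then have 1: "(\<lambda>n. complex_of_real ((2 * pi) ^ DIM('a) * heatr (?l n) ?g x)) \<longlonglongrightarrow> (\<integral>\<xi>. cis (x \<bullet> \<xi>) * fourier ?g \<xi> \<partial>lborel)"
    unfolding heat_fourier[OF f l1(1)] .
  have "(\<lambda>n. ?g x - heatr (?l n) ?g x) \<longlonglongrightarrow> 0"
  proof (rule Lim_null_comparison)
    show "\<forall>\<^sub>F n in sequentially. norm (?g x - heatr (?l n) ?g x) \<le> C * ?l n * exp (- ((norm x)\<^sup>2 / 64))"
      using C[OF l1] by (intro always_eventually) auto
    have "(\<lambda>n. C * ?l n * exp (- ((norm x)\<^sup>2 / 64))) \<longlonglongrightarrow> C * 0 * exp (- ((norm x)\<^sup>2 / 64))" by (intro tendsto_intros l0)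
    then show "(\<lambda>n. C * ?l n * exp (- ((norm x)\<^sup>2 / 64))) \<longlonglongrightarrow> 0" by simp
  qed
  then have "(\<lambda>n. ?g x - (?g x - heatr (?l n) ?g x)) \<longlonglongrightarrow> ?g x - 0" by (intro tendsto_diff tendsto_const)
  then have "(\<lambda>n. complex_of_real ((2 * pi) ^ DIM('a) * heatr (?l n) ?g x)) \<longlonglongrightarrow> complex_of_real ((2 * pi) ^ DIM('a) * ?g x)"
    by (intro tendsto_intros) simp
  with 1 show ?thesis by (rule LIMSEQ_unique)
qed

text \<open>The constant \<open>1 / \<kappa>\<close>.\<close>

definition subc :: "real \<Rightarrow> real" where
  "subc s = (\<integral>l. indicator {0<..} l * ((1 - exp (- l)) * l powr (-1 - s)) \<partial>lborel)"

text \<open>1 - e^(-l) is at most l, which settles integrability at 0, and at most 1, which settles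
  it at infinity.\<close>

lemma subc_integrable:
  assumes s: "0 < s" "s < 1"
  shows "integrable lborel (\<lambda>l. indicator {0<..} l * ((1 - exp (- l)) * l powr (-1 - s)))" "subc s > 0"
proof -
  let ?q = "\<lambda>l::real. indicator {0<..} l * ((1 - exp (- l)) * l powr (-1 - s))"
  have nn: "0 \<le> ?q l" for l by (auto simp: indicator_def)
  have "(\<integral>\<^sup>+l. ennreal (?q l) \<partial>lborel) \<le> (\<integral>\<^sup>+l. indicator {0..1} l * ennreal (l powr (- s)) + indicator {1..} l * ennreal (l powr (-1 - s)) \<partial>lborel)"
  proof (rule nn_integral_mono)
    fix l :: real
    have "(1 - exp (- l)) * l powr (-1 - s) \<le> l powr (- s)" if "l > 0"
    proof -
      have "(1 - exp (- l)) * l powr (-1 - s) \<le> l * l powr (-1 - s)"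
        using exp_ge_add_one_self[of "- l"] by (intro mult_right_mono) auto
      also have "\<dots> = l powr (- s)" using that powr_mult_base[of l "-1 - s"] by simp
      finally show ?thesis .
    qed
    moreover have "(1 - exp (- l)) * l powr (-1 - s) \<le> 1 * l powr (-1 - s)" by (intro mult_right_mono) auto
    ultimately show "ennreal (?q l) \<le> indicator {0..1} l * ennreal (l powr (- s)) + indicator {1..} l * ennreal (l powr (-1 - s))"
    proof -
      consider "l \<le> 0" | "0 < l" "l \<le> 1" | "1 < l" by linarith
      then show ?thesis
      proof cases
        case 2
        then have "ennreal (?q l) \<le> indicator {0..1} l * ennreal (l powr (- s))"
          using \<open>l > 0 \<Longrightarrow> (1 - exp (- l)) * l powr (-1 - s) \<le> l powr (- s)\<close> by (simp add: ennreal_leI)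
        then show ?thesis by (rule order_trans) simp
      next
        case 3
        then show ?thesis
          using \<open>(1 - exp (- l)) * l powr (-1 - s) \<le> 1 * l powr (-1 - s)\<close> by (simp add: ennreal_leI)
      qed simp
    qed
  qed
  also have "\<dots> = ennreal (1 / (1 - s)) + ennreal (1 / s)"
    using nn_integral_powr_head[of 1 s] nn_integral_powr_tail[of 1 s] s by (subst nn_integral_add) auto
  also have "\<dots> < \<infinity>" by simp
  finally have fin: "(\<integral>\<^sup>+l. ennreal (?q l) \<partial>lborel) < \<infinity>" .
  show i: "integrable lborel ?q" using fin nn by (intro integrableI_nonneg) auto
  have "subc s \<noteq> 0"
  proof
    assume "subc s = 0"
    then have "AE l in lborel. ?q l = 0"
      unfolding subc_def using integral_nonneg_eq_0_iff_AE[OF i] nn by auto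
    then have "AE l in lborel. l \<notin> {0<..<1::real}" by eventually_elim (auto simp: indicator_def split: if_splits)
    then have "emeasure lborel {0<..<1::real} = 0"
      by (subst (asm) AE_iff_measurable[where N = "{0<..<1}"]) auto
    then show False by simp
  qed
  moreover have "subc s \<ge> 0" unfolding subc_def using nn by (intro Bochner_Integration.integral_nonneg) auto
  ultimately show "subc s > 0" by linarith
qed

text \<open>Substitute r^2 l for l. With r = |\<xi>| this writes the symbol |\<xi>|^(2 s) as a
  superposition of 1 - e^(-l |\<xi>|^2), the symbols of the identity minus the heat
  semigroup.\<close>

lemma subc_scale:
  assumes s: "0 < s" "s < 1" and r: "r \<ge> 0"
  shows "integrable lborel (\<lambda>l. indicator {0<..} l * ((1 - exp (- (l * r\<^sup>2))) * l powr (-1 - s)))"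
    "(\<integral>l. indicator {0<..} l * ((1 - exp (- (l * r\<^sup>2))) * l powr (-1 - s)) \<partial>lborel) = subc s * r powr (2 * s)"
proof -
  let ?q = "\<lambda>l::real. indicator {0<..} l * ((1 - exp (- l)) * l powr (-1 - s))"
  have *: "integrable lborel (\<lambda>l. indicator {0<..} l * ((1 - exp (- (l * r\<^sup>2))) * l powr (-1 - s))) \<and>
    (\<integral>l. indicator {0<..} l * ((1 - exp (- (l * r\<^sup>2))) * l powr (-1 - s)) \<partial>lborel) = subc s * r powr (2 * s)"
  proof (cases "r = 0")
    case False
    then have r: "r > 0" using r by simp
    have e: "indicator {0<..} l * ((1 - exp (- (l * r\<^sup>2))) * l powr (-1 - s)) = r powr (2 + 2 * s) * ?q (0 + r\<^sup>2 * l)" for l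
    proof (cases "l > 0")
      case True
      have "(r\<^sup>2 * l) powr (-1 - s) = r powr (- (2 + 2 * s)) * l powr (-1 - s)"
        using r True power_powr[of r 2 "-1 - s"] by (simp add: powr_mult)
      moreover have "r powr (2 + 2 * s) * r powr (- (2 + 2 * s)) = 1" using r by (simp flip: powr_add)
      ultimately have "r powr (2 + 2 * s) * (r\<^sup>2 * l) powr (-1 - s) = l powr (-1 - s)"
        by (simp add: mult.assoc[symmetric])
      then show ?thesis using True r by (simp add: mult.commute mult.left_commute)
    next
      case False
      then have "\<not> 0 < r\<^sup>2 * l" using r by (simp add: zero_less_mult_iff)
      then show ?thesis using False by simp
    qed
    have i: "integrable lborel (\<lambda>l. ?q (0 + r\<^sup>2 * l))"
      using lborel_integrable_real_affine[OF subc_integrable(1)[OF s], of "r\<^sup>2" 0] r by simp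
    have "subc s = r\<^sup>2 * (\<integral>l. ?q (0 + r\<^sup>2 * l) \<partial>lborel)"
      unfolding subc_def using lborel_integral_real_affine[of "r\<^sup>2" ?q 0] r by simp
    then have "(\<integral>l. ?q (0 + r\<^sup>2 * l) \<partial>lborel) = subc s / r\<^sup>2" using r by simp
    moreover have "r powr (2 + 2 * s) / r\<^sup>2 = r powr (2 * s)" using r by (simp add: powr_add)
    moreover have "r powr (2 + 2 * s) * (subc s / r\<^sup>2) = subc s * (r powr (2 + 2 * s) / r\<^sup>2)" by simp
    moreover have "(\<integral>l. r powr (2 + 2 * s) * ?q (0 + r\<^sup>2 * l) \<partial>lborel) = r powr (2 + 2 * s) * (\<integral>l. ?q (0 + r\<^sup>2 * l) \<partial>lborel)"
      by (rule integral_mult_right_zero)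
    ultimately show ?thesis
      unfolding e using integrable_mult_right[OF i, of "r powr (2 + 2 * s)"] by (simp only:)
  qed simp
  then show "integrable lborel (\<lambda>l. indicator {0<..} l * ((1 - exp (- (l * r\<^sup>2))) * l powr (-1 - s)))"
    "(\<integral>l. indicator {0<..} l * ((1 - exp (- (l * r\<^sup>2))) * l powr (-1 - s)) \<partial>lborel) = subc s * r powr (2 * s)" by auto
qed

text \<open>Insert the superposition of \<open>subc_scale\<close> into the Fourier integral and
  exchange; for fixed l the two frequency integrals are \<open>fourier_inversion\<close> and
  \<open>heat_fourier\<close>. Integrability in l comes from the same application of Fubini's
  theorem.\<close>

lemma frac_lap_rep:
  fixes f :: "'a::euclidean_space \<Rightarrow> real \<Rightarrow> real"
  assumes f: "bumplike f" and s: "0 < s" "s < 1"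
  shows "subc s * frac_lap s (tensor f) x = (\<integral>l. indicator {0<..} l * l powr (-1 - s) * (tensor f x - heatr l (tensor f) x) \<partial>lborel)"
    "integrable lborel (\<lambda>l. indicator {0<..} l * l powr (-1 - s) * (tensor f x - heatr l (tensor f) x))"
proof -
  let ?g = "tensor f"
  note [measurable] = bumplike_measurable[OF f]
  obtain w where w: "integrable lborel w" "\<And>\<xi>. (1 + (norm \<xi>)\<^sup>2) * norm (fourier ?g \<xi>) \<le> w \<xi>"
    using fourier_decay[OF f] by blast
  let ?c = "\<lambda>\<xi>. cis (x \<bullet> \<xi>) * fourier ?g \<xi>"
  let ?k = "\<lambda>l \<xi>. indicator {0<..} l * ((1 - exp (- (l * (norm \<xi>)\<^sup>2))) * l powr (-1 - s))"
  have ci: "integrable lborel ?c"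
  proof (rule Bochner_Integration.integrable_bound[OF w(1)])
    show "AE \<xi> in lborel. norm (?c \<xi>) \<le> norm (w \<xi>)"
    proof (rule AE_I2)
      fix \<xi> show "norm (?c \<xi>) \<le> norm (w \<xi>)"
        using w(2)[of \<xi>] mult_right_mono[of 1 "1 + (norm \<xi>)\<^sup>2" "norm (fourier ?g \<xi>)"] by (simp add: norm_mult)
    qed
  qed measurable
  have cei: "integrable lborel (\<lambda>\<xi>. complex_of_real (exp (- (l * (norm \<xi>)\<^sup>2))) * ?c \<xi>)" if "l > 0" for l
    by (rule Bochner_Integration.integrable_bound[OF ci]) (measurable, use that in \<open>auto simp: norm_mult intro!: mult_left_le_one_le\<close>)
  have pi: "integrable (lborel \<Otimes>\<^sub>M lborel) (\<lambda>(\<xi>, l). complex_of_real (?k l \<xi>) * ?c \<xi>)"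
  proof (rule lborel_pair.Fubini_integrable)
    show "(\<lambda>(\<xi>, l). complex_of_real (?k l \<xi>) * ?c \<xi>) \<in> borel_measurable (lborel \<Otimes>\<^sub>M lborel)" by measurable
    show "AE \<xi> in lborel. integrable lborel (\<lambda>l. case (\<xi>, l) of (\<xi>, l) \<Rightarrow> complex_of_real (?k l \<xi>) * ?c \<xi>)"
      using subc_scale(1)[OF s norm_ge_zero] by (intro AE_I2) (auto simp only: prod.case intro!: integrable_mult_left integrable_of_real)
    have "norm (complex_of_real (?k l \<xi>) * ?c \<xi>) = ?k l \<xi> * norm (fourier ?g \<xi>)" for l \<xi>
    proof -
      have "0 \<le> ?k l \<xi>" by (auto simp: indicator_def)
      then show ?thesis by (simp only: norm_mult norm_of_real norm_cis mult_1 abs_of_nonneg)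
    qed
    then have e: "(\<integral>l. norm (complex_of_real (?k l \<xi>) * ?c \<xi>) \<partial>lborel) = subc s * norm \<xi> powr (2 * s) * norm (fourier ?g \<xi>)" for \<xi>
      using subc_scale[OF s norm_ge_zero[of \<xi>]] by simp
    show "integrable lborel (\<lambda>\<xi>. \<integral>l. norm (case (\<xi>, l) of (\<xi>, l) \<Rightarrow> complex_of_real (?k l \<xi>) * ?c \<xi>) \<partial>lborel)"
      unfolding prod.case e
    proof (rule Bochner_Integration.integrable_bound[of _ "\<lambda>\<xi>. subc s * w \<xi>"])
      show "AE \<xi> in lborel. norm (subc s * norm \<xi> powr (2 * s) * norm (fourier ?g \<xi>)) \<le> norm (subc s * w \<xi>)"
      proof (rule AE_I2)
        fix \<xi> :: 'a
        have "norm \<xi> powr (2 * s) \<le> 1 + (norm \<xi>)\<^sup>2"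
        proof (cases "norm \<xi> \<le> 1")
          case True
          then have "norm \<xi> powr (2 * s) \<le> 1" using s by (intro powr_le1) auto
          then show ?thesis by (simp add: add_increasing2)
        next
          case False
          then have "norm \<xi> powr (2 * s) \<le> norm \<xi> powr 2" using s by (intro powr_mono) auto
          then show ?thesis by simp
        qed
        then have "norm \<xi> powr (2 * s) * norm (fourier ?g \<xi>) \<le> (1 + (norm \<xi>)\<^sup>2) * norm (fourier ?g \<xi>)" by (intro mult_right_mono) auto
        then have "subc s * (norm \<xi> powr (2 * s) * norm (fourier ?g \<xi>)) \<le> subc s * w \<xi>"
          using subc_integrable(2)[OF s] w(2)[of \<xi>] by (intro mult_left_mono) auto
        then show "norm (subc s * norm \<xi> powr (2 * s) * norm (fourier ?g \<xi>)) \<le> norm (subc s * w \<xi>)"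
          using subc_integrable(2)[OF s] by (auto simp: mult.assoc intro: order_trans[OF _ abs_ge_self])
      qed
    qed (use w(1) in auto)
  qed
  have inner: "(\<integral>\<xi>. complex_of_real (?k l \<xi>) * ?c \<xi> \<partial>lborel) = complex_of_real ((2 * pi) ^ DIM('a) * (indicator {0<..} l * l powr (-1 - s) * (?g x - heatr l ?g x)))" for l
  proof (cases "l > 0")
    case True
    have "(\<integral>\<xi>. complex_of_real (?k l \<xi>) * ?c \<xi> \<partial>lborel) = (\<integral>\<xi>. complex_of_real (l powr (-1 - s)) * (?c \<xi> - complex_of_real (exp (- (l * (norm \<xi>)\<^sup>2))) * ?c \<xi>) \<partial>lborel)"
      using True by (intro Bochner_Integration.integral_cong refl) (simp add: algebra_simps)
    also have "\<dots> = complex_of_real (l powr (-1 - s)) * ((\<integral>\<xi>. ?c \<xi> \<partial>lborel) - (\<integral>\<xi>. complex_of_real (exp (- (l * (norm \<xi>)\<^sup>2))) * ?c \<xi> \<partial>lborel))"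
      using ci cei[OF True] by simp
    also have "(\<integral>\<xi>. complex_of_real (exp (- (l * (norm \<xi>)\<^sup>2))) * ?c \<xi> \<partial>lborel) = complex_of_real ((2 * pi) ^ DIM('a) * heatr l ?g x)"
      unfolding heat_fourier[OF f True, symmetric] by (intro Bochner_Integration.integral_cong refl) (simp add: ac_simps)
    also have "(\<integral>\<xi>. ?c \<xi> \<partial>lborel) = complex_of_real ((2 * pi) ^ DIM('a) * ?g x)" by (rule fourier_inversion[OF f])
    finally show ?thesis using True by (simp add: algebra_simps)
  qed simp
  have "(\<integral>\<xi>. (\<integral>l. complex_of_real (?k l \<xi>) * ?c \<xi> \<partial>lborel) \<partial>lborel) = (\<integral>l. (\<integral>\<xi>. complex_of_real (?k l \<xi>) * ?c \<xi> \<partial>lborel) \<partial>lborel)"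
    using lborel_pair.Fubini_integral[OF pi] by simp
  also have "\<dots> = complex_of_real ((2 * pi) ^ DIM('a) * (\<integral>l. indicator {0<..} l * l powr (-1 - s) * (?g x - heatr l ?g x) \<partial>lborel))"
    unfolding inner integral_complex_of_real by simp
  also have "(\<integral>\<xi>. (\<integral>l. complex_of_real (?k l \<xi>) * ?c \<xi> \<partial>lborel) \<partial>lborel) = (\<integral>\<xi>. complex_of_real (subc s) * (cis (x \<bullet> \<xi>) * complex_of_real (norm \<xi> powr (2 * s)) * fourier ?g \<xi>) \<partial>lborel)"
  proof (rule Bochner_Integration.integral_cong[OF refl])
    fix \<xi> :: 'a
    have "(\<integral>l. complex_of_real (?k l \<xi>) * ?c \<xi> \<partial>lborel) = complex_of_real (subc s * norm \<xi> powr (2 * s)) * ?c \<xi>"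
      unfolding subc_scale(2)[OF s norm_ge_zero, symmetric] integral_complex_of_real[symmetric]
      by (rule integral_mult_left_zero)
    then show "(\<integral>l. complex_of_real (?k l \<xi>) * ?c \<xi> \<partial>lborel) = complex_of_real (subc s) * (cis (x \<bullet> \<xi>) * complex_of_real (norm \<xi> powr (2 * s)) * fourier ?g \<xi>)"
      by (simp add: ac_simps)
  qed
  finally have main: "complex_of_real (subc s) * (\<integral>\<xi>. cis (x \<bullet> \<xi>) * complex_of_real (norm \<xi> powr (2 * s)) * fourier ?g \<xi> \<partial>lborel)
      = complex_of_real ((2 * pi) ^ DIM('a) * (\<integral>l. indicator {0<..} l * l powr (-1 - s) * (?g x - heatr l ?g x) \<partial>lborel))"
    by simp
  let ?I = "\<integral>\<xi>. cis (x \<bullet> \<xi>) * complex_of_real (norm \<xi> powr (2 * s)) * fourier ?g \<xi> \<partial>lborel"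
  have "subc s * Re ?I = (2 * pi) ^ DIM('a) * (\<integral>l. indicator {0<..} l * l powr (-1 - s) * (?g x - heatr l ?g x) \<partial>lborel)"
    using arg_cong[OF main, of Re] by (simp only: Re_complex_of_real) simp
  moreover have "frac_lap s ?g x = Re ?I / (2 * pi) ^ DIM('a)"
  proof -
    have "(1 / (2 * complex_of_real pi) ^ DIM('a)) * ?I = complex_of_real (1 / (2 * pi) ^ DIM('a)) * ?I" by simp
    then show ?thesis unfolding frac_lap_def by (simp del: of_real_divide of_real_power of_real_mult)
  qed
  ultimately show "subc s * frac_lap s ?g x = (\<integral>l. indicator {0<..} l * l powr (-1 - s) * (?g x - heatr l ?g x) \<partial>lborel)"
    by simp
  have "integrable lborel (\<lambda>l. Re (\<integral>\<xi>. complex_of_real (?k l \<xi>) * ?c \<xi> \<partial>lborel))"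
    using lborel_pair.integrable_snd[OF pi] by (intro integrable_Re) simp
  then have "integrable lborel (\<lambda>l. (2 * pi) ^ DIM('a) * (indicator {0<..} l * l powr (-1 - s) * (?g x - heatr l ?g x)))"
    unfolding inner Re_complex_of_real .
  then show "integrable lborel (\<lambda>l. indicator {0<..} l * l powr (-1 - s) * (?g x - heatr l ?g x))"
    by (subst (asm) integrable_mult_left_iff) auto
qed

section \<open>Truncating the fractional Laplacian\<close>

lemma nn_integral_translate:
  fixes f :: "'a::euclidean_space \<Rightarrow> ennreal"
  assumes [measurable]: "f \<in> borel_measurable borel"
  shows "(\<integral>\<^sup>+y. f (y - h) \<partial>lborel) = (\<integral>\<^sup>+y. f y \<partial>lborel)"
proof -
  have "(\<integral>\<^sup>+y. f y \<partial>lborel) = (\<integral>\<^sup>+y. f y \<partial>(distr lborel borel ((+) (- h))))"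
    by (simp only: lborel_distr_plus)
  also have "\<dots> = (\<integral>\<^sup>+y. f (y - h) \<partial>lborel)"
    by (subst nn_integral_distr) auto
  finally show ?thesis by simp
qed

lemma integral_translate:
  fixes f :: "'a::euclidean_space \<Rightarrow> real"
  assumes [measurable]: "f \<in> borel_measurable borel"
  shows "(\<integral>y. f (y - h) \<partial>lborel) = (\<integral>y. f y \<partial>lborel)"
proof -
  have "(\<integral>y. f y \<partial>lborel) = (\<integral>y. f y \<partial>(distr lborel borel ((+) (- h))))"
    by (simp only: lborel_distr_plus)
  also have "\<dots> = (\<integral>y. f (y - h) \<partial>lborel)"
    by (subst integral_distr) auto
  finally show ?thesis by simp
qed

text \<open>A translate of a tensor is a tensor with translated factors, so all results for
  \<open>bumplike\<close> families apply to g(y - x) for every x.\<close>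

definition shift :: "'a::euclidean_space \<Rightarrow> ('a \<Rightarrow> real \<Rightarrow> real) \<Rightarrow> 'a \<Rightarrow> real \<Rightarrow> real" where
  "shift h f = (\<lambda>b t. f b (t - h \<bullet> b))"

lemma tensor_shift: "tensor (shift h f) y = tensor f (y - h)"
  by (simp add: tensor_def shift_def inner_diff_left)

lemma bumplike_shift:
  assumes "bumplike f" shows "bumplike (shift h f)"
proof -
  obtain R where R: "R \<ge> 0" "\<And>b t. b \<in> Basis \<Longrightarrow> t \<notin> {-R..R} \<Longrightarrow> f b t = 0" "\<And>b. b \<in> Basis \<Longrightarrow> smooth1 (f b)"
    "\<And>b t. b \<in> Basis \<Longrightarrow> 0 \<le> f b t"
    by (rule bumplike_props[OF assms]) blast
  have "smooth1 (shift h f b)" if "b \<in> Basis" for b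
    using smooth1_affine[OF R(3)[OF that], of 1 "- (h \<bullet> b)"] by (simp add: shift_def)
  moreover have "shift h f b t = 0" if b: "b \<in> Basis" and t: "t \<notin> {- (R + norm h)..R + norm h}" for b t
    unfolding shift_def using Basis_le_norm[OF b, of h] t by (intro R(2)[OF b]) auto
  ultimately show ?thesis
    unfolding bumplike_def using R(1,4) by (auto simp: shift_def intro!: exI[of _ "R + norm h"])
qed

lemma bumplike_bounded:
  assumes "bumplike f" obtains M where "\<And>x. tensor f x \<le> M"
proof -
  obtain C where C: "C \<ge> 0" "\<And>x. tensor f x \<le> C * exp (- ((norm x)\<^sup>2 / 64))" using bumplike_heat[OF assms] by blast
  have "C * exp (- ((norm x)\<^sup>2 / 64)) \<le> C * 1" for x :: 'a using C(1) by (intro mult_left_mono) auto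
  with C(2) have "tensor f x \<le> C" for x by (metis mult.right_neutral order_trans)
  then show ?thesis using that by blast
qed

lemma heatr_heat_tensor:
  assumes f: "bumplike f" and l: "l > 0"
  shows "ennreal (heatr l (tensor f) x) = heat l (\<lambda>y. ennreal (tensor f y)) x" "0 \<le> heatr l (tensor f) x"
proof -
  obtain M where "\<And>x. tensor f x \<le> M" using bumplike_bounded[OF f] by blast
  from heatr_heat(2,3)[OF bumplike_measurable[OF f] bumplike_nonneg[OF f] this l]
  show "ennreal (heatr l (tensor f) x) = heat l (\<lambda>y. ennreal (tensor f y)) x" "0 \<le> heatr l (tensor f) x" by auto
qed

lemma heatr_shift:
  assumes f: "bumplike f"
  shows "heatr l (tensor (shift h f)) x = heatr l (tensor f) (x - h)"
proof -
  note [measurable] = bumplike_measurable[OF f]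
  have "heatr l (tensor f) (x - h) = (\<integral>y. heat_ker l (x - h - (y - h)) * tensor f (y - h) \<partial>lborel)"
    unfolding heatr_def by (rule integral_translate[symmetric]) measurable
  then show ?thesis by (simp add: heatr_def tensor_shift)
qed

text \<open>\<open>frac_lap_rep\<close> reduces translation invariance to that of the heat
  flow.\<close>

lemma frac_lap_shift:
  assumes f: "bumplike f" and s: "0 < s" "s < 1"
  shows "frac_lap s (tensor (shift h f)) x = frac_lap s (tensor f) (x - h)"
proof -
  have "subc s * frac_lap s (tensor (shift h f)) x = subc s * frac_lap s (tensor f) (x - h)"
    unfolding frac_lap_rep(1)[OF f s] frac_lap_rep(1)[OF bumplike_shift[OF f] s] heatr_shift[OF f] tensor_shift ..
  then show ?thesis using subc_integrable(2)[OF s] by simp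
qed

lemma frac_lap_measurable:
  assumes [measurable]: "g \<in> borel_measurable borel"
  shows "frac_lap s g \<in> borel_measurable borel"
  unfolding frac_lap_def by measurable

lemma heat_mono_wgt:
  assumes "\<And>y. f y \<le> ennreal C * wgt s y"
  shows "heat l f x \<le> ennreal C * heat l (wgt s) x"
proof -
  have "heat l f x \<le> (\<integral>\<^sup>+y. ennreal C * (ennreal (heat_ker l (x - y)) * wgt s y) \<partial>lborel)"
    unfolding heat_def using assms by (intro nn_integral_mono) (metis mult.left_commute mult_left_mono zero_le)
  also have "\<dots> = ennreal C * heat l (wgt s) x" unfolding heat_def by (rule nn_integral_cmult) measurable
  finally show ?thesis .
qed

lemma jump_mono_wgt:
  assumes "\<And>y. f y \<le> ennreal C * wgt s y"
  shows "jump s \<delta> f x \<le> ennreal C * jump s \<delta> (wgt s) x"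
proof -
  have "jump s \<delta> f x \<le> (\<integral>\<^sup>+l. ennreal C * (indicator {\<delta>..} l * ennreal (l powr (-1 - s)) * heat l (wgt s) x) \<partial>lborel)"
    unfolding jump_def using heat_mono_wgt[of f C s, OF assms]
    by (intro nn_integral_mono) (metis mult.left_commute mult_left_mono zero_le)
  also have "\<dots> = ennreal C * jump s \<delta> (wgt s) x" unfolding jump_def by (rule nn_integral_cmult) measurable
  finally show ?thesis .
qed

lemma wgt_finite:
  fixes x :: "'a::euclidean_space"
  assumes "0 < s" "s < 1" shows "wgt s x < \<top>"
  using wgt_le_Phi[OF assms, where 'a = 'a] by (metis ennreal_less_top le_less_trans)

lemma jump_bump_le:
  assumes f: "bumplike f" and s: "0 < s" "s < 1" and \<delta>: "0 < \<delta>" "\<delta> \<le> 1"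
  shows "\<exists>C\<ge>0. \<forall>x. jump s \<delta> (\<lambda>y. ennreal (tensor f y)) x \<le> ennreal C * wgt s x"
proof -
  obtain C where C: "C \<ge> 0" "\<And>x. ennreal (tensor f x) \<le> ennreal C * wgt s x"
    using bumplike_wgt[OF f s] by blast
  define B where "B = \<delta> powr (- s) / s + (3 / (1 - s) + 8 / s)"
  have B: "B \<ge> 0" using s by (simp add: B_def)
  have "jump s \<delta> (\<lambda>y. ennreal (tensor f y)) x \<le> ennreal (C * B) * wgt s x" for x
  proof -
    have "jump s \<delta> (\<lambda>y. ennreal (tensor f y)) x \<le> ennreal C * jump s \<delta> (wgt s) x" by (rule jump_mono_wgt[OF C(2)])
    also have "\<dots> \<le> ennreal C * (ennreal B * wgt s x)"
      unfolding B_def by (intro mult_left_mono jump_wgt_le s \<delta>) auto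
    finally show ?thesis using B C(1) by (simp add: ennreal_mult mult.assoc)
  qed
  then show ?thesis using B C(1) by (intro exI[of _ "C * B"]) auto
qed

lemma jump_bump_finite:
  assumes f: "bumplike f" and s: "0 < s" "s < 1" and \<delta>: "0 < \<delta>" "\<delta> \<le> 1"
  shows "jump s \<delta> (\<lambda>y. ennreal (tensor f y)) x < \<top>"
proof -
  obtain C where "\<And>x. jump s \<delta> (\<lambda>y. ennreal (tensor f y)) x \<le> ennreal C * wgt s x"
    using jump_bump_le[OF assms] by blast
  moreover have "ennreal C * wgt s x < \<top>" using wgt_finite[OF s, of x] by (simp add: ennreal_mult_less_top)
  ultimately show ?thesis by (rule le_less_trans)
qed

text \<open>Cut the integral of \<open>frac_lap_rep\<close> at \<delta>. Above, l^(-1-s) is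
  integrable and the difference splits into K g and P g; below, |g - H l g| \<le> C l \<zeta>
  integrates to the error. \<open>C\<close> is a parameter rather than existentially quantified, as
  it must be the same for all \<delta>.\<close>

lemma frac_lap_split:
  fixes f :: "'a::euclidean_space \<Rightarrow> real \<Rightarrow> real"
  assumes f: "bumplike f" and s: "0 < s" "s < 1" and \<delta>: "0 < \<delta>" "\<delta> \<le> 1"
    and C: "C \<ge> 0" "\<And>l x. 0 < l \<Longrightarrow> l \<le> 1 \<Longrightarrow> ennreal \<bar>tensor f x - heatr l (tensor f) x\<bar> \<le> ennreal (C * l) * wgt s x"
  shows "ennreal \<bar>\<delta> powr (- s) / s * tensor f x - enn2real (jump s \<delta> (\<lambda>y. ennreal (tensor f y)) x) - subc s * frac_lap s (tensor f) x\<bar>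
     \<le> ennreal (C * (\<delta> powr (1 - s) / (1 - s))) * wgt s x"
proof -
  let ?g = "tensor f"
  let ?\<phi> = "\<lambda>l. indicator {0<..} l * l powr (-1 - s) * (?g x - heatr l ?g x)"
  note rep = frac_lap_rep[OF f s, of x]
  have m1: "?\<phi> \<in> borel_measurable borel" using rep(2) by (simp add: borel_measurable_integrable)
  have a: "integrable lborel (\<lambda>l. indicator {0<..<\<delta>} l * ?\<phi> l)" "integrable lborel (\<lambda>l. indicator {\<delta>..} l * ?\<phi> l)"
    using integrable_mult_indicator[OF _ rep(2), of "{0<..<\<delta>}"] integrable_mult_indicator[OF _ rep(2), of "{\<delta>..}"] by auto
  have b: "integrable lborel (\<lambda>l. indicator {\<delta>..} l * l powr (-1 - s))" "(\<integral>l. indicator {\<delta>..} l * l powr (-1 - s) \<partial>lborel) = \<delta> powr (- s) / s"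
  proof -
    have e: "(\<integral>\<^sup>+l. ennreal (indicator {\<delta>..} l * l powr (-1 - s)) \<partial>lborel) = ennreal (\<delta> powr (- s) / s)"
      using nn_integral_powr_tail[OF \<delta>(1) s(1)] by (simp add: ennreal_mult' ennreal_indicator)
    show "integrable lborel (\<lambda>l. indicator {\<delta>..} l * l powr (-1 - s))"
      using e by (intro integrableI_nonneg) auto
    show "(\<integral>l. indicator {\<delta>..} l * l powr (-1 - s) \<partial>lborel) = \<delta> powr (- s) / s"
      using e s by (subst integral_eq_nn_integral) auto
  qed
  have c: "integrable lborel (\<lambda>l. indicator {\<delta>..} l * l powr (-1 - s) * heatr l ?g x)"
  proof -
    have "integrable lborel (\<lambda>l. indicator {\<delta>..} l * l powr (-1 - s) * ?g x - indicator {\<delta>..} l * ?\<phi> l)"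
      using a(2) b(1) by auto
    moreover have "indicator {\<delta>..} l * l powr (-1 - s) * ?g x - indicator {\<delta>..} l * ?\<phi> l = indicator {\<delta>..} l * l powr (-1 - s) * heatr l ?g x" for l
      using \<delta> by (auto simp: indicator_def algebra_simps)
    ultimately show ?thesis by simp
  qed
  have d: "enn2real (jump s \<delta> (\<lambda>y. ennreal (?g y)) x) = (\<integral>l. indicator {\<delta>..} l * l powr (-1 - s) * heatr l ?g x \<partial>lborel)"
  proof -
    have nn: "0 \<le> indicator {\<delta>..} l * l powr (-1 - s) * heatr l ?g x" for l
      using heatr_heat_tensor(2)[OF f, of l x] \<delta> by (auto simp: indicator_def)
    have "jump s \<delta> (\<lambda>y. ennreal (?g y)) x = (\<integral>\<^sup>+l. ennreal (indicator {\<delta>..} l * l powr (-1 - s) * heatr l ?g x) \<partial>lborel)"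
      unfolding jump_def
    proof (rule nn_integral_cong)
      fix l :: real
      show "indicator {\<delta>..} l * ennreal (l powr (-1 - s)) * heat l (\<lambda>y. ennreal (?g y)) x = ennreal (indicator {\<delta>..} l * l powr (-1 - s) * heatr l ?g x)"
        using heatr_heat_tensor[OF f, of l x] \<delta> by (auto simp: indicator_def ennreal_mult)
    qed
    also have "\<dots> = ennreal (\<integral>l. indicator {\<delta>..} l * l powr (-1 - s) * heatr l ?g x \<partial>lborel)"
      using nn by (intro nn_integral_eq_integral c) auto
    finally show ?thesis using nn by simp
  qed
  have "subc s * frac_lap s ?g x = (\<integral>l. indicator {0<..<\<delta>} l * ?\<phi> l + indicator {\<delta>..} l * ?\<phi> l \<partial>lborel)"
    unfolding rep(1) using \<delta> by (intro Bochner_Integration.integral_cong) (auto simp: indicator_def)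
  also have "\<dots> = (\<integral>l. indicator {0<..<\<delta>} l * ?\<phi> l \<partial>lborel) + (\<integral>l. indicator {\<delta>..} l * ?\<phi> l \<partial>lborel)"
    using a by simp
  also have "(\<integral>l. indicator {\<delta>..} l * ?\<phi> l \<partial>lborel) = (\<integral>l. indicator {\<delta>..} l * l powr (-1 - s) * ?g x - indicator {\<delta>..} l * l powr (-1 - s) * heatr l ?g x \<partial>lborel)"
    using \<delta> by (intro Bochner_Integration.integral_cong) (auto simp: indicator_def algebra_simps)
  also have "\<dots> = \<delta> powr (- s) / s * ?g x - enn2real (jump s \<delta> (\<lambda>y. ennreal (?g y)) x)"
    unfolding d using b c by simp
  finally have "\<bar>\<delta> powr (- s) / s * ?g x - enn2real (jump s \<delta> (\<lambda>y. ennreal (?g y)) x) - subc s * frac_lap s ?g x\<bar> = \<bar>\<integral>l. indicator {0<..<\<delta>} l * ?\<phi> l \<partial>lborel\<bar>"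
    by simp
  note eq = arg_cong[OF this, of ennreal]
  have "ennreal \<bar>\<integral>l. indicator {0<..<\<delta>} l * ?\<phi> l \<partial>lborel\<bar> \<le> (\<integral>\<^sup>+l. ennreal \<bar>indicator {0<..<\<delta>} l * ?\<phi> l\<bar> \<partial>lborel)"
    using integral_norm_bound_ennreal[OF a(1)] by (simp only: real_norm_def)
  also have "\<dots> \<le> (\<integral>\<^sup>+l. ennreal C * wgt s x * (indicator {0..\<delta>} l * ennreal (l powr (- s))) \<partial>lborel)"
  proof (rule nn_integral_mono)
    fix l :: real
    show "ennreal \<bar>indicator {0<..<\<delta>} l * ?\<phi> l\<bar> \<le> ennreal C * wgt s x * (indicator {0..\<delta>} l * ennreal (l powr (- s)))"
    proof (cases "l \<in> {0<..<\<delta>}")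
      case True
      then have l: "0 < l" "l \<le> 1" using \<delta> by auto
      have "indicator {0<..<\<delta>} l * ?\<phi> l = l powr (-1 - s) * (?g x - heatr l ?g x)"
        using True by simp
      then have "\<bar>indicator {0<..<\<delta>} l * ?\<phi> l\<bar> = l powr (-1 - s) * \<bar>?g x - heatr l ?g x\<bar>"
        by (simp only: abs_mult abs_of_nonneg[OF powr_ge_zero])
      then have "ennreal \<bar>indicator {0<..<\<delta>} l * ?\<phi> l\<bar> = ennreal (l powr (-1 - s)) * ennreal \<bar>?g x - heatr l ?g x\<bar>"
        by (simp only: ennreal_mult[OF powr_ge_zero abs_ge_zero])
      also have "\<dots> \<le> ennreal (l powr (-1 - s)) * (ennreal (C * l) * wgt s x)"
        by (rule mult_left_mono[OF C(2)[OF l]]) simp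
      also have "\<dots> = ennreal (l powr (-1 - s) * (C * l)) * wgt s x"
        using C(1) l by (simp add: ennreal_mult mult.assoc)
      also have "l powr (-1 - s) * (C * l) = C * l powr (- s)"
      proof -
        have "l powr (-1 - s) * (C * l) = C * (l * l powr (-1 - s))" by (simp only: ac_simps)
        also have "l * l powr (-1 - s) = l powr (- s)" using powr_mult_base[of l "-1 - s"] l by simp
        finally show ?thesis .
      qed
      also have "ennreal (C * l powr (- s)) * wgt s x = ennreal C * wgt s x * ennreal (l powr (- s))"
        unfolding ennreal_mult[OF C(1) powr_ge_zero] by (simp only: ac_simps)
      finally show ?thesis using True by simp
    qed simp
  qed
  also have "\<dots> = ennreal C * wgt s x * ennreal (\<delta> powr (1 - s) / (1 - s))"
    using nn_integral_powr_head[of \<delta> s] \<delta> s by (subst nn_integral_cmult) auto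
  also have "\<dots> = ennreal (C * (\<delta> powr (1 - s) / (1 - s))) * wgt s x"
  proof -
    have "ennreal (C * (\<delta> powr (1 - s) / (1 - s))) = ennreal C * ennreal (\<delta> powr (1 - s) / (1 - s))"
      using C(1) s by (intro ennreal_mult) auto
    then show ?thesis by (simp only: ac_simps)
  qed
  finally show ?thesis unfolding eq .
qed

text \<open>The splitting at \<delta> = 1: the error, g / s and P g are each bounded by the weight.
  This makes the pairing of a solution with (-\<Delta>)^s of a bump absolutely convergent.\<close>

lemma frac_lap_wgt_bound:
  assumes f: "bumplike f" and s: "0 < s" "s < 1"
  shows "\<exists>C\<ge>0. \<forall>x. ennreal \<bar>frac_lap s (tensor f) x\<bar> \<le> ennreal C * wgt s x"
proof -
  obtain C where C: "C \<ge> 0" "\<And>x. ennreal (tensor f x) \<le> ennreal C * wgt s x"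
      "\<And>l x. 0 < l \<Longrightarrow> l \<le> 1 \<Longrightarrow> ennreal \<bar>tensor f x - heatr l (tensor f) x\<bar> \<le> ennreal (C * l) * wgt s x"
    using bumplike_wgt[OF f s] by blast
  obtain B where B: "B \<ge> 0" "\<And>x. jump s 1 (\<lambda>y. ennreal (tensor f y)) x \<le> ennreal B * wgt s x"
    using jump_bump_le[OF f s, of 1] by auto
  define D where "D = C / (1 - s) + (C / s + B)"
  have D: "D \<ge> 0" using B C s by (simp add: D_def)
  have "ennreal \<bar>frac_lap s (tensor f) x\<bar> \<le> ennreal (D / subc s) * wgt s x" for x
  proof -
    let ?g = "tensor f" and ?J = "enn2real (jump s 1 (\<lambda>y. ennreal (tensor f y)) x)"
    have c: "subc s > 0" by (rule subc_integrable(2)[OF s])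
    have g0: "0 \<le> ?g x" by (rule bumplike_nonneg[OF f])
    have "subc s * \<bar>frac_lap s ?g x\<bar> = \<bar>subc s * frac_lap s ?g x\<bar>" using c by (simp add: abs_mult)
    also have "\<dots> \<le> \<bar>1 powr (- s) / s * ?g x - ?J - subc s * frac_lap s ?g x\<bar> + (1 / s * ?g x + ?J)"
    proof -
      have "\<bar>c\<bar> \<le> \<bar>a - J - c\<bar> + (a + J)" if "a \<ge> 0" "J \<ge> 0" for a J c :: real using that by linarith
      from this[of "1 / s * ?g x" ?J "subc s * frac_lap s ?g x"] show ?thesis using g0 s by simp
    qed
    finally have "ennreal (subc s * \<bar>frac_lap s ?g x\<bar>) \<le> ennreal \<bar>1 powr (- s) / s * ?g x - ?J - subc s * frac_lap s ?g x\<bar> + (ennreal (1 / s * ?g x) + ennreal ?J)"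
      using g0 s by (simp add: ennreal_leI flip: ennreal_plus)
    also have "\<dots> \<le> ennreal (C * (1 powr (1 - s) / (1 - s))) * wgt s x + (ennreal (1 / s) * (ennreal C * wgt s x) + ennreal B * wgt s x)"
    proof (intro add_mono)
      show "ennreal \<bar>1 powr (- s) / s * ?g x - ?J - subc s * frac_lap s ?g x\<bar> \<le> ennreal (C * (1 powr (1 - s) / (1 - s))) * wgt s x"
        by (rule frac_lap_split[OF f s _ _ C(1,3)]) auto
      show "ennreal (1 / s * ?g x) \<le> ennreal (1 / s) * (ennreal C * wgt s x)"
        using s g0 C(2)[of x] by (subst ennreal_mult) (auto intro!: mult_left_mono)
      show "ennreal ?J \<le> ennreal B * wgt s x"
        using B(2)[of x] jump_bump_finite[OF f s, of 1 x] by simp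
    qed
    also have "\<dots> = ennreal D * wgt s x"
    proof -
      have "ennreal D = ennreal (C * (1 powr (1 - s) / (1 - s))) + (ennreal (1 / s * C) + ennreal B)"
        unfolding D_def using C(1) B(1) s by (simp flip: ennreal_plus)
      moreover have "ennreal (1 / s * C) = ennreal (1 / s) * ennreal C" using C(1) s by (intro ennreal_mult) auto
      ultimately show ?thesis by (simp only: distrib_right mult.assoc)
    qed
    finally have "ennreal (subc s * \<bar>frac_lap s ?g x\<bar>) \<le> ennreal D * wgt s x" .
    then have "ennreal (1 / subc s) * ennreal (subc s * \<bar>frac_lap s ?g x\<bar>) \<le> ennreal (1 / subc s) * (ennreal D * wgt s x)"
      by (intro mult_left_mono) auto
    moreover have "ennreal (1 / subc s) * ennreal (subc s * \<bar>frac_lap s ?g x\<bar>) = ennreal \<bar>frac_lap s ?g x\<bar>"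
      using c by (simp flip: ennreal_mult)
    moreover have "ennreal (1 / subc s) * ennreal D = ennreal (D / subc s)"
      using c D by (simp flip: ennreal_mult)
    ultimately show ?thesis by (simp only: mult.assoc[symmetric])
  qed
  then show ?thesis using D subc_integrable(2)[OF s] by (intro exI[of _ "D / subc s"]) auto
qed

text \<open>Integrating in l first exhibits P as convolution with a single nonnegative kernel; for
  \<delta> = 1 this kernel is \<open>wgt s\<close>.\<close>

definition jump_ker :: "real \<Rightarrow> real \<Rightarrow> 'a::euclidean_space \<Rightarrow> ennreal" where
  "jump_ker s \<delta> z = (\<integral>\<^sup>+l. indicator {\<delta>..} l * ennreal (l powr (-1 - s)) * ennreal (heat_ker l z) \<partial>lborel)"

lemma jump_ker_measurable[measurable]: "jump_ker s \<delta> \<in> borel_measurable borel"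
  unfolding jump_ker_def by measurable

lemma jump_ker_minus_commute: "jump_ker s \<delta> (x - y) = jump_ker s \<delta> (y - x)"
  by (simp add: jump_ker_def heat_ker_minus_commute[of _ x y])

lemma jump_jump_ker:
  fixes f :: "'a::euclidean_space \<Rightarrow> ennreal"
  assumes [measurable]: "f \<in> borel_measurable borel"
  shows "jump s \<delta> f x = (\<integral>\<^sup>+y. jump_ker s \<delta> (x - y) * f y \<partial>lborel)"
proof -
  have "(\<integral>\<^sup>+y. jump_ker s \<delta> (x - y) * f y \<partial>lborel) =
      (\<integral>\<^sup>+y. (\<integral>\<^sup>+l. indicator {\<delta>..} l * ennreal (l powr (-1 - s)) * ennreal (heat_ker l (x - y)) * f y \<partial>lborel) \<partial>lborel)"
    unfolding jump_ker_def by (intro nn_integral_cong nn_integral_multc[symmetric]) measurable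
  also have "\<dots> = (\<integral>\<^sup>+l. (\<integral>\<^sup>+y. indicator {\<delta>..} l * ennreal (l powr (-1 - s)) * ennreal (heat_ker l (x - y)) * f y \<partial>lborel) \<partial>lborel)"
    by (rule lborel_pair.Fubini') measurable
  also have "\<dots> = jump s \<delta> f x"
    unfolding jump_def heat_def mult.assoc
    by (intro nn_integral_cong) (subst nn_integral_cmult[symmetric], auto simp: nn_integral_cmult)
  finally show ?thesis ..
qed

lemma wgt_conv_le:
  assumes "0 < s" "s < 1"
  shows "(\<integral>\<^sup>+y. wgt s (x - y) * wgt s y \<partial>lborel) \<le> ennreal (8 / s) * wgt s x"
  using jump_wgt_1_le[OF assms, of x] jump_jump_ker[of "wgt s" s 1 x] by (simp add: wgt_def[of s "_ - _"] jump_ker_def)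

lemma jump_ker_finite:
  assumes "0 < s" "0 < \<delta>"
  shows "jump_ker s \<delta> (z :: 'a::euclidean_space) < \<top>"
proof -
  define c where "c = (1 / sqrt (4 * pi * \<delta>)) ^ DIM('a)"
  have "jump_ker s \<delta> z \<le> (\<integral>\<^sup>+l. (indicator {\<delta>..} l * ennreal (l powr (-1 - s))) * ennreal c \<partial>lborel)"
    unfolding jump_ker_def
  proof (intro nn_integral_mono)
    fix l :: real
    have "heat_ker l z \<le> c" if l: "l \<ge> \<delta>"
    proof -
      have "heat_ker l z = (1 / sqrt (4 * pi * l)) ^ DIM('a) * exp (- ((norm z)\<^sup>2 / (4 * l)))" using l assms by (intro heat_ker_eq) auto
      also have "\<dots> \<le> c * 1"
        unfolding c_def using l assms by (intro mult_mono power_mono divide_left_mono) auto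
      finally show ?thesis by simp
    qed
    then show "indicator {\<delta>..} l * ennreal (l powr (-1 - s)) * ennreal (heat_ker l z) \<le> indicator {\<delta>..} l * ennreal (l powr (-1 - s)) * ennreal c"
      by (cases "l \<ge> \<delta>") (auto intro!: mult_left_mono ennreal_leI)
  qed
  also have "\<dots> = ennreal (\<delta> powr (- s) / s) * ennreal c"
    by (subst nn_integral_multc) (use nn_integral_powr_tail[OF assms(2,1)] in auto)
  also have "\<dots> < \<top>" by (simp add: ennreal_mult_less_top)
  finally show ?thesis .
qed

lemma integrable_against_wgt:
  fixes v :: "'a::euclidean_space \<Rightarrow> real"
  assumes [measurable]: "v \<in> borel_measurable borel" "h \<in> borel_measurable borel"
    and fin: "(\<integral>\<^sup>+y. ennreal \<bar>v y\<bar> * wgt s y \<partial>lborel) < \<top>"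
    and h: "\<And>y. ennreal \<bar>h y\<bar> \<le> ennreal C * wgt s y"
  shows "integrable lborel (\<lambda>y. v y * h y)"
proof (rule integrableI_bounded)
  have "(\<integral>\<^sup>+y. ennreal (norm (v y * h y)) \<partial>lborel) \<le> (\<integral>\<^sup>+y. ennreal C * (ennreal \<bar>v y\<bar> * wgt s y) \<partial>lborel)"
  proof (rule nn_integral_mono)
    fix y
    have "ennreal (norm (v y * h y)) = ennreal \<bar>v y\<bar> * ennreal \<bar>h y\<bar>" by (simp add: abs_mult ennreal_mult)
    also have "\<dots> \<le> ennreal \<bar>v y\<bar> * (ennreal C * wgt s y)" by (intro mult_left_mono h) auto
    finally show "ennreal (norm (v y * h y)) \<le> ennreal C * (ennreal \<bar>v y\<bar> * wgt s y)" by (simp add: ac_simps)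
  qed
  also have "\<dots> = ennreal C * (\<integral>\<^sup>+y. ennreal \<bar>v y\<bar> * wgt s y \<partial>lborel)" by (rule nn_integral_cmult) measurable
  also have "\<dots> < \<infinity>" using fin by (simp add: ennreal_mult_less_top)
  finally show "(\<integral>\<^sup>+y. ennreal (norm (v y * h y)) \<partial>lborel) < \<infinity>" .
qed measurable

text \<open>By \<open>frac_lap_split\<close>, K g minus the scaled fractional Laplacian is P g plus
  an error. Fubini's theorem moves P from the bump to the correlation of \<open>v\<close> with its
  translates, and positivity of the kernel lets the absolute value inside. The error is paired with
  |v| directly.\<close>

lemma source_bound:
  fixes v :: "'a::euclidean_space \<Rightarrow> real"
  assumes vm[measurable]: "v \<in> borel_measurable borel"
    and fin: "(\<integral>\<^sup>+y. ennreal \<bar>v y\<bar> * wgt s y \<partial>lborel) < \<top>"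
    and f: "bumplike f" and s: "0 < s" "s < 1" and \<delta>: "0 < \<delta>" "\<delta> \<le> 1"
    and C: "C \<ge> 0" "\<And>l x. 0 < l \<Longrightarrow> l \<le> 1 \<Longrightarrow> ennreal \<bar>tensor f x - heatr l (tensor f) x\<bar> \<le> ennreal (C * l) * wgt s x"
  shows "ennreal \<bar>\<delta> powr (- s) / s * (\<integral>y. v y * tensor f (y - x) \<partial>lborel) - subc s * (\<integral>y. v y * frac_lap s (tensor f) (y - x) \<partial>lborel)\<bar>
    \<le> jump s \<delta> (\<lambda>x'. ennreal \<bar>\<integral>y. v y * tensor f (y - x') \<partial>lborel\<bar>) x
      + ennreal (C * (\<delta> powr (1 - s) / (1 - s))) * (\<integral>\<^sup>+y. ennreal \<bar>v y\<bar> * wgt s (y - x) \<partial>lborel)"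
proof -
  let ?g = "tensor f"
  note [measurable] = bumplike_measurable[OF f] frac_lap_measurable[OF bumplike_measurable[OF f]]
  have g0: "0 \<le> ?g y" for y by (rule bumplike_nonneg[OF f])
  define W where "W = (\<lambda>x'. \<integral>y. v y * ?g (y - x') \<partial>lborel)"
  \<comment> \<open>The real-valued kernel, so that Fubini's theorem for signed integrands applies;
    \<open>jump_ker_finite\<close> ensures that nothing is lost.\<close>
  define pr where "pr = (\<lambda>z::'a. enn2real (jump_ker s \<delta> z))"
  have pr: "ennreal (pr z) = jump_ker s \<delta> z" for z unfolding pr_def using jump_ker_finite[OF s(1) \<delta>(1), of z] by simp
  have pr0: "0 \<le> pr z" for z by (simp add: pr_def)
  have [measurable]: "pr \<in> borel_measurable borel" "W \<in> borel_measurable borel" unfolding pr_def W_def by measurable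
  define P where "P = (\<lambda>y. enn2real (jump s \<delta> (\<lambda>y. ennreal (?g y)) (y - x)))"
  define R where "R = (\<lambda>y. \<delta> powr (- s) / s * ?g (y - x) - P y - subc s * frac_lap s ?g (y - x))"
  have [measurable]: "P \<in> borel_measurable borel" "R \<in> borel_measurable borel" unfolding R_def P_def by measurable
  have Pjump: "ennreal (P y) = (\<integral>\<^sup>+x'. ennreal (pr (x' - x) * ?g (y - x')) \<partial>lborel)" for y
  proof -
    have "ennreal (P y) = jump s \<delta> (\<lambda>y. ennreal (?g y)) (y - x)"
      unfolding P_def using jump_bump_finite[OF f s \<delta>] by simp
    also have "\<dots> = (\<integral>\<^sup>+u. jump_ker s \<delta> (y - x - u) * ennreal (?g u) \<partial>lborel)" by (rule jump_jump_ker) measurable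
    \<comment> \<open>Substituting u = y - x' makes x' the point at which \<open>v\<close> is
      correlated with the bump, and leaves x' - x in the kernel.\<close>
    also have "\<dots> = (\<integral>\<^sup>+x'. jump_ker s \<delta> (y - x - (y - x')) * ennreal (?g (y - x')) \<partial>lborel)"
      by (rule nn_integral_lborel_reflect[symmetric]) measurable
    also have "\<dots> = (\<integral>\<^sup>+x'. ennreal (pr (x' - x) * ?g (y - x')) \<partial>lborel)"
      using g0 pr0 by (simp add: ennreal_mult pr)
    finally show ?thesis .
  qed
  have Pi: "integrable lborel (\<lambda>x'. pr (x' - x) * ?g (y - x'))" for y
    using Pjump[of y] g0 pr0 by (intro integrableI_nonneg) (auto simp flip: Pjump)
  have P0: "0 \<le> P y" for y by (simp add: P_def)
  have Peq: "P y = (\<integral>x'. pr (x' - x) * ?g (y - x') \<partial>lborel)" for y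
    using Pjump[of y] nn_integral_eq_integral[OF Pi[of y]] g0 pr0 P0 by simp
  obtain Cx where Cx: "\<And>y. ennreal (?g (y - x)) \<le> ennreal Cx * wgt s y"
    using bumplike_wgt[OF bumplike_shift[OF f, of x] s] by (auto simp: tensor_shift)
  obtain Dx where Dx: "\<And>y. ennreal \<bar>frac_lap s ?g (y - x)\<bar> \<le> ennreal Dx * wgt s y"
    using frac_lap_wgt_bound[OF bumplike_shift[OF f, of x] s] by (auto simp: frac_lap_shift[OF f s])
  obtain Ex where Ex: "\<And>y. jump s \<delta> (\<lambda>y. ennreal (?g (y - x))) y \<le> ennreal Ex * wgt s y"
    using jump_bump_le[OF bumplike_shift[OF f, of x] s \<delta>] by (auto simp: tensor_shift)
  have PEx: "ennreal \<bar>P y\<bar> \<le> ennreal Ex * wgt s y" for y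
  proof -
    have "jump s \<delta> (\<lambda>y. ennreal (?g (y - x))) y = (\<integral>\<^sup>+u. jump_ker s \<delta> (y - u) * ennreal (?g (u - x)) \<partial>lborel)"
      by (rule jump_jump_ker) measurable
    also have "\<dots> = (\<integral>\<^sup>+u. jump_ker s \<delta> (y - x - (u - x)) * ennreal (?g (u - x)) \<partial>lborel)" by simp
    also have "\<dots> = (\<integral>\<^sup>+u. jump_ker s \<delta> (y - x - u) * ennreal (?g u) \<partial>lborel)"
      by (rule nn_integral_translate) measurable
    also have "\<dots> = jump s \<delta> (\<lambda>y. ennreal (?g y)) (y - x)" by (rule jump_jump_ker[symmetric]) measurable
    also have "\<dots> = ennreal (P y)" unfolding P_def using jump_bump_finite[OF f s \<delta>] by simp
    finally show ?thesis using Ex[of y] P0[of y] by simp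
  qed
  have i1: "integrable lborel (\<lambda>y. v y * ?g (y - x))"
    using g0 Cx by (intro integrable_against_wgt[OF vm _ fin, of _ Cx]) auto
  have i2: "integrable lborel (\<lambda>y. v y * frac_lap s ?g (y - x))"
    by (rule integrable_against_wgt[OF vm _ fin Dx]) measurable
  have i3: "integrable lborel (\<lambda>y. v y * P y)"
    by (rule integrable_against_wgt[OF vm _ fin PEx]) measurable
  have i4: "integrable lborel (\<lambda>y. v y * R y)"
  proof -
    have "integrable lborel (\<lambda>y. \<delta> powr (- s) / s * (v y * ?g (y - x)) - v y * P y - subc s * (v y * frac_lap s ?g (y - x)))"
      using i1 i2 i3 by auto
    then show ?thesis by (simp add: R_def algebra_simps)
  qed
  have "\<delta> powr (- s) / s * (\<integral>y. v y * ?g (y - x) \<partial>lborel) - subc s * (\<integral>y. v y * frac_lap s ?g (y - x) \<partial>lborel)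
      = (\<integral>y. \<delta> powr (- s) / s * (v y * ?g (y - x)) - subc s * (v y * frac_lap s ?g (y - x)) \<partial>lborel)"
    using i1 i2 by simp
  also have "\<dots> = (\<integral>y. v y * P y + v y * R y \<partial>lborel)"
    by (intro Bochner_Integration.integral_cong) (auto simp: R_def algebra_simps)
  also have "\<dots> = (\<integral>y. v y * P y \<partial>lborel) + (\<integral>y. v y * R y \<partial>lborel)" using i3 i4 by simp
  finally have split: "\<delta> powr (- s) / s * (\<integral>y. v y * ?g (y - x) \<partial>lborel) - subc s * (\<integral>y. v y * frac_lap s ?g (y - x) \<partial>lborel)
      = (\<integral>y. v y * P y \<partial>lborel) + (\<integral>y. v y * R y \<partial>lborel)" .
  have "ennreal \<bar>(\<integral>y. v y * P y \<partial>lborel) + (\<integral>y. v y * R y \<partial>lborel)\<bar> \<le> ennreal \<bar>\<integral>y. v y * P y \<partial>lborel\<bar> + ennreal \<bar>\<integral>y. v y * R y \<partial>lborel\<bar>"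
    by (simp add: ennreal_leI abs_triangle_ineq flip: ennreal_plus)
  also have "ennreal \<bar>\<integral>y. v y * P y \<partial>lborel\<bar> \<le> jump s \<delta> (\<lambda>x'. ennreal \<bar>W x'\<bar>) x"
  proof -
    let ?F = "\<lambda>y x'. v y * (pr (x' - x) * ?g (y - x'))"
    have pi: "integrable (lborel \<Otimes>\<^sub>M lborel) (\<lambda>(y, x'). ?F y x')"
    proof (rule lborel_pair.Fubini_integrable)
      show "AE y in lborel. integrable lborel (\<lambda>x'. case (y, x') of (y, x') \<Rightarrow> ?F y x')"
        using Pi by (intro AE_I2) auto
      have "(\<integral>x'. norm (?F y x') \<partial>lborel) = \<bar>v y * P y\<bar>" for y
      proof -
        have "(\<integral>x'. norm (?F y x') \<partial>lborel) = (\<integral>x'. \<bar>v y\<bar> * (pr (x' - x) * ?g (y - x')) \<partial>lborel)"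
          using pr0 g0 by (intro Bochner_Integration.integral_cong) (auto simp: abs_mult)
        then show ?thesis using P0[of y] by (simp add: Peq[symmetric] abs_mult)
      qed
      then show "integrable lborel (\<lambda>y. \<integral>x'. norm (case (y, x') of (y, x') \<Rightarrow> ?F y x') \<partial>lborel)"
        using integrable_norm[OF i3] by simp
    qed measurable
    have e: "(\<integral>y. ?F y x' \<partial>lborel) = pr (x' - x) * W x'" for x'
    proof -
      have "(\<integral>y. ?F y x' \<partial>lborel) = (\<integral>y. pr (x' - x) * (v y * ?g (y - x')) \<partial>lborel)" by (simp add: ac_simps)
      then show ?thesis unfolding W_def by simp
    qed
    have "(\<integral>y. v y * P y \<partial>lborel) = (\<integral>y. (\<integral>x'. ?F y x' \<partial>lborel) \<partial>lborel)" by (simp add: Peq)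
    also have "\<dots> = (\<integral>x'. (\<integral>y. ?F y x' \<partial>lborel) \<partial>lborel)"
      using lborel_pair.Fubini_integral[OF pi] by simp
    finally have "(\<integral>y. v y * P y \<partial>lborel) = (\<integral>x'. pr (x' - x) * W x' \<partial>lborel)" unfolding e .
    moreover have "integrable lborel (\<lambda>x'. pr (x' - x) * W x')"
      using lborel_pair.integrable_snd[OF pi] by (simp add: e)
    ultimately have "ennreal \<bar>\<integral>y. v y * P y \<partial>lborel\<bar> \<le> (\<integral>\<^sup>+x'. ennreal (norm (pr (x' - x) * W x')) \<partial>lborel)"
      using integral_norm_bound_ennreal[of lborel "\<lambda>x'. pr (x' - x) * W x'"] by simp
    also have "\<dots> = (\<integral>\<^sup>+x'. jump_ker s \<delta> (x - x') * ennreal \<bar>W x'\<bar> \<partial>lborel)"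
      using pr0 by (simp add: abs_mult ennreal_mult pr jump_ker_minus_commute[of s \<delta> x])
    also have "\<dots> = jump s \<delta> (\<lambda>x'. ennreal \<bar>W x'\<bar>) x" by (rule jump_jump_ker[symmetric]) measurable
    finally show ?thesis .
  qed
  also have "ennreal \<bar>\<integral>y. v y * R y \<partial>lborel\<bar> \<le> ennreal (C * (\<delta> powr (1 - s) / (1 - s))) * (\<integral>\<^sup>+y. ennreal \<bar>v y\<bar> * wgt s (y - x) \<partial>lborel)"
  proof -
    have "ennreal \<bar>\<integral>y. v y * R y \<partial>lborel\<bar> \<le> (\<integral>\<^sup>+y. ennreal (norm (v y * R y)) \<partial>lborel)"
      using integral_norm_bound_ennreal[OF i4] by simp
    also have "\<dots> \<le> (\<integral>\<^sup>+y. ennreal (C * (\<delta> powr (1 - s) / (1 - s))) * (ennreal \<bar>v y\<bar> * wgt s (y - x)) \<partial>lborel)"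
    proof (rule nn_integral_mono)
      fix y
      have "ennreal (norm (v y * R y)) = ennreal \<bar>v y\<bar> * ennreal \<bar>R y\<bar>" by (simp add: abs_mult ennreal_mult)
      also have "\<dots> \<le> ennreal \<bar>v y\<bar> * (ennreal (C * (\<delta> powr (1 - s) / (1 - s))) * wgt s (y - x))"
        unfolding R_def P_def by (intro mult_left_mono frac_lap_split[OF f s \<delta> C]) auto
      finally show "ennreal (norm (v y * R y)) \<le> ennreal (C * (\<delta> powr (1 - s) / (1 - s))) * (ennreal \<bar>v y\<bar> * wgt s (y - x))"
        by (simp add: ac_simps)
    qed
    also have "\<dots> = ennreal (C * (\<delta> powr (1 - s) / (1 - s))) * (\<integral>\<^sup>+y. ennreal \<bar>v y\<bar> * wgt s (y - x) \<partial>lborel)"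
      by (rule nn_integral_cmult) measurable
    finally show ?thesis .
  qed
  finally show ?thesis unfolding split W_def by (simp add: add_mono)
qed

section \<open>The weighted estimate for solutions with zero trace\<close>

lemma nn_integral_exp_tail:
  assumes "K \<ge> 0" "\<beta> > (0::real)"
  shows "(\<integral>\<^sup>+t. ennreal (exp (- (\<beta> * t)) * exp (- (K * (t - r)))) * indicator {r..} t \<partial>lborel) = ennreal (exp (- (\<beta> * r)) / (K + \<beta>))"
proof -
  define k where "k = K + \<beta>"
  define F where "F = (\<lambda>t. - (exp (K * r) / k) * exp (- (k * t)))"
  have p: "k > 0" using assms by (simp add: k_def)
  have e: "exp (- (\<beta> * t)) * exp (- (K * (t - r))) = exp (K * r) * exp (- (k * t))" for t
    by (simp add: k_def algebra_simps flip: exp_add)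
  have "(\<integral>\<^sup>+t. ennreal (exp (- (\<beta> * t)) * exp (- (K * (t - r)))) * indicator {r..} t \<partial>lborel) = ennreal (0 - F r)"
  proof (rule nn_integral_FTC_atLeast)
    show "DERIV F t :> exp (- (\<beta> * t)) * exp (- (K * (t - r)))" for t
      unfolding F_def e using p by (auto intro!: derivative_eq_intros)
    have "((\<lambda>t. exp (- (k * t))) \<longlongrightarrow> 0) at_top"
      using p by (intro filterlim_compose[OF exp_at_bot] filterlim_uminus_at_bot_at_top[THEN filterlim_compose]
          filterlim_tendsto_pos_mult_at_top[OF tendsto_const] filterlim_ident)
    then have "(F \<longlongrightarrow> - (exp (K * r) / k) * 0) at_top" unfolding F_def by (intro tendsto_intros)
    then show "(F \<longlongrightarrow> 0) at_top" by simp
  qed auto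
  also have "0 - F r = exp (- (\<beta> * r)) / (K + \<beta>)"
    unfolding F_def using e[of r] by (simp add: k_def)
  finally show ?thesis .
qed

text \<open>Exchange the order of integration: the time integral of e^(-\<beta> t) e^(-K (t - r))
  over t \<ge> r is e^(-\<beta> r) / (K + \<beta>). This gain is what compensates the factor of
  order K produced by P \<zeta>.\<close>

lemma time_estimate:
  fixes A Q :: "real \<Rightarrow> ennreal"
  assumes [measurable]: "A \<in> borel_measurable borel" "Q \<in> borel_measurable borel"
    and K: "K \<ge> 0" "\<beta> > 0"
    and AQ: "AE t in lborel. t \<in> {0<..<T} \<longrightarrow> A t \<le> (\<integral>\<^sup>+r. indicator {0<..<t} r * ennreal (exp (- (K * (t - r)))) * Q r \<partial>lborel)"
  shows "(\<integral>\<^sup>+t. indicator {0<..<T} t * ennreal (exp (- (\<beta> * t))) * A t \<partial>lborel)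
    \<le> ennreal (1 / (K + \<beta>)) * (\<integral>\<^sup>+r. indicator {0<..<T} r * ennreal (exp (- (\<beta> * r))) * Q r \<partial>lborel)"
proof -
  let ?k = "\<lambda>t r. (if 0 < r \<and> r < t \<and> t < T then ennreal (exp (- (\<beta> * t)) * exp (- (K * (t - r)))) else 0)"
  have "(\<integral>\<^sup>+t. indicator {0<..<T} t * ennreal (exp (- (\<beta> * t))) * A t \<partial>lborel) \<le> (\<integral>\<^sup>+t. (\<integral>\<^sup>+r. ?k t r * Q r \<partial>lborel) \<partial>lborel)"
  proof (rule nn_integral_mono_AE)
    show "AE t in lborel. indicator {0<..<T} t * ennreal (exp (- (\<beta> * t))) * A t \<le> (\<integral>\<^sup>+r. ?k t r * Q r \<partial>lborel)"
      using AQ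
    proof eventually_elim
      case (elim t)
      show ?case
      proof (cases "t \<in> {0<..<T}")
        case True
        then have "indicator {0<..<T} t * ennreal (exp (- (\<beta> * t))) * A t \<le> ennreal (exp (- (\<beta> * t))) * (\<integral>\<^sup>+r. indicator {0<..<t} r * ennreal (exp (- (K * (t - r)))) * Q r \<partial>lborel)"
          using elim by (auto intro!: mult_left_mono)
        also have "\<dots> = (\<integral>\<^sup>+r. ennreal (exp (- (\<beta> * t))) * (indicator {0<..<t} r * ennreal (exp (- (K * (t - r)))) * Q r) \<partial>lborel)"
          by (rule nn_integral_cmult[symmetric]) measurable
        also have "\<dots> = (\<integral>\<^sup>+r. ?k t r * Q r \<partial>lborel)"
          using True by (intro nn_integral_cong) (auto simp: indicator_def ennreal_mult mult.assoc)
        finally show ?thesis .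
      qed simp
    qed
  qed
  also have "\<dots> = (\<integral>\<^sup>+r. (\<integral>\<^sup>+t. ?k t r * Q r \<partial>lborel) \<partial>lborel)"
    by (rule lborel_pair.Fubini') measurable
  also have "\<dots> \<le> (\<integral>\<^sup>+r. ennreal (1 / (K + \<beta>)) * (indicator {0<..<T} r * ennreal (exp (- (\<beta> * r))) * Q r) \<partial>lborel)"
  proof (rule nn_integral_mono)
    fix r :: real
    show "(\<integral>\<^sup>+t. ?k t r * Q r \<partial>lborel) \<le> ennreal (1 / (K + \<beta>)) * (indicator {0<..<T} r * ennreal (exp (- (\<beta> * r))) * Q r)"
    proof (cases "r \<in> {0<..<T}")
      case True
      have "(\<integral>\<^sup>+t. ?k t r * Q r \<partial>lborel) \<le> (\<integral>\<^sup>+t. (ennreal (exp (- (\<beta> * t)) * exp (- (K * (t - r)))) * indicator {r..} t) * Q r \<partial>lborel)"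
        by (intro nn_integral_mono) (auto simp: indicator_def)
      also have "\<dots> = ennreal (exp (- (\<beta> * r)) / (K + \<beta>)) * Q r"
        by (subst nn_integral_multc) (use nn_integral_exp_tail[OF K] in auto)
      also have "\<dots> = ennreal (1 / (K + \<beta>)) * ennreal (exp (- (\<beta> * r))) * Q r"
        using K by (simp flip: ennreal_mult)
      finally show ?thesis using True by (simp add: mult.assoc)
    next
      case False
      then have "(\<integral>\<^sup>+t. ?k t r * Q r \<partial>lborel) = (\<integral>\<^sup>+t. 0 \<partial>(lborel :: real measure))"
        by (intro nn_integral_cong) auto
      then show ?thesis by simp
    qed
  qed
  also have "\<dots> = ennreal (1 / (K + \<beta>)) * (\<integral>\<^sup>+r. indicator {0<..<T} r * ennreal (exp (- (\<beta> * r))) * Q r \<partial>lborel)"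
    by (rule nn_integral_cmult) measurable
  finally show ?thesis .
qed

text \<open>Multiplying by a + 1 gives a J + J \<le> a J + b; finiteness of J permits the
  subtraction.\<close>

lemma ennreal_absorb:
  assumes "J \<le> ennreal (1 / (a + 1)) * (ennreal a * J + b)" "J < \<top>" "b < \<top>" "a \<ge> 0"
  shows "J \<le> b"
proof -
  obtain j where j: "J = ennreal j" "j \<ge> 0" using assms(2) by (cases J) auto
  obtain c where c: "b = ennreal c" "c \<ge> 0" using assms(3) by (cases b) auto
  have "ennreal a * ennreal j + ennreal c = ennreal (a * j + c)"
    using j(2) c(2) assms(4) by (simp add: ennreal_mult)
  moreover have "ennreal (1 / (a + 1)) * ennreal (a * j + c) = ennreal (1 / (a + 1) * (a * j + c))"
    using j(2) c(2) assms(4) by (intro ennreal_mult[symmetric]) auto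
  ultimately have "ennreal j \<le> ennreal (1 / (a + 1) * (a * j + c))"
    using assms(1) unfolding j(1) c(1) by simp
  then have "j \<le> 1 / (a + 1) * (a * j + c)" using j c assms(4) by (simp add: ennreal_le_iff)
  then have "j * (a + 1) \<le> a * j + c" using assms(4) by (simp add: pos_le_divide_eq)
  then show ?thesis using j c by (simp add: algebra_simps ennreal_leI)
qed

lemma ennreal_zero_of_small:
  assumes s: "s < (1::real)" and c: "c \<ge> 0" and M: "M < \<top>"
    and le: "\<And>n. J \<le> ennreal (c * (1 / real (Suc n)) powr (1 - s)) * M"
  shows "J = 0"
proof -
  obtain m where m: "M = ennreal m" "m \<ge> 0" using M by (cases M) auto
  have "J < \<top>"
    by (rule le_less_trans[OF le[of 0]]) (use M in \<open>simp add: ennreal_mult_less_top\<close>)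
  then obtain j where j: "J = ennreal j" "j \<ge> 0" by (cases J) auto
  have le': "j \<le> c * (1 / real (Suc n)) powr (1 - s) * m" for n
    using le[of n] c m(2) unfolding j(1) m(1) by (simp add: ennreal_le_iff flip: ennreal_mult del: of_nat_Suc)
  have "(\<lambda>n. real (Suc n) powr (- (1 - s))) \<longlonglongrightarrow> 0"
    using s by (intro tendsto_neg_powr filterlim_compose[OF filterlim_real_sequentially filterlim_Suc]) simp
  then have "(\<lambda>n. (1 / real (Suc n)) powr (1 - s)) \<longlonglongrightarrow> 0"
    unfolding powr_minus_divide by (simp add: powr_divide del: of_nat_Suc)
  then have "(\<lambda>n. c * (1 / real (Suc n)) powr (1 - s) * m) \<longlonglongrightarrow> c * 0 * m" by (intro tendsto_intros)
  then have "j \<le> c * 0 * m" by (rule LIMSEQ_le_const) (use le' in auto)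
  then show ?thesis using j by simp
qed

lemma wgt_pos:
  assumes "0 < s" "s < 1" shows "wgt s x \<noteq> 0"
proof
  assume z: "wgt s x = 0"
  obtain C where "ennreal (heat_ker 1 x) \<le> ennreal C * wgt s x" using heat_ker_le_wgt[of 1 s, where 'a = 'a] assms by auto
  then have "heat_ker 1 x \<le> 0" using z by (simp add: ennreal_eq_0_iff)
  moreover have "heat_ker 1 x > 0" by (simp add: heat_ker_eq)
  ultimately show False by simp
qed

text \<open>What the estimate uses about the difference of two solutions. In the application
  \<open>w\<close> is set to zero outside (0, T), so \<open>fin\<close> integrates over all times.
  In \<open>weak\<close> the time factor may have any sign, and the space-time integrals are already
  iterated.\<close>

locale zero_trace_solution =
  fixes w :: "real \<Rightarrow> 'a::euclidean_space \<Rightarrow> real" and s T :: real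
  assumes s: "0 < s" "s < 1" and T: "0 < T"
    and wm: "(\<lambda>z. w (fst z) (snd z)) \<in> borel_measurable (borel \<Otimes>\<^sub>M borel)"
    and fin: "(\<integral>\<^sup>+t. (\<integral>\<^sup>+y. ennreal \<bar>w t y\<bar> * wgt s y \<partial>lborel) \<partial>lborel) < \<top>"
    and weak: "\<And>f \<theta>. bumplike f \<Longrightarrow> test1 T \<theta> \<Longrightarrow>
      (\<integral>t. (\<integral>y. w t y * tensor f y \<partial>lborel) * deriv \<theta> t \<partial>lborel) =
      (\<integral>t. (\<integral>y. w t y * frac_lap s (tensor f) y \<partial>lborel) * \<theta> t \<partial>lborel)"
    and trace: "\<And>f. bumplike f \<Longrightarrow> \<exists>E. E \<in> null_sets lborel \<and>
      ((\<lambda>t. \<integral>y. w t y * tensor f y \<partial>lborel) \<longlongrightarrow> 0) (at 0 within ({0<..} - E))"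
begin

lemma w_measurable[measurable (raw)]:
  assumes [measurable]: "f \<in> borel_measurable M" "g \<in> borel_measurable M"
  shows "(\<lambda>z. w (f z) (g z)) \<in> borel_measurable M"
  using measurable_compose[OF _ wm, of "\<lambda>z. (f z, g z)" M] by simp

lemma AE_slice: "AE t in lborel. (\<integral>\<^sup>+y. ennreal \<bar>w t y\<bar> * wgt s y \<partial>lborel) < \<top>"
proof -
  have "AE t in lborel. (\<integral>\<^sup>+y. ennreal \<bar>w t y\<bar> * wgt s y \<partial>lborel) \<noteq> \<infinity>"
    by (rule nn_integral_PInf_AE) (measurable, use fin in auto)
  then show ?thesis by eventually_elim (simp add: top.not_eq_extremum)
qed

lemma integrable_slice:
  assumes [measurable]: "h \<in> borel_measurable borel" and h: "\<And>y. ennreal \<bar>h y\<bar> \<le> ennreal C * wgt s y"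
  shows "integrable (lborel \<Otimes>\<^sub>M lborel) (\<lambda>(t, y). w t y * h y)"
    "integrable lborel (\<lambda>t. \<integral>y. w t y * h y \<partial>lborel)"
proof -
  show i: "integrable (lborel \<Otimes>\<^sub>M lborel) (\<lambda>(t, y). w t y * h y)"
  proof (rule integrableI_bounded)
    have "(\<integral>\<^sup>+z. ennreal (norm (case z of (t, y) \<Rightarrow> w t y * h y)) \<partial>(lborel \<Otimes>\<^sub>M lborel)) = (\<integral>\<^sup>+t. (\<integral>\<^sup>+y. ennreal \<bar>w t y * h y\<bar> \<partial>lborel) \<partial>lborel)"
      by (subst lborel.nn_integral_fst[symmetric]) auto
    also have "\<dots> \<le> (\<integral>\<^sup>+t. (\<integral>\<^sup>+y. ennreal C * (ennreal \<bar>w t y\<bar> * wgt s y) \<partial>lborel) \<partial>lborel)"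
    proof (intro nn_integral_mono)
      fix t y
      have "ennreal \<bar>w t y * h y\<bar> = ennreal \<bar>w t y\<bar> * ennreal \<bar>h y\<bar>" by (simp add: abs_mult ennreal_mult)
      also have "\<dots> \<le> ennreal \<bar>w t y\<bar> * (ennreal C * wgt s y)" by (intro mult_left_mono h) auto
      finally show "ennreal \<bar>w t y * h y\<bar> \<le> ennreal C * (ennreal \<bar>w t y\<bar> * wgt s y)" by (simp add: ac_simps)
    qed
    also have "\<dots> = ennreal C * (\<integral>\<^sup>+t. (\<integral>\<^sup>+y. ennreal \<bar>w t y\<bar> * wgt s y \<partial>lborel) \<partial>lborel)"
      by (simp add: nn_integral_cmult)
    also have "\<dots> < \<infinity>" using fin by (simp add: ennreal_mult_less_top)
    finally show "(\<integral>\<^sup>+z. ennreal (norm (case z of (t, y) \<Rightarrow> w t y * h y)) \<partial>(lborel \<Otimes>\<^sub>M lborel)) < \<infinity>" .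
  qed measurable
  show "integrable lborel (\<lambda>t. \<integral>y. w t y * h y \<partial>lborel)"
    using lborel_pair.integrable_fst[OF i] by simp
qed

text \<open>This is W(t, x) for the bump g = \<open>tensor f\<close>.\<close>

definition corr :: "('a \<Rightarrow> real \<Rightarrow> real) \<Rightarrow> real \<Rightarrow> 'a \<Rightarrow> real" where
  "corr f t x = (\<integral>y. w t y * tensor f (y - x) \<partial>lborel)"

text \<open>The majorant of the source in Duhamel's formula for W: P |W| plus the truncation error.
  Division by \<open>subc s\<close> restores the normalisation of (-\<Delta>)^s.\<close>

definition src :: "('a \<Rightarrow> real \<Rightarrow> real) \<Rightarrow> real \<Rightarrow> real \<Rightarrow> real \<Rightarrow> 'a \<Rightarrow> ennreal" where
  "src f \<delta> C r x = ennreal (1 / subc s) * (jump s \<delta> (\<lambda>x'. ennreal \<bar>corr f r x'\<bar>) x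
     + ennreal (C * (\<delta> powr (1 - s) / (1 - s))) * (\<integral>\<^sup>+y. ennreal \<bar>w r y\<bar> * wgt s (y - x) \<partial>lborel))"

lemma corr_measurable:
  assumes f: "bumplike f" and [measurable]: "g \<in> borel_measurable M" "h \<in> borel_measurable M"
  shows "(\<lambda>z. corr f (g z) (h z)) \<in> borel_measurable M"
proof -
  note [measurable] = bumplike_measurable[OF f]
  show ?thesis unfolding corr_def by measurable
qed

lemma src_measurable:
  assumes f: "bumplike f" and [measurable]: "g \<in> borel_measurable M" "h \<in> borel_measurable M"
  shows "(\<lambda>z. src f \<delta> C (g z) (h z)) \<in> borel_measurable M"
proof -
  note [measurable (raw)] = corr_measurable[OF f]
  show ?thesis unfolding src_def by measurable
qed

text \<open>Duhamel's formula at fixed x. Write H for the pairing of \<open>w\<close> with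
  (-\<Delta>)^s of the translated bump. With q = K W - H the equation W' = - H reads W' = - K W + q,
  whatever K is; for the K of the truncation \<open>source_bound\<close> controls q at almost every
  time.\<close>

lemma corr_bound:
  assumes f: "bumplike f" and \<delta>: "0 < \<delta>" "\<delta> \<le> 1"
    and C: "C \<ge> 0" "\<And>l x. 0 < l \<Longrightarrow> l \<le> 1 \<Longrightarrow> ennreal \<bar>tensor f x - heatr l (tensor f) x\<bar> \<le> ennreal (C * l) * wgt s x"
  shows "AE t in lborel. t \<in> {0<..<T} \<longrightarrow> ennreal \<bar>corr f t x\<bar> \<le>
    (\<integral>\<^sup>+r. indicator {0<..<t} r * ennreal (exp (- (\<delta> powr (- s) / s / subc s * (t - r)))) * src f \<delta> C r x \<partial>lborel)"
proof -
  note [measurable] = bumplike_measurable[OF f] frac_lap_measurable[OF bumplike_measurable[OF f]]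
  note [measurable (raw)] = corr_measurable[OF f] src_measurable[OF f]
  define K where "K = \<delta> powr (- s) / s / subc s"
  have c: "subc s > 0" by (rule subc_integrable(2)[OF s])
  let ?fx = "shift x f"
  have fx: "bumplike ?fx" by (rule bumplike_shift[OF f])
  define H where "H = (\<lambda>t. \<integral>y. w t y * frac_lap s (tensor f) (y - x) \<partial>lborel)"
  define q where "q = (\<lambda>t. K * corr f t x - H t)"
  obtain C1 where C1: "\<And>y. ennreal (tensor f (y - x)) \<le> ennreal C1 * wgt s y"
    using bumplike_wgt[OF fx s] by (auto simp: tensor_shift)
  obtain C2 where C2: "\<And>y. ennreal \<bar>frac_lap s (tensor f) (y - x)\<bar> \<le> ennreal C2 * wgt s y"
    using frac_lap_wgt_bound[OF fx s] by (auto simp: frac_lap_shift[OF f s])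
  have Wi: "integrable lborel (\<lambda>t. corr f t x)"
    unfolding corr_def using C1 bumplike_nonneg[OF f] by (intro integrable_slice(2)[of _ C1]) auto
  have Hi: "integrable lborel H"
    unfolding H_def using C2 by (intro integrable_slice(2)[of _ C2]) auto
  have qi: "integrable lborel q" unfolding q_def using Wi Hi by auto
  obtain E where E: "E \<in> null_sets lborel" "((\<lambda>t. corr f t x) \<longlongrightarrow> 0) (at 0 within ({0<..} - E))"
    using trace[OF fx] by (auto simp: corr_def tensor_shift)
  have "AE t in lborel. t \<in> {0<..<T} \<longrightarrow> ennreal \<bar>corr f t x\<bar> \<le> (\<integral>\<^sup>+r. indicator {0<..<t} r * ennreal (exp (- (K * (t - r))) * \<bar>q r\<bar>) \<partial>lborel)"
  proof (rule duhamel_bound[OF Wi qi T E(1) _ E(2)])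
    fix \<theta> assume th: "test1 T \<theta>"
    have "(\<integral>t. corr f t x * deriv \<theta> t \<partial>lborel) = (\<integral>t. H t * \<theta> t \<partial>lborel)"
      using weak[OF fx th] by (simp add: corr_def H_def tensor_shift frac_lap_shift[OF f s])
    then show "(\<integral>t. corr f t x * deriv \<theta> t \<partial>lborel) = (\<integral>t. (K * corr f t x - q t) * \<theta> t \<partial>lborel)"
      by (simp add: q_def)
  qed
  moreover have qQ: "AE r in lborel. ennreal \<bar>q r\<bar> \<le> src f \<delta> C r x"
    using AE_slice
  proof eventually_elim
    case (elim r)
    have "ennreal \<bar>q r\<bar> = ennreal (1 / subc s) * ennreal \<bar>\<delta> powr (- s) / s * corr f r x - subc s * H r\<bar>"
    proof -
      have "q r = 1 / subc s * (\<delta> powr (- s) / s * corr f r x - subc s * H r)"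
        unfolding q_def K_def using c by (simp add: field_simps)
      then have "\<bar>q r\<bar> = 1 / subc s * \<bar>\<delta> powr (- s) / s * corr f r x - subc s * H r\<bar>"
        using c by (simp only: abs_mult) simp
      moreover have "ennreal (1 / subc s * \<bar>\<delta> powr (- s) / s * corr f r x - subc s * H r\<bar>)
          = ennreal (1 / subc s) * ennreal \<bar>\<delta> powr (- s) / s * corr f r x - subc s * H r\<bar>"
        using c by (intro ennreal_mult) auto
      ultimately show ?thesis by (simp only:)
    qed
    also have "\<dots> \<le> src f \<delta> C r x"
      unfolding src_def H_def corr_def
      by (intro mult_left_mono source_bound[OF _ elim f s \<delta> C]) auto
    finally show ?case .
  qed
  ultimately show ?thesis
  proof eventually_elim
    case (elim t)
    show ?case
    proof
      assume "t \<in> {0<..<T}"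
      with elim have "ennreal \<bar>corr f t x\<bar> \<le> (\<integral>\<^sup>+r. indicator {0<..<t} r * ennreal (exp (- (K * (t - r))) * \<bar>q r\<bar>) \<partial>lborel)" by blast
      also have "\<dots> \<le> (\<integral>\<^sup>+r. indicator {0<..<t} r * ennreal (exp (- (K * (t - r)))) * src f \<delta> C r x \<partial>lborel)"
      proof (rule nn_integral_mono_AE)
        show "AE r in lborel. indicator {0<..<t} r * ennreal (exp (- (K * (t - r))) * \<bar>q r\<bar>) \<le> indicator {0<..<t} r * ennreal (exp (- (K * (t - r)))) * src f \<delta> C r x"
          using qQ by eventually_elim (simp add: ennreal_mult mult.assoc mult_left_mono)
      qed
      finally show "ennreal \<bar>corr f t x\<bar> \<le> (\<integral>\<^sup>+r. indicator {0<..<t} r * ennreal (exp (- (\<delta> powr (- s) / s / subc s * (t - r)))) * src f \<delta> C r x \<partial>lborel)"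
        by (simp only: K_def)
    qed
  qed
qed

lemma wgt_conv_slice:
  "(\<integral>\<^sup>+x. wgt s x * (\<integral>\<^sup>+y. ennreal \<bar>w r y\<bar> * wgt s (y - x) \<partial>lborel) \<partial>lborel)
    \<le> ennreal (8 / s) * (\<integral>\<^sup>+y. ennreal \<bar>w r y\<bar> * wgt s y \<partial>lborel)"
proof -
  have "(\<integral>\<^sup>+x. wgt s x * (\<integral>\<^sup>+y. ennreal \<bar>w r y\<bar> * wgt s (y - x) \<partial>lborel) \<partial>lborel)
      = (\<integral>\<^sup>+x. (\<integral>\<^sup>+y. ennreal \<bar>w r y\<bar> * (wgt s (y - x) * wgt s x) \<partial>lborel) \<partial>lborel)"
    by (intro nn_integral_cong) (subst nn_integral_cmult[symmetric], auto simp: ac_simps)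
  also have "\<dots> = (\<integral>\<^sup>+y. (\<integral>\<^sup>+x. ennreal \<bar>w r y\<bar> * (wgt s (y - x) * wgt s x) \<partial>lborel) \<partial>lborel)"
    by (rule lborel_pair.Fubini') measurable
  also have "\<dots> = (\<integral>\<^sup>+y. ennreal \<bar>w r y\<bar> * (\<integral>\<^sup>+x. wgt s (y - x) * wgt s x \<partial>lborel) \<partial>lborel)"
    by (intro nn_integral_cong nn_integral_cmult) measurable
  also have "\<dots> \<le> (\<integral>\<^sup>+y. ennreal \<bar>w r y\<bar> * (ennreal (8 / s) * wgt s y) \<partial>lborel)"
    by (intro nn_integral_mono mult_left_mono wgt_conv_le s) auto
  also have "\<dots> = (\<integral>\<^sup>+y. ennreal (8 / s) * (ennreal \<bar>w r y\<bar> * wgt s y) \<partial>lborel)" by (simp add: ac_simps)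
  also have "\<dots> = ennreal (8 / s) * (\<integral>\<^sup>+y. ennreal \<bar>w r y\<bar> * wgt s y \<partial>lborel)"
    by (rule nn_integral_cmult) measurable
  finally show ?thesis .
qed

text \<open>Integrating \<open>corr_bound\<close> against \<zeta> and e^(-\<beta> t), and moving P
  onto \<zeta> by symmetry, compares (a + 1) J with a J plus a remainder. Although a is of order
  \<delta>^(-s), it cancels, and the remainder tends to 0 with \<delta>.\<close>

lemma corr_zero_AE:
  assumes f: "bumplike f"
  shows "AE t in lborel. t \<in> {0<..<T} \<longrightarrow> (\<integral>y. w t y * tensor f y \<partial>lborel) = 0"
proof -
  note [measurable] = bumplike_measurable[OF f]
  note [measurable (raw)] = corr_measurable[OF f] src_measurable[OF f]
  have c: "subc s > 0" by (rule subc_integrable(2)[OF s])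
  obtain C where C: "C \<ge> 0" "\<And>x. ennreal (tensor f x) \<le> ennreal C * wgt s x"
      "\<And>l x. 0 < l \<Longrightarrow> l \<le> 1 \<Longrightarrow> ennreal \<bar>tensor f x - heatr l (tensor f) x\<bar> \<le> ennreal (C * l) * wgt s x"
    using bumplike_wgt[OF f s] by blast
  define B where "B = 3 / (1 - s) + 8 / s"
  have B: "B \<ge> 0" using s by (simp add: B_def)
  \<comment> \<open>Chosen so that K + \<beta> exceeds by exactly 1 the coefficient \<open>a\<close>
    with which P \<zeta> returns J; see \<open>Kb\<close>.\<close>
  define \<beta> where "\<beta> = B / subc s + 1"
  have \<beta>: "\<beta> > 0" using B c by (simp add: \<beta>_def add_nonneg_pos)
  define M where "M = (\<integral>\<^sup>+t. (\<integral>\<^sup>+y. ennreal \<bar>w t y\<bar> * wgt s y \<partial>lborel) \<partial>lborel)"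
  have M: "M < \<top>" using fin by (simp add: M_def)
  define e where "e = (\<lambda>t::real. indicator {0<..<T} t * ennreal (exp (- (\<beta> * t))))"
  have [measurable]: "e \<in> borel_measurable borel" unfolding e_def by measurable
  have e1: "e t \<le> 1" for t
    using \<beta> by (cases "t \<in> {0<..<T}") (auto simp: e_def ennreal_le_1)
  define m where "m = (\<lambda>t. \<integral>\<^sup>+x. ennreal \<bar>corr f t x\<bar> * wgt s x \<partial>lborel)"
  have [measurable]: "m \<in> borel_measurable borel" unfolding m_def by measurable
  define J where "J = (\<integral>\<^sup>+t. e t * m t \<partial>lborel)"
  \<comment> \<open>Bounding the bump by the weight turns \<open>m\<close> into an integral against
    the weight convolved with itself, which \<open>wgt_conv_slice\<close> reduces to the weighted
    mass of \<open>w\<close>; this is the source of the finiteness of J.\<close>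
  have m_le: "m t \<le> ennreal (C * (8 / s)) * (\<integral>\<^sup>+y. ennreal \<bar>w t y\<bar> * wgt s y \<partial>lborel)" for t
  proof -
    have "ennreal \<bar>corr f t x\<bar> \<le> ennreal C * (\<integral>\<^sup>+y. ennreal \<bar>w t y\<bar> * wgt s (y - x) \<partial>lborel)" for x
    proof -
      have "ennreal \<bar>corr f t x\<bar> \<le> (\<integral>\<^sup>+y. ennreal \<bar>w t y * tensor f (y - x)\<bar> \<partial>lborel)"
      \<comment> \<open>Without integrability \<open>corr\<close> takes the default value 0 of the
        Bochner integral and the bound is trivial.\<close>
      proof (cases "integrable lborel (\<lambda>y. w t y * tensor f (y - x))")
        case True
        from integral_norm_bound_ennreal[OF this] show ?thesis by (simp add: corr_def)
      qed (simp add: corr_def not_integrable_integral_eq)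
      also have "\<dots> \<le> (\<integral>\<^sup>+y. ennreal C * (ennreal \<bar>w t y\<bar> * wgt s (y - x)) \<partial>lborel)"
      proof (rule nn_integral_mono)
        fix y
        have "ennreal \<bar>w t y * tensor f (y - x)\<bar> = ennreal \<bar>w t y\<bar> * ennreal (tensor f (y - x))"
          using bumplike_nonneg[OF f] by (simp add: abs_mult ennreal_mult)
        also have "\<dots> \<le> ennreal \<bar>w t y\<bar> * (ennreal C * wgt s (y - x))" by (intro mult_left_mono C) auto
        finally show "ennreal \<bar>w t y * tensor f (y - x)\<bar> \<le> ennreal C * (ennreal \<bar>w t y\<bar> * wgt s (y - x))" by (simp add: ac_simps)
      qed
      also have "\<dots> = ennreal C * (\<integral>\<^sup>+y. ennreal \<bar>w t y\<bar> * wgt s (y - x) \<partial>lborel)" by (rule nn_integral_cmult) measurable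
      finally show ?thesis .
    qed
    then have "m t \<le> (\<integral>\<^sup>+x. ennreal C * (wgt s x * (\<integral>\<^sup>+y. ennreal \<bar>w t y\<bar> * wgt s (y - x) \<partial>lborel)) \<partial>lborel)"
      unfolding m_def by (intro nn_integral_mono) (metis mult.commute mult.left_commute mult_left_mono zero_le)
    also have "\<dots> = ennreal C * (\<integral>\<^sup>+x. wgt s x * (\<integral>\<^sup>+y. ennreal \<bar>w t y\<bar> * wgt s (y - x) \<partial>lborel) \<partial>lborel)"
      by (rule nn_integral_cmult) measurable
    also have "\<dots> \<le> ennreal C * (ennreal (8 / s) * (\<integral>\<^sup>+y. ennreal \<bar>w t y\<bar> * wgt s y \<partial>lborel))"
      by (intro mult_left_mono wgt_conv_slice) auto
    also have "\<dots> = ennreal (C * (8 / s)) * (\<integral>\<^sup>+y. ennreal \<bar>w t y\<bar> * wgt s y \<partial>lborel)"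
    proof -
      have "ennreal (C * (8 / s)) = ennreal C * ennreal (8 / s)" using C(1) s by (intro ennreal_mult) auto
      then show ?thesis by (simp only: mult.assoc)
    qed
    finally show ?thesis .
  qed
  have J_fin: "J < \<top>"
  proof -
    have "J \<le> (\<integral>\<^sup>+t. ennreal (C * (8 / s)) * (\<integral>\<^sup>+y. ennreal \<bar>w t y\<bar> * wgt s y \<partial>lborel) \<partial>lborel)"
      unfolding J_def
    proof (rule nn_integral_mono)
      fix t
      have "e t * m t \<le> 1 * m t" by (intro mult_right_mono e1) auto
      with m_le[of t] show "e t * m t \<le> ennreal (C * (8 / s)) * (\<integral>\<^sup>+y. ennreal \<bar>w t y\<bar> * wgt s y \<partial>lborel)" by simp
    qed
    also have "\<dots> = ennreal (C * (8 / s)) * M" unfolding M_def by (rule nn_integral_cmult) measurable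
    also have "\<dots> < \<top>" using M by (simp add: ennreal_mult_less_top)
    finally show ?thesis .
  qed
  have J_le: "J \<le> ennreal (C * (\<delta> powr (1 - s) / (1 - s)) * (8 / s) / subc s) * M" if \<delta>: "0 < \<delta>" "\<delta> \<le> 1" for \<delta>
  proof -
    define K0 where "K0 = \<delta> powr (- s) / s"
    have K0: "K0 \<ge> 0" using s by (simp add: K0_def)
    define a where "a = (K0 + B) / subc s"
    have a: "a \<ge> 0" using K0 B c by (simp add: a_def)
    define cd where "cd = C * (\<delta> powr (1 - s) / (1 - s))"
    have cd: "cd \<ge> 0" using C(1) s by (simp add: cd_def)
    have Kb: "K0 / subc s + \<beta> = a + 1" by (simp add: a_def \<beta>_def add_divide_distrib)
    have "J = (\<integral>\<^sup>+t. (\<integral>\<^sup>+x. wgt s x * (e t * ennreal \<bar>corr f t x\<bar>) \<partial>lborel) \<partial>lborel)"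
      unfolding J_def m_def by (intro nn_integral_cong) (subst nn_integral_cmult[symmetric], auto simp: ac_simps)
    also have "\<dots> = (\<integral>\<^sup>+x. (\<integral>\<^sup>+t. wgt s x * (e t * ennreal \<bar>corr f t x\<bar>) \<partial>lborel) \<partial>lborel)"
      by (rule lborel_pair.Fubini') measurable
    also have "\<dots> = (\<integral>\<^sup>+x. wgt s x * (\<integral>\<^sup>+t. e t * ennreal \<bar>corr f t x\<bar> \<partial>lborel) \<partial>lborel)"
      by (intro nn_integral_cong nn_integral_cmult) measurable
    also have "\<dots> \<le> (\<integral>\<^sup>+x. wgt s x * (ennreal (1 / (a + 1)) * (\<integral>\<^sup>+r. e r * src f \<delta> C r x \<partial>lborel)) \<partial>lborel)"
    proof (intro nn_integral_mono mult_left_mono)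
      fix x
      show "(\<integral>\<^sup>+t. e t * ennreal \<bar>corr f t x\<bar> \<partial>lborel) \<le> ennreal (1 / (a + 1)) * (\<integral>\<^sup>+r. e r * src f \<delta> C r x \<partial>lborel)"
        unfolding e_def Kb[symmetric] K0_def
        by (rule time_estimate[OF _ _ _ \<beta> corr_bound[OF f \<delta> C(1,3)]]) (use s c in auto)
    qed auto
    also have "\<dots> = ennreal (1 / (a + 1)) * (\<integral>\<^sup>+x. wgt s x * (\<integral>\<^sup>+r. e r * src f \<delta> C r x \<partial>lborel) \<partial>lborel)"
      by (subst nn_integral_cmult[symmetric]) (auto simp: ac_simps)
    also have "(\<integral>\<^sup>+x. wgt s x * (\<integral>\<^sup>+r. e r * src f \<delta> C r x \<partial>lborel) \<partial>lborel) = (\<integral>\<^sup>+x. (\<integral>\<^sup>+r. e r * (wgt s x * src f \<delta> C r x) \<partial>lborel) \<partial>lborel)"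
      by (intro nn_integral_cong) (subst nn_integral_cmult[symmetric], auto simp: ac_simps)
    also have "\<dots> = (\<integral>\<^sup>+r. (\<integral>\<^sup>+x. e r * (wgt s x * src f \<delta> C r x) \<partial>lborel) \<partial>lborel)"
      by (rule lborel_pair.Fubini') measurable
    also have "\<dots> = (\<integral>\<^sup>+r. e r * (\<integral>\<^sup>+x. wgt s x * src f \<delta> C r x \<partial>lborel) \<partial>lborel)"
      by (intro nn_integral_cong nn_integral_cmult) measurable
    also have "\<dots> \<le> (\<integral>\<^sup>+r. ennreal a * (e r * m r) + ennreal (cd * (8 / s) / subc s) * (\<integral>\<^sup>+y. ennreal \<bar>w r y\<bar> * wgt s y \<partial>lborel) \<partial>lborel)"
    proof (rule nn_integral_mono)
      fix r
      let ?I = "\<lambda>x. \<integral>\<^sup>+y. ennreal \<bar>w r y\<bar> * wgt s (y - x) \<partial>lborel" and ?m = "\<integral>\<^sup>+y. ennreal \<bar>w r y\<bar> * wgt s y \<partial>lborel"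
      have "(\<integral>\<^sup>+x. wgt s x * src f \<delta> C r x \<partial>lborel) = (\<integral>\<^sup>+x. ennreal (1 / subc s) * (wgt s x * jump s \<delta> (\<lambda>x'. ennreal \<bar>corr f r x'\<bar>) x + ennreal cd * (wgt s x * ?I x)) \<partial>lborel)"
        unfolding src_def cd_def by (intro nn_integral_cong) (simp add: distrib_left ac_simps)
      also have "\<dots> = ennreal (1 / subc s) * ((\<integral>\<^sup>+x. wgt s x * jump s \<delta> (\<lambda>x'. ennreal \<bar>corr f r x'\<bar>) x \<partial>lborel) + ennreal cd * (\<integral>\<^sup>+x. wgt s x * ?I x \<partial>lborel))"
        by (subst nn_integral_cmult, measurable) (subst nn_integral_add, auto simp: nn_integral_cmult)
      also have "\<dots> \<le> ennreal (1 / subc s) * (ennreal (K0 + B) * m r + ennreal cd * (ennreal (8 / s) * ?m))"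
      proof (intro mult_left_mono add_mono wgt_conv_slice)
        \<comment> \<open>P is moved from |W|, about which nothing pointwise is known, to the
          weight.\<close>
        have "(\<integral>\<^sup>+x. wgt s x * jump s \<delta> (\<lambda>x'. ennreal \<bar>corr f r x'\<bar>) x \<partial>lborel) = (\<integral>\<^sup>+x. ennreal \<bar>corr f r x\<bar> * jump s \<delta> (wgt s) x \<partial>lborel)"
          by (rule jump_symmetric) measurable
        also have "\<dots> \<le> (\<integral>\<^sup>+x. ennreal \<bar>corr f r x\<bar> * (ennreal (K0 + B) * wgt s x) \<partial>lborel)"
          unfolding K0_def B_def by (intro nn_integral_mono mult_left_mono jump_wgt_le s \<delta>) auto
        also have "\<dots> = (\<integral>\<^sup>+x. ennreal (K0 + B) * (ennreal \<bar>corr f r x\<bar> * wgt s x) \<partial>lborel)" by (simp add: ac_simps)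
        also have "\<dots> = ennreal (K0 + B) * m r" unfolding m_def by (rule nn_integral_cmult) measurable
        finally show "(\<integral>\<^sup>+x. wgt s x * jump s \<delta> (\<lambda>x'. ennreal \<bar>corr f r x'\<bar>) x \<partial>lborel) \<le> ennreal (K0 + B) * m r" .
      qed auto
      also have "\<dots> = ennreal a * m r + ennreal (cd * (8 / s) / subc s) * ?m"
      proof -
        have "ennreal a = ennreal (1 / subc s) * ennreal (K0 + B)"
          using K0 B c unfolding a_def by (subst ennreal_mult[symmetric]) auto
        moreover have "ennreal (cd * (8 / s) / subc s) = ennreal (1 / subc s) * (ennreal cd * ennreal (8 / s))"
          using cd s c by (simp flip: ennreal_mult)
        ultimately show ?thesis by (simp only: distrib_left mult.assoc)
      qed
      finally have "e r * (\<integral>\<^sup>+x. wgt s x * src f \<delta> C r x \<partial>lborel) \<le> e r * (ennreal a * m r + ennreal (cd * (8 / s) / subc s) * ?m)"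
        by (intro mult_left_mono) auto
      also have "\<dots> = ennreal a * (e r * m r) + e r * (ennreal (cd * (8 / s) / subc s) * ?m)" by (simp add: distrib_left ac_simps)
      also have "e r * (ennreal (cd * (8 / s) / subc s) * ?m) \<le> 1 * (ennreal (cd * (8 / s) / subc s) * ?m)"
        by (intro mult_right_mono e1) auto
      finally show "e r * (\<integral>\<^sup>+x. wgt s x * src f \<delta> C r x \<partial>lborel) \<le> ennreal a * (e r * m r) + ennreal (cd * (8 / s) / subc s) * ?m"
        by (simp add: add_left_mono)
    qed
    also have "\<dots> = ennreal a * J + ennreal (cd * (8 / s) / subc s) * M"
      unfolding J_def M_def by (subst nn_integral_add) (auto simp: nn_integral_cmult)
    finally have "J \<le> ennreal (1 / (a + 1)) * (ennreal a * J + ennreal (cd * (8 / s) / subc s) * M)"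
      by (simp add: mult_left_mono)
    then have "J \<le> ennreal (cd * (8 / s) / subc s) * M"
      by (rule ennreal_absorb) (use J_fin M a in \<open>auto simp: ennreal_mult_less_top\<close>)
    then show ?thesis by (simp only: cd_def)
  qed
  have "J = 0"
  proof (rule ennreal_zero_of_small[OF s(2) _ M])
    show "J \<le> ennreal (C / (1 - s) * (8 / s) / subc s * (1 / real (Suc n)) powr (1 - s)) * M" for n
      using J_le[of "1 / real (Suc n)"] by (simp add: ac_simps)
  qed (use C(1) s c in auto)
  then have "AE r in lborel. e r * m r = 0" unfolding J_def by (subst (asm) nn_integral_0_iff_AE) auto
  then have m0: "AE r in lborel. r \<in> {0<..<T} \<longrightarrow> m r = 0"
    by eventually_elim (auto simp: e_def)
  \<comment> \<open>\<open>W\<close> vanishes only for almost every \<open>x\<close> so far; as \<open>P\<close> smooths, the Duhamel bound improves this to \<open>x = 0\<close>.\<close>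
  have Q0: "AE r in lborel. r \<in> {0<..<T} \<longrightarrow> src f \<delta> C r 0 \<le> ennreal (C / (1 - s) / subc s * \<delta> powr (1 - s)) * (\<integral>\<^sup>+y. ennreal \<bar>w r y\<bar> * wgt s y \<partial>lborel)" if "\<delta> > 0" for \<delta>
    using m0
  proof eventually_elim
    case (elim r)
    show ?case
    proof
      assume "r \<in> {0<..<T}"
      with elim have "m r = 0" by blast
      then have "AE x in lborel. ennreal \<bar>corr f r x\<bar> * wgt s x = 0"
        unfolding m_def by (subst (asm) nn_integral_0_iff_AE) auto
      then have "AE x in lborel. jump_ker s \<delta> (0 - x) * ennreal \<bar>corr f r x\<bar> = 0"
        by eventually_elim (use wgt_pos[OF s] in auto)
      then have "(\<integral>\<^sup>+x. jump_ker s \<delta> (0 - x) * ennreal \<bar>corr f r x\<bar> \<partial>lborel) = 0"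
        by (subst nn_integral_0_iff_AE) auto
      then have "jump s \<delta> (\<lambda>x'. ennreal \<bar>corr f r x'\<bar>) 0 = 0" by (subst jump_jump_ker) auto
      then have "src f \<delta> C r 0 = ennreal (1 / subc s) * ennreal (C * (\<delta> powr (1 - s) / (1 - s))) * (\<integral>\<^sup>+y. ennreal \<bar>w r y\<bar> * wgt s y \<partial>lborel)"
        by (simp add: src_def mult.assoc)
      also have "ennreal (1 / subc s) * ennreal (C * (\<delta> powr (1 - s) / (1 - s))) = ennreal (C / (1 - s) / subc s * \<delta> powr (1 - s))"
        using c C(1) s by (simp flip: ennreal_mult)
      finally show "src f \<delta> C r 0 \<le> ennreal (C / (1 - s) / subc s * \<delta> powr (1 - s)) * (\<integral>\<^sup>+y. ennreal \<bar>w r y\<bar> * wgt s y \<partial>lborel)" by simp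
    qed
  qed
  have W0: "AE t in lborel. t \<in> {0<..<T} \<longrightarrow> ennreal \<bar>corr f t 0\<bar> \<le> ennreal (C / (1 - s) / subc s * \<delta> powr (1 - s)) * M" if \<delta>: "0 < \<delta>" "\<delta> \<le> 1" for \<delta>
  proof -
    have "AE t in lborel. t \<in> {0<..<T} \<longrightarrow> ennreal \<bar>corr f t 0\<bar> \<le> (\<integral>\<^sup>+r. indicator {0<..<t} r * ennreal (exp (- (\<delta> powr (- s) / s / subc s * (t - r)))) * src f \<delta> C r 0 \<partial>lborel)"
      by (rule corr_bound[OF f \<delta> C(1)]) (rule C(3))
    then show ?thesis
    proof eventually_elim
      case (elim t)
      show ?case
      proof
        assume t: "t \<in> {0<..<T}"
        with elim have "ennreal \<bar>corr f t 0\<bar> \<le> (\<integral>\<^sup>+r. indicator {0<..<t} r * ennreal (exp (- (\<delta> powr (- s) / s / subc s * (t - r)))) * src f \<delta> C r 0 \<partial>lborel)" by blast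
        also have "\<dots> \<le> (\<integral>\<^sup>+r. ennreal (C / (1 - s) / subc s * \<delta> powr (1 - s)) * (\<integral>\<^sup>+y. ennreal \<bar>w r y\<bar> * wgt s y \<partial>lborel) \<partial>lborel)"
        proof (rule nn_integral_mono_AE)
          show "AE r in lborel. indicator {0<..<t} r * ennreal (exp (- (\<delta> powr (- s) / s / subc s * (t - r)))) * src f \<delta> C r 0
              \<le> ennreal (C / (1 - s) / subc s * \<delta> powr (1 - s)) * (\<integral>\<^sup>+y. ennreal \<bar>w r y\<bar> * wgt s y \<partial>lborel)"
            using Q0[OF \<delta>(1)]
          proof eventually_elim
            case (elim r)
            show ?case
            proof (cases "r \<in> {0<..<t}")
              case True
              have "ennreal (exp (- (\<delta> powr (- s) / s / subc s * (t - r)))) \<le> 1"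
                using True s c by (simp add: ennreal_le_1)
              then have "indicator {0<..<t} r * ennreal (exp (- (\<delta> powr (- s) / s / subc s * (t - r)))) * src f \<delta> C r 0 \<le> 1 * src f \<delta> C r 0"
                using True by (intro mult_right_mono) auto
              also have "\<dots> \<le> ennreal (C / (1 - s) / subc s * \<delta> powr (1 - s)) * (\<integral>\<^sup>+y. ennreal \<bar>w r y\<bar> * wgt s y \<partial>lborel)"
                using elim True t by auto
              finally show ?thesis .
            qed simp
          qed
        qed
        also have "\<dots> = ennreal (C / (1 - s) / subc s * \<delta> powr (1 - s)) * M"
          unfolding M_def by (rule nn_integral_cmult) measurable
        finally show "ennreal \<bar>corr f t 0\<bar> \<le> ennreal (C / (1 - s) / subc s * \<delta> powr (1 - s)) * M" .
      qed
    qed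
  qed
  \<comment> \<open>The null set in \<open>W0\<close> depends on \<delta>; the sequence \<delta> = 1
    / (n + 1) needs only countably many of them.\<close>
  have "AE t in lborel. \<forall>n::nat. t \<in> {0<..<T} \<longrightarrow> ennreal \<bar>corr f t 0\<bar> \<le> ennreal (C / (1 - s) / subc s * (1 / real (Suc n)) powr (1 - s)) * M"
    unfolding AE_all_countable by (intro allI W0) auto
  then show ?thesis
  proof eventually_elim
    case (elim t)
    show ?case
    proof
      assume "t \<in> {0<..<T}"
      with elim have le: "ennreal \<bar>corr f t 0\<bar> \<le> ennreal (C / (1 - s) / subc s * (1 / real (Suc n)) powr (1 - s)) * M" for n by blast
      have "ennreal \<bar>corr f t 0\<bar> = 0"
        by (rule ennreal_zero_of_small[OF s(2) _ M le]) (use C(1) s c in auto)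
      then show "(\<integral>y. w t y * tensor f y \<partial>lborel) = 0" by (simp add: corr_def)
    qed
  qed
qed

end

section \<open>Uniqueness\<close>

lemma frac_lap_cmult: "frac_lap s (\<lambda>y. c * g y) x = c * frac_lap s g x"
proof -
  have "fourier (\<lambda>y. c * g y) \<xi> = complex_of_real c * fourier g \<xi>" for \<xi>
  proof -
    have "fourier (\<lambda>y. c * g y) \<xi> = (\<integral>y. complex_of_real c * (cis (- (y \<bullet> \<xi>)) * complex_of_real (g y)) \<partial>lborel)"
      unfolding fourier_def by (simp add: ac_simps)
    then show ?thesis unfolding fourier_def by (simp only: integral_mult_right_zero)
  qed
  then have "(\<integral>\<xi>. cis (x \<bullet> \<xi>) * complex_of_real (norm \<xi> powr (2 * s)) * fourier (\<lambda>y. c * g y) \<xi> \<partial>lborel)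
      = (\<integral>\<xi>. complex_of_real c * (cis (x \<bullet> \<xi>) * complex_of_real (norm \<xi> powr (2 * s)) * fourier g \<xi>) \<partial>lborel)"
    by (simp add: ac_simps)
  also have "\<dots> = complex_of_real c * (\<integral>\<xi>. cis (x \<bullet> \<xi>) * complex_of_real (norm \<xi> powr (2 * s)) * fourier g \<xi> \<partial>lborel)"
    by (rule integral_mult_right_zero)
  finally show ?thesis
    unfolding frac_lap_def by (simp only: mult.left_commute[of _ "complex_of_real c"] Re_complex_of_real times_complex.sel Im_complex_of_real mult_zero_left diff_zero)
qed

lemma bumplike_bump:
  fixes a b :: "'a::euclidean_space"
  assumes "c > 0" shows "bumplike (\<lambda>i. bump c (a \<bullet> i) (b \<bullet> i))"
proof -
  have "bump c (a \<bullet> i) (b \<bullet> i) t = 0" if i: "i \<in> Basis" and t: "t \<notin> {- (norm a + norm b)..norm a + norm b}" for i :: 'a and t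
    using Basis_le_norm[OF i, of a] Basis_le_norm[OF i, of b] t norm_ge_zero[of a] norm_ge_zero[of b]
    unfolding bump_eq_0_iff by auto
  then show ?thesis
    unfolding bumplike_def using assms
    by (auto simp: smooth1_bump bump_nonneg intro!: exI[of _ "norm a + norm b"])
qed

text \<open>The weight is bounded below on balls, so integrability against it yields integrability
  of the difference of two solutions over (0, T) times a bounded box.\<close>

lemma one_le_wgt:
  assumes s: "0 < s" "s < 1"
  shows "\<exists>C\<ge>0. \<forall>x::'a::euclidean_space. norm x \<le> R \<longrightarrow> 1 \<le> ennreal C * wgt s x"
proof -
  obtain C where C: "C \<ge> 0" "\<And>x::'a. ennreal (heat_ker 1 x) \<le> ennreal C * wgt s x" using heat_ker_le_wgt[of 1 s] s by auto
  define c where "c = (1 / sqrt (4 * pi)) ^ DIM('a) * exp (- (R\<^sup>2 / 4))"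
  have c: "c > 0" by (simp add: c_def)
  have "1 \<le> ennreal (1 / c * C) * wgt s x" if "norm x \<le> R" for x :: 'a
  proof -
    have "(norm x)\<^sup>2 \<le> R\<^sup>2" using that by (intro power_mono) auto
    then have "c \<le> heat_ker 1 x" by (simp add: heat_ker_eq c_def mult_left_mono)
    then have "ennreal c \<le> ennreal C * wgt s x" using C(2)[of x] by (meson ennreal_leI order_trans)
    then have "ennreal (1 / c) * ennreal c \<le> ennreal (1 / c) * (ennreal C * wgt s x)" by (intro mult_left_mono) auto
    moreover have "ennreal (1 / c) * ennreal c = 1" using c by (simp flip: ennreal_mult)
    moreover have "ennreal (1 / c * C) = ennreal (1 / c) * ennreal C" using c C(1) by (intro ennreal_mult) auto
    ultimately show ?thesis by (simp only: mult.assoc)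
  qed
  then show ?thesis using c C(1) by (intro exI[of _ "1 / c * C"]) auto
qed

lemma test_fun_tensor:
  fixes f :: "'a::euclidean_space \<Rightarrow> real \<Rightarrow> real"
  assumes f: "bumplike f" and \<theta>: "test1 T \<theta>"
  shows "test_fun_on ({0<..<T} \<times> (UNIV :: 'a set)) (\<lambda>z. \<theta> (fst z) * tensor f (snd z))"
proof -
  define F where "F = (\<lambda>b::real \<times> 'a. if b = (1, 0) then \<theta> else f (snd b))"
  have eq: "(\<lambda>z::real \<times> 'a. \<theta> (fst z) * tensor f (snd z)) = tensor F"
    unfolding F_def by (rule ext) (rule tensor_prod[symmetric])
  obtain R where R: "R \<ge> 0" "\<And>b t. b \<in> Basis \<Longrightarrow> t \<notin> {-R..R} \<Longrightarrow> f b t = 0" "\<And>b. b \<in> Basis \<Longrightarrow> smooth1 (f b)"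
    by (rule bumplike_props[OF f]) blast
  obtain a b where ab: "smooth1 \<theta>" "0 < a" "b < T" "\<And>t. t \<notin> {a..b} \<Longrightarrow> \<theta> t = 0" using \<theta> by (auto simp: test1_def)
  have Bas: "i = (1, 0) \<or> (\<exists>v\<in>Basis. i = (0, v))" if "i \<in> (Basis :: (real \<times> 'a) set)" for i
    using that by (auto simp: Basis_prod_def)
  have v0: "v \<noteq> 0" if "v \<in> (Basis :: 'a set)" for v using that by (metis nonzero_Basis)
  have sm: "smooth1 (F i)" if "i \<in> Basis" for i
    using Bas[OF that] ab(1) R(3) by (auto simp: F_def)
  define l r where "l = (a, - R *\<^sub>R (One :: 'a))" and "r = (b, R *\<^sub>R (One :: 'a))"
  have su: "F i t = 0" if i: "i \<in> Basis" and t: "t \<notin> {l \<bullet> i..r \<bullet> i}" for i t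
    using Bas[OF i] t ab(4) R(2) by (auto simp: F_def l_def r_def)
  have "cbox l r \<subseteq> {0<..<T} \<times> UNIV"
    using ab(2,3) by (auto simp: l_def r_def cbox_Pair_eq)
  moreover have "smooth_fun (tensor F)" by (rule smooth_fun_tensor) (rule sm)
  moreover have "tsupport (tensor F) \<subseteq> cbox l r" by (rule tsupport_tensor(1)) (rule su)
  moreover have "compact (tsupport (tensor F))" by (rule tsupport_tensor(2)[of l r]) (rule su)
  ultimately show ?thesis
    unfolding eq test_fun_on_def by blast
qed

lemma test1_bump:
  assumes "c > 0" "0 < a" "a \<le> b" "b < T" shows "test1 T (bump c a b)"
proof -
  have "\<forall>t. t \<notin> {a..b} \<longrightarrow> bump c a b t = 0" by (auto simp: bump_eq_0_iff)
  then show ?thesis unfolding test1_def using assms smooth1_bump by blast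
qed

text \<open>\<alpha> is bounded and vanishes outside (0, T), and k is dominated by the weight, hence
  by \<Phi>: the product is tested exactly in the class where \<open>u\<close> is
  integrable.\<close>

lemma solution_integrable:
  fixes u :: "real \<Rightarrow> 'a::euclidean_space \<Rightarrow> real"
  assumes u: "L1_L1Phi s T u" and s: "0 < s" "s < 1"
    and [measurable]: "\<alpha> \<in> borel_measurable borel" "k \<in> borel_measurable borel"
    and \<alpha>: "\<And>t. \<bar>\<alpha> t\<bar> \<le> A" "\<And>t. t \<notin> {0<..<T} \<Longrightarrow> \<alpha> t = 0"
    and k: "\<And>y. ennreal \<bar>k y\<bar> \<le> ennreal C * wgt s y" "C \<ge> 0"
  shows "integrable lborel (\<lambda>z. u (fst z) (snd z) * (\<alpha> (fst z) * k (snd z)))"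
proof -
  have um: "(\<lambda>z. u (fst z) (snd z)) \<in> borel_measurable (borel \<Otimes>\<^sub>M borel)"
    using u by (simp add: L1_L1Phi_def case_prod_beta' borel_prod)
  have [measurable]: "(\<lambda>z. u (fst z) (snd z)) \<in> borel_measurable borel" using um by (simp add: borel_prod)
  obtain D where D: "D \<ge> 0" "\<And>x::'a. wgt s x \<le> ennreal (D * Phi s x)" using wgt_le_Phi[OF s] by blast
  have A: "A \<ge> 0" using \<alpha>(1)[of 0] by linarith
  have kP: "\<bar>k y\<bar> \<le> C * D * Phi s y" for y
  proof -
    have "ennreal \<bar>k y\<bar> \<le> ennreal C * ennreal (D * Phi s y)" using k(1)[of y] D(2)[of y] by (meson mult_left_mono order_trans zero_le)
    also have "\<dots> = ennreal (C * (D * Phi s y))" using k(2) D(1) Phi_pos[of s y] by (intro ennreal_mult[symmetric]) auto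
    finally show ?thesis using k(2) D(1) Phi_pos[of s y] by (simp add: ennreal_le_iff mult.assoc)
  qed
  show ?thesis
  proof (rule integrableI_bounded)
    have [measurable]: "(\<lambda>z::real \<times> 'a. \<alpha> (fst z)) \<in> borel_measurable borel" "(\<lambda>z::real \<times> 'a. k (snd z)) \<in> borel_measurable borel"
      unfolding borel_prod[symmetric] by measurable
    show "(\<lambda>z. u (fst z) (snd z) * (\<alpha> (fst z) * k (snd z))) \<in> borel_measurable lborel" by measurable
    have [measurable]: "(\<lambda>z::real \<times> 'a. Phi s (snd z)) \<in> borel_measurable borel"
      unfolding Phi_def borel_prod[symmetric] by measurable
    have "(\<integral>\<^sup>+z. ennreal (norm (u (fst z) (snd z) * (\<alpha> (fst z) * k (snd z)))) \<partial>lborel)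
        \<le> (\<integral>\<^sup>+z. ennreal (A * (C * D)) * (indicator ({0<..<T} \<times> UNIV) z * ennreal (\<bar>u (fst z) (snd z)\<bar> * Phi s (snd z))) \<partial>lborel)"
    proof (rule nn_integral_mono)
      fix z :: "real \<times> 'a"
      show "ennreal (norm (u (fst z) (snd z) * (\<alpha> (fst z) * k (snd z)))) \<le> ennreal (A * (C * D)) * (indicator ({0<..<T} \<times> UNIV) z * ennreal (\<bar>u (fst z) (snd z)\<bar> * Phi s (snd z)))"
      proof (cases "fst z \<in> {0<..<T}")
        case True
        have "\<bar>\<alpha> (fst z)\<bar> * \<bar>k (snd z)\<bar> \<le> A * (C * D * Phi s (snd z))"
          using \<alpha>(1) kP A by (intro mult_mono) auto
        then have "\<bar>u (fst z) (snd z)\<bar> * (\<bar>\<alpha> (fst z)\<bar> * \<bar>k (snd z)\<bar>) \<le> \<bar>u (fst z) (snd z)\<bar> * (A * (C * D * Phi s (snd z)))"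
          by (intro mult_left_mono) auto
        then have "ennreal (norm (u (fst z) (snd z) * (\<alpha> (fst z) * k (snd z)))) \<le> ennreal ((A * (C * D)) * (\<bar>u (fst z) (snd z)\<bar> * Phi s (snd z)))"
          by (intro ennreal_leI) (simp add: abs_mult ac_simps)
        also have "\<dots> = ennreal (A * (C * D)) * ennreal (\<bar>u (fst z) (snd z)\<bar> * Phi s (snd z))"
          using A k(2) D(1) Phi_pos[of s "snd z"] by (intro ennreal_mult) auto
        finally show ?thesis using True by (simp add: indicator_def mem_Times_iff)
      qed (simp add: \<alpha>(2))
    qed
    also have "\<dots> = ennreal (A * (C * D)) * (\<integral>\<^sup>+z. indicator ({0<..<T} \<times> UNIV) z * ennreal (\<bar>u (fst z) (snd z)\<bar> * Phi s (snd z)) \<partial>lborel)"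
    proof (rule nn_integral_cmult)
      have [measurable]: "{0<..<T} \<times> (UNIV :: 'a set) \<in> sets borel" by (intro borel_open open_Times) auto
      show "(\<lambda>z. indicator ({0<..<T} \<times> UNIV) z * ennreal (\<bar>u (fst z) (snd z)\<bar> * Phi s (snd z))) \<in> borel_measurable lborel" by measurable
    qed
    also have "\<dots> < \<infinity>" using u by (simp add: L1_L1Phi_def ennreal_mult_less_top)
    finally show "(\<integral>\<^sup>+z. ennreal (norm (u (fst z) (snd z) * (\<alpha> (fst z) * k (snd z)))) \<partial>lborel) < \<infinity>" .
  qed
qed

lemma integral_product_split:
  fixes v :: "real \<Rightarrow> 'a::euclidean_space \<Rightarrow> real"
  assumes "integrable lborel (\<lambda>z. v (fst z) (snd z) * (\<alpha> (fst z) * k (snd z)))"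
  shows "(\<integral>z. v (fst z) (snd z) * (\<alpha> (fst z) * k (snd z)) \<partial>lborel) = (\<integral>t. (\<integral>y. v t y * k y \<partial>lborel) * \<alpha> t \<partial>lborel)"
proof -
  have i: "integrable (lborel \<Otimes>\<^sub>M lborel) (\<lambda>z. v (fst z) (snd z) * (\<alpha> (fst z) * k (snd z)))"
    using assms by (simp only: lborel_prod)
  have "(\<integral>z. v (fst z) (snd z) * (\<alpha> (fst z) * k (snd z)) \<partial>lborel) = (\<integral>t. (\<integral>y. v t y * (\<alpha> t * k y) \<partial>lborel) \<partial>lborel)"
    using lborel_pair.integral_fst'[OF i] by (simp add: lborel_prod)
  also have "\<dots> = (\<integral>t. (\<integral>y. (v t y * k y) * \<alpha> t \<partial>lborel) \<partial>lborel)" by (simp add: ac_simps)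
  finally show ?thesis by (simp only: integral_mult_left_zero)
qed

lemma weak_equation_nonneg:
  fixes u :: "real \<Rightarrow> 'a::euclidean_space \<Rightarrow> real"
  assumes u: "very_weak_solution s T u" and f: "bumplike f" and \<theta>: "test1 T \<theta>" "\<And>t. 0 \<le> \<theta> t"
  shows "(\<integral>z. u (fst z) (snd z) * (deriv \<theta> (fst z) * tensor f (snd z)) \<partial>lborel) =
    (\<integral>z. u (fst z) (snd z) * (\<theta> (fst z) * frac_lap s (tensor f) (snd z)) \<partial>lborel)"
proof -
  let ?\<psi> = "\<lambda>z::real \<times> 'a. \<theta> (fst z) * tensor f (snd z)"
  have sm: "smooth1 \<theta>" using \<theta>(1) by (simp add: test1_def)
  have "(\<integral>z. u (fst z) (snd z) * deriv (\<lambda>t. ?\<psi> (t, snd z)) (fst z) \<partial>lborel)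
        = (\<integral>z. u (fst z) (snd z) * frac_lap s (\<lambda>y. ?\<psi> (fst z, y)) (snd z) \<partial>lborel)"
  proof -
    have nn: "\<forall>z. 0 \<le> ?\<psi> z" using \<theta>(2) bumplike_nonneg[OF f] by simp
    show ?thesis
      by (rule mp[OF mp[OF spec[OF conjunct2[OF u[unfolded very_weak_solution_def]], of ?\<psi>] test_fun_tensor[OF f \<theta>(1)]] nn])
  qed
  moreover have "deriv (\<lambda>t. ?\<psi> (t, snd z)) (fst z) = deriv \<theta> (fst z) * tensor f (snd z)" for z :: "real \<times> 'a"
    using DERIV_cmult_right[OF smooth1_deriv(1)[OF sm], of "tensor f (snd z)"] by (auto intro!: DERIV_imp_deriv)
  ultimately show ?thesis by (simp add: frac_lap_cmult)
qed

text \<open>The weak formulation only admits nonnegative test functions.\<close>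

lemma test1_positive_shift:
  assumes "test1 T \<theta>"
  obtains M \<eta> where "test1 T \<eta>" "\<And>t. 0 \<le> \<eta> t" "\<And>t. 0 \<le> \<theta> t + M * \<eta> t" "test1 T (\<lambda>t. \<theta> t + M * \<eta> t)"
proof -
  obtain a b where ab: "smooth1 \<theta>" "0 < a" "a \<le> b" "b < T" "\<And>t. t \<notin> {a..b} \<Longrightarrow> \<theta> t = 0"
    using assms by (auto simp: test1_def)
  define \<eta> where "\<eta> = bump 1 (a / 2) ((b + T) / 2)"
  have \<eta>: "test1 T \<eta>" unfolding \<eta>_def by (rule test1_bump) (use ab in auto)
  have sm: "smooth1 \<eta>" unfolding \<eta>_def by (rule smooth1_bump) simp
  obtain t0 where t0: "t0 \<in> {a..b}" "\<And>t. t \<in> {a..b} \<Longrightarrow> \<eta> t0 \<le> \<eta> t"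
    using continuous_attains_inf[of "{a..b}" \<eta>] smooth1_continuous[OF sm] ab(3) by auto
  have nn: "0 \<le> \<eta> t" for t by (simp add: \<eta>_def bump_nonneg)
  have "\<eta> t0 \<noteq> 0" unfolding \<eta>_def bump_eq_0_iff using t0(1) ab by auto
  then have p: "\<eta> t0 > 0" using nn[of t0] by linarith
  obtain B where B: "B \<ge> 0" "\<And>t. \<bar>\<theta> t\<bar> \<le> B" using test1_props(3)[OF assms] by blast
  define M where "M = B / \<eta> t0"
  have M: "M \<ge> 0" using B p by (simp add: M_def)
  have pos: "0 \<le> \<theta> t + M * \<eta> t" for t
  proof (cases "t \<in> {a..b}")
    case True
    have "B = M * \<eta> t0" using p by (simp add: M_def)
    also have "\<dots> \<le> M * \<eta> t" using t0(2)[OF True] M by (intro mult_left_mono) auto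
    finally show ?thesis using B(2)[of t] by linarith
  next
    case False
    then show ?thesis using ab(5)[OF False] M nn[of t] by simp
  qed
  have "test1 T (\<lambda>t. \<theta> t + M * \<eta> t)"
    unfolding test1_def
  proof (intro conjI exI)
    show "smooth1 (\<lambda>t. \<theta> t + M * \<eta> t)" by (intro smooth1_add smooth1_mult smooth1_const ab sm)
    show "0 < a / 2" "a / 2 \<le> (b + T) / 2" "(b + T) / 2 < T" using ab by auto
    show "\<forall>t. t \<notin> {a / 2..(b + T) / 2} \<longrightarrow> \<theta> t + M * \<eta> t = 0"
    proof (intro allI impI)
      fix t assume t: "t \<notin> {a / 2..(b + T) / 2}"
      have "\<theta> t = 0" using t ab by (intro ab(5)) auto
      moreover have "\<eta> t = 0" unfolding \<eta>_def bump_eq_0_iff using t by auto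
      ultimately show "\<theta> t + M * \<eta> t = 0" by simp
    qed
  qed
  then show ?thesis using that \<eta> nn pos by blast
qed

theorem theorem5p1:
  fixes s T :: real
    and \<mu>0 :: "'a::euclidean_space measure"
    and u1 u2 :: "real \<Rightarrow> 'a \<Rightarrow> real"
  assumes "0 < s" "s < 1" "0 < T"
    and "Mplus_s s \<mu>0"
    and "very_weak_solution s T u1" "very_weak_solution s T u2"
    and "AE z in (lborel :: (real \<times> 'a) measure). fst z \<in> {0<..<T} \<longrightarrow> 0 \<le> u1 (fst z) (snd z)"
    and "AE z in (lborel :: (real \<times> 'a) measure). fst z \<in> {0<..<T} \<longrightarrow> 0 \<le> u2 (fst z) (snd z)"
    and "has_initial_trace s T u1 \<mu>0" "has_initial_trace s T u2 \<mu>0"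
  shows "AE z in (lborel :: (real \<times> 'a) measure).
           fst z \<in> {0<..<T} \<longrightarrow> u1 (fst z) (snd z) = u2 (fst z) (snd z)"
proof -
  note s = assms(1,2) and T = assms(3) and sol = assms(5,6) and tr = assms(9,10)
  have L: "L1_L1Phi s T u1" "L1_L1Phi s T u2" using tr by (auto simp: has_initial_trace_def)
  \<comment> \<open>Set to zero outside (0, T), since integrability is assumed only there.\<close>
  define w where "w = (\<lambda>t (x::'a). if t \<in> {0<..<T} then u1 t x - u2 t x else 0)"
  have um[measurable]: "(\<lambda>z. u1 (fst z) (snd z)) \<in> borel_measurable (borel \<Otimes>\<^sub>M borel)"
    "(\<lambda>z. u2 (fst z) (snd z)) \<in> borel_measurable (borel \<Otimes>\<^sub>M borel)"
    using L by (simp_all add: L1_L1Phi_def case_prod_beta' borel_prod)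
  have wm: "(\<lambda>z. w (fst z) (snd z)) \<in> borel_measurable (borel \<Otimes>\<^sub>M borel)"
    unfolding w_def by measurable
  have w_int: "integrable lborel (\<lambda>z. w (fst z) (snd z) * (\<alpha> (fst z) * k (snd z)))"
      "(\<integral>z. w (fst z) (snd z) * (\<alpha> (fst z) * k (snd z)) \<partial>lborel) =
        (\<integral>z. u1 (fst z) (snd z) * (\<alpha> (fst z) * k (snd z)) \<partial>lborel) - (\<integral>z. u2 (fst z) (snd z) * (\<alpha> (fst z) * k (snd z)) \<partial>lborel)"
    if "\<alpha> \<in> borel_measurable borel" "k \<in> borel_measurable borel" "\<And>t. \<bar>\<alpha> t\<bar> \<le> A" "\<And>t. t \<notin> {0<..<T} \<Longrightarrow> \<alpha> t = 0"
      "\<And>y. ennreal \<bar>k y\<bar> \<le> ennreal C * wgt s y" "C \<ge> 0" for \<alpha> and k :: "'a \<Rightarrow> real" and A C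
  proof -
    note i = solution_integrable[OF L(1) s that] solution_integrable[OF L(2) s that]
    have e: "w (fst z) (snd z) * (\<alpha> (fst z) * k (snd z)) = u1 (fst z) (snd z) * (\<alpha> (fst z) * k (snd z)) - u2 (fst z) (snd z) * (\<alpha> (fst z) * k (snd z))" for z
      using that(4)[of "fst z"] by (auto simp: w_def algebra_simps)
    show "integrable lborel (\<lambda>z. w (fst z) (snd z) * (\<alpha> (fst z) * k (snd z)))" unfolding e using i by auto
    show "(\<integral>z. w (fst z) (snd z) * (\<alpha> (fst z) * k (snd z)) \<partial>lborel) =
        (\<integral>z. u1 (fst z) (snd z) * (\<alpha> (fst z) * k (snd z)) \<partial>lborel) - (\<integral>z. u2 (fst z) (snd z) * (\<alpha> (fst z) * k (snd z)) \<partial>lborel)"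
      unfolding e using i by simp
  qed
  have gC: "\<exists>C\<ge>0. \<forall>y. ennreal \<bar>tensor f y\<bar> \<le> ennreal C * wgt s y" if "bumplike f" for f :: "'a \<Rightarrow> real \<Rightarrow> real"
    using bumplike_wgt[OF that s] bumplike_nonneg[OF that] by auto
  have fin: "(\<integral>\<^sup>+t. (\<integral>\<^sup>+y. ennreal \<bar>w t y\<bar> * wgt s y \<partial>lborel) \<partial>lborel) < \<top>"
  proof -
    have [measurable]: "(\<lambda>z. w (fst z) (snd z)) \<in> borel_measurable (lborel \<Otimes>\<^sub>M lborel)"
      using wm by simp
    have zf: "ennreal (enn2real (wgt s y)) = wgt s y" for y :: 'a using wgt_finite[OF s, of y] by simp
    have "integrable lborel (\<lambda>z. w (fst z) (snd z) * (indicator {0<..<T} (fst z) * enn2real (wgt s (snd z))))"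
      by (rule w_int(1)[of _ _ 1 1]) (auto simp: indicator_def zf)
    then have "(\<integral>\<^sup>+z. ennreal (norm (w (fst z) (snd z) * (indicator {0<..<T} (fst z) * enn2real (wgt s (snd z))))) \<partial>(lborel \<Otimes>\<^sub>M lborel)) < \<infinity>"
      unfolding integrable_iff_bounded lborel_prod by blast
    also have "(\<integral>\<^sup>+z. ennreal (norm (w (fst z) (snd z) * (indicator {0<..<T} (fst z) * enn2real (wgt s (snd z))))) \<partial>(lborel \<Otimes>\<^sub>M lborel))
        = (\<integral>\<^sup>+z. ennreal \<bar>w (fst z) (snd z)\<bar> * wgt s (snd z) \<partial>(lborel \<Otimes>\<^sub>M lborel))"
    proof (rule nn_integral_cong)
      fix z :: "real \<times> 'a"
      have "norm (w (fst z) (snd z) * (indicator {0<..<T} (fst z) * enn2real (wgt s (snd z)))) = \<bar>w (fst z) (snd z)\<bar> * enn2real (wgt s (snd z))"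
        by (auto simp: w_def abs_mult indicator_def)
      then show "ennreal (norm (w (fst z) (snd z) * (indicator {0<..<T} (fst z) * enn2real (wgt s (snd z))))) = ennreal \<bar>w (fst z) (snd z)\<bar> * wgt s (snd z)"
        by (simp add: ennreal_mult zf)
    qed
    also have "\<dots> = (\<integral>\<^sup>+t. (\<integral>\<^sup>+y. ennreal \<bar>w t y\<bar> * wgt s y \<partial>lborel) \<partial>lborel)"
      by (subst lborel.nn_integral_fst[symmetric]) auto
    finally show ?thesis by simp
  qed
  have slice: "integrable lborel (\<lambda>t. \<integral>y. w t y * k y \<partial>lborel)"
    if [measurable]: "k \<in> borel_measurable borel" and k: "\<And>y. ennreal \<bar>k y\<bar> \<le> ennreal C * wgt s y" "C \<ge> 0" for k :: "'a \<Rightarrow> real" and C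
  proof -
    have "integrable lborel (\<lambda>z. w (fst z) (snd z) * (indicator {0<..<T} (fst z) * k (snd z)))"
      using k by (intro w_int(1)[of _ _ 1 C]) (auto simp: indicator_def)
    from lborel_pair.integrable_fst'[OF this[folded lborel_prod]]
    have "integrable lborel (\<lambda>t. \<integral>y. w t y * (indicator {0<..<T} t * k y) \<partial>lborel)" by simp
    moreover have "w t y * (indicator {0<..<T} t * k y) = w t y * k y" for t y by (auto simp: w_def)
    ultimately show ?thesis by simp
  qed
  interpret zero_trace_solution w s T
  proof
    show "0 < s" "s < 1" "0 < T" by fact+
    show "(\<lambda>z. w (fst z) (snd z)) \<in> borel_measurable (borel \<Otimes>\<^sub>M borel)" by (rule wm)
    show "(\<integral>\<^sup>+t. (\<integral>\<^sup>+y. ennreal \<bar>w t y\<bar> * wgt s y \<partial>lborel) \<partial>lborel) < \<top>" by (rule fin)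
  next
    fix f :: "'a \<Rightarrow> real \<Rightarrow> real" and \<theta> assume f: "bumplike f" and th: "test1 T \<theta>"
    note [measurable] = bumplike_measurable[OF f] frac_lap_measurable[OF bumplike_measurable[OF f]]
    obtain C1 where C1: "C1 \<ge> 0" "\<And>y. ennreal \<bar>tensor f y\<bar> \<le> ennreal C1 * wgt s y" using gC[OF f] by blast
    obtain C2 where C2: "C2 \<ge> 0" "\<And>y. ennreal \<bar>frac_lap s (tensor f) y\<bar> \<le> ennreal C2 * wgt s y"
      using frac_lap_wgt_bound[OF f s] by blast
    let ?F = "\<lambda>t. \<integral>y. w t y * tensor f y \<partial>lborel" and ?H = "\<lambda>t. \<integral>y. w t y * frac_lap s (tensor f) y \<partial>lborel"
    have Fi: "integrable lborel ?F" by (rule slice[OF _ C1(2,1)]) measurable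
    have Hi: "integrable lborel ?H" by (rule slice[OF _ C2(2,1)]) measurable
    have nonneg: "(\<integral>t. ?F t * deriv \<theta> t \<partial>lborel) = (\<integral>t. ?H t * \<theta> t \<partial>lborel)" if th: "test1 T \<theta>" and nn: "\<And>t. 0 \<le> \<theta> t" for \<theta>
    proof -
      have sm: "smooth1 \<theta>" using th by (simp add: test1_def)
      note p = test1_props[OF th]
      obtain A1 where A1: "\<And>t. \<bar>\<theta> t\<bar> \<le> A1" using p(3) by blast
      obtain A2 where A2: "\<And>t. \<bar>deriv \<theta> t\<bar> \<le> A2" using p(4) by blast
      note m = smooth1_measurable[OF sm] smooth1_measurable[OF smooth1_deriv(2)[OF sm]]
      have i1: "integrable lborel (\<lambda>z. w (fst z) (snd z) * (deriv \<theta> (fst z) * tensor f (snd z)))"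
        and e1: "(\<integral>z. w (fst z) (snd z) * (deriv \<theta> (fst z) * tensor f (snd z)) \<partial>lborel) =
          (\<integral>z. u1 (fst z) (snd z) * (deriv \<theta> (fst z) * tensor f (snd z)) \<partial>lborel) - (\<integral>z. u2 (fst z) (snd z) * (deriv \<theta> (fst z) * tensor f (snd z)) \<partial>lborel)"
        by (rule w_int[OF m(2) bumplike_measurable[OF f] A2 p(6) C1(2,1)], simp)+
      have i2: "integrable lborel (\<lambda>z. w (fst z) (snd z) * (\<theta> (fst z) * frac_lap s (tensor f) (snd z)))"
        and e2: "(\<integral>z. w (fst z) (snd z) * (\<theta> (fst z) * frac_lap s (tensor f) (snd z)) \<partial>lborel) =
          (\<integral>z. u1 (fst z) (snd z) * (\<theta> (fst z) * frac_lap s (tensor f) (snd z)) \<partial>lborel) - (\<integral>z. u2 (fst z) (snd z) * (\<theta> (fst z) * frac_lap s (tensor f) (snd z)) \<partial>lborel)"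
        by (rule w_int[OF m(1) frac_lap_measurable[OF bumplike_measurable[OF f]] A1 p(5) C2(2,1)], simp)+
      have "(\<integral>t. ?F t * deriv \<theta> t \<partial>lborel) = (\<integral>z. w (fst z) (snd z) * (deriv \<theta> (fst z) * tensor f (snd z)) \<partial>lborel)"
        by (rule integral_product_split[OF i1, symmetric])
      also have "\<dots> = (\<integral>z. w (fst z) (snd z) * (\<theta> (fst z) * frac_lap s (tensor f) (snd z)) \<partial>lborel)"
        unfolding e1 e2 weak_equation_nonneg[OF sol(1) f th nn] weak_equation_nonneg[OF sol(2) f th nn] ..
      also have "\<dots> = (\<integral>t. ?H t * \<theta> t \<partial>lborel)" by (rule integral_product_split[OF i2])
      finally show ?thesis .
    qed
    \<comment> \<open>\<theta> is \<theta> + M \<eta> minus M times \<eta>, where \<theta> + M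
      \<eta> and \<eta> are nonnegative test functions; linearity carries the equation over to
      \<theta>.\<close>
    obtain M \<eta> where \<eta>: "test1 T \<eta>" "\<And>t. 0 \<le> \<eta> t" "\<And>t. 0 \<le> \<theta> t + M * \<eta> t" "test1 T (\<lambda>t. \<theta> t + M * \<eta> t)"
      using test1_positive_shift[OF th] by metis
    have sm: "smooth1 \<theta>" "smooth1 \<eta>" using th \<eta>(1) by (auto simp: test1_def)
    have bi: "integrable lborel (\<lambda>t. g t * h t)" if g: "integrable lborel g" and h: "smooth1 h" "\<exists>M\<ge>0. \<forall>t. \<bar>h t\<bar> \<le> M" for g h :: "real \<Rightarrow> real"
    proof -
      obtain B where B: "B \<ge> 0" "\<And>t. \<bar>h t\<bar> \<le> B" using h(2) by blast
      show ?thesis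
      proof (rule Bochner_Integration.integrable_bound[of _ "\<lambda>t. g t * B"])
        show "AE t in lborel. norm (g t * h t) \<le> norm (g t * B)"
          using B by (auto simp: abs_mult intro!: mult_left_mono)
        show "(\<lambda>t. g t * h t) \<in> borel_measurable lborel"
          using g smooth1_measurable[OF h(1)] by (auto simp: borel_measurable_integrable)
      qed (use g in auto)
    qed
    note tp = test1_props(3,4)[OF th] and cp = test1_props(3,4)[OF \<eta>(1)]
    have d: "deriv (\<lambda>t. \<theta> t + M * \<eta> t) t = deriv \<theta> t + M * deriv \<eta> t" for t
      by (rule DERIV_imp_deriv) (intro DERIV_add DERIV_cmult smooth1_deriv sm)
    have "(\<integral>t. ?F t * deriv \<theta> t \<partial>lborel) + M * (\<integral>t. ?F t * deriv \<eta> t \<partial>lborel) = (\<integral>t. ?F t * deriv \<theta> t + M * (?F t * deriv \<eta> t) \<partial>lborel)"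
      using bi[OF Fi smooth1_deriv(2)[OF sm(1)] tp(2)] bi[OF Fi smooth1_deriv(2)[OF sm(2)] cp(2)] by simp
    also have "\<dots> = (\<integral>t. ?F t * deriv (\<lambda>t. \<theta> t + M * \<eta> t) t \<partial>lborel)" unfolding d by (simp add: algebra_simps)
    also have "\<dots> = (\<integral>t. ?H t * (\<theta> t + M * \<eta> t) \<partial>lborel)" by (rule nonneg[OF \<eta>(4,3)])
    also have "\<dots> = (\<integral>t. ?H t * \<theta> t + M * (?H t * \<eta> t) \<partial>lborel)" by (simp add: algebra_simps)
    also have "\<dots> = (\<integral>t. ?H t * \<theta> t \<partial>lborel) + M * (\<integral>t. ?H t * \<eta> t \<partial>lborel)"
      using bi[OF Hi sm(1) tp(1)] bi[OF Hi sm(2) cp(1)] by simp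
    finally show "(\<integral>t. ?F t * deriv \<theta> t \<partial>lborel) = (\<integral>t. ?H t * \<theta> t \<partial>lborel)"
      using nonneg[OF \<eta>(1,2)] by simp
  next
    fix f :: "'a \<Rightarrow> real \<Rightarrow> real" assume f: "bumplike f"
    note [measurable] = bumplike_measurable[OF f]
    obtain C1 where C1: "C1 \<ge> 0" "\<And>y. ennreal \<bar>tensor f y\<bar> \<le> ennreal C1 * wgt s y" using gC[OF f] by blast
    obtain R where R: "R \<ge> 0" "\<And>b t. b \<in> Basis \<Longrightarrow> t \<notin> {-R..R} \<Longrightarrow> f b t = 0" "\<And>b. b \<in> Basis \<Longrightarrow> smooth1 (f b)"
      by (rule bumplike_props[OF f]) blast
    have ct: "continuous_on UNIV (tensor f)" by (intro continuous_on_tensor smooth1_continuous R(3))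
    have cs: "compact (tsupport (tensor f))"
      by (rule tsupport_tensor(2)[of "- R *\<^sub>R One" "R *\<^sub>R One"]) (use R(2) in auto)
    obtain E1 where E1: "E1 \<in> null_sets lborel" "((\<lambda>t. \<integral>x. u1 t x * tensor f x \<partial>lborel) \<longlongrightarrow> (\<integral>x. tensor f x \<partial>\<mu>0)) (at 0 within ({0<..} - E1))"
      using tr(1) ct cs unfolding has_initial_trace_def by blast
    obtain E2 where E2: "E2 \<in> null_sets lborel" "((\<lambda>t. \<integral>x. u2 t x * tensor f x \<partial>lborel) \<longlongrightarrow> (\<integral>x. tensor f x \<partial>\<mu>0)) (at 0 within ({0<..} - E2))"
      using tr(2) ct cs unfolding has_initial_trace_def by blast
    have AEi: "AE t in lborel. t \<in> {0<..<T} \<longrightarrow> integrable lborel (\<lambda>y. u t y * tensor f y)" if "L1_L1Phi s T u" for u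
    proof -
      have "integrable lborel (\<lambda>z. u (fst z) (snd z) * (indicator {0<..<T} (fst z) * tensor f (snd z)))"
        using C1 by (intro solution_integrable[OF that s, of _ _ 1 C1]) (auto simp: indicator_def)
      from lborel_pair.AE_integrable_fst'[OF this[folded lborel_prod]]
      show ?thesis by eventually_elim auto
    qed
    \<comment> \<open>At times where a slice is not integrable, its Bochner integral has the default
      value 0, and the integral of the difference need not be the difference of the integrals. These
      times form a null set, which joins the exceptional sets of the two traces.\<close>
    obtain N where N: "{t. \<not> (t \<in> {0<..<T} \<longrightarrow> integrable lborel (\<lambda>y. u1 t y * tensor f y) \<and> integrable lborel (\<lambda>y. u2 t y * tensor f y))} \<subseteq> N"
        "N \<in> null_sets lborel"
    proof -
      have "AE t in lborel. t \<in> {0<..<T} \<longrightarrow> integrable lborel (\<lambda>y. u1 t y * tensor f y) \<and> integrable lborel (\<lambda>y. u2 t y * tensor f y)"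
        using AEi[OF L(1)] AEi[OF L(2)] by eventually_elim auto
      then show ?thesis using that unfolding eventually_ae_filter by auto
    qed
    define E where "E = E1 \<union> E2 \<union> N"
    have "E \<in> null_sets lborel" unfolding E_def using E1 E2 N by blast
    moreover have "((\<lambda>t. \<integral>y. w t y * tensor f y \<partial>lborel) \<longlongrightarrow> 0) (at 0 within ({0<..} - E))"
    proof (rule Lim_transform_eventually)
      have "((\<lambda>t. \<integral>x. u1 t x * tensor f x \<partial>lborel) \<longlongrightarrow> (\<integral>x. tensor f x \<partial>\<mu>0)) (at 0 within ({0<..} - E))"
        by (rule tendsto_within_subset[OF E1(2)]) (auto simp: E_def)
      moreover have "((\<lambda>t. \<integral>x. u2 t x * tensor f x \<partial>lborel) \<longlongrightarrow> (\<integral>x. tensor f x \<partial>\<mu>0)) (at 0 within ({0<..} - E))"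
        by (rule tendsto_within_subset[OF E2(2)]) (auto simp: E_def)
      ultimately have "((\<lambda>t. (\<integral>x. u1 t x * tensor f x \<partial>lborel) - (\<integral>x. u2 t x * tensor f x \<partial>lborel)) \<longlongrightarrow> (\<integral>x. tensor f x \<partial>\<mu>0) - (\<integral>x. tensor f x \<partial>\<mu>0)) (at 0 within ({0<..} - E))"
        by (rule tendsto_diff)
      then show "((\<lambda>t. (\<integral>x. u1 t x * tensor f x \<partial>lborel) - (\<integral>x. u2 t x * tensor f x \<partial>lborel)) \<longlongrightarrow> 0) (at 0 within ({0<..} - E))" by simp
      show "\<forall>\<^sub>F t in at 0 within ({0<..} - E). (\<integral>x. u1 t x * tensor f x \<partial>lborel) - (\<integral>x. u2 t x * tensor f x \<partial>lborel) = (\<integral>y. w t y * tensor f y \<partial>lborel)"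
        unfolding eventually_at
      proof (intro exI[of _ T] conjI ballI impI)
        fix t assume t: "t \<in> {0<..} - E" "t \<noteq> 0 \<and> dist t 0 < T"
        then have t': "t \<in> {0<..<T}" "t \<notin> N" by (auto simp: dist_real_def E_def)
        then have "integrable lborel (\<lambda>y. u1 t y * tensor f y)" "integrable lborel (\<lambda>y. u2 t y * tensor f y)" using N(1) by auto
        then have "(\<integral>x. u1 t x * tensor f x \<partial>lborel) - (\<integral>x. u2 t x * tensor f x \<partial>lborel) = (\<integral>y. u1 t y * tensor f y - u2 t y * tensor f y \<partial>lborel)" by simp
        also have "\<dots> = (\<integral>y. w t y * tensor f y \<partial>lborel)" using t' by (simp add: w_def algebra_simps)
        finally show "(\<integral>x. u1 t x * tensor f x \<partial>lborel) - (\<integral>x. u2 t x * tensor f x \<partial>lborel) = (\<integral>y. w t y * tensor f y \<partial>lborel)" .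
      qed (rule T)
    qed
    ultimately show "\<exists>E. E \<in> null_sets lborel \<and> ((\<lambda>t. \<integral>y. w t y * tensor f y \<partial>lborel) \<longlongrightarrow> 0) (at 0 within ({0<..} - E))" by blast
  qed
  \<comment> \<open>A space-time bump is a product \<theta>(t) g(x), so \<open>corr_zero_AE\<close>
    annihilates its pairing with \<open>w\<close> after integration in t. The boxes (0, T) x (-n,
    n)^N exhaust the domain.\<close>
  have "AE z in (lborel :: (real \<times> 'a) measure). z \<in> box (0, - real n *\<^sub>R One) (T, real n *\<^sub>R One) \<longrightarrow>
      w (fst z) (snd z) * (indicator {0<..<T} (fst z) * indicator (box (- real n *\<^sub>R One) (real n *\<^sub>R One)) (snd z)) = 0" for n :: nat
  proof (rule AE_zero_of_bumps)
    let ?B = "box (- real n *\<^sub>R One) (real n *\<^sub>R One) :: 'a set"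
    obtain R where R: "\<And>x. x \<in> ?B \<Longrightarrow> norm x \<le> R" using bounded_box[of "- real n *\<^sub>R One :: 'a" "real n *\<^sub>R One"] unfolding bounded_iff by blast
    obtain C where C: "C \<ge> 0" "\<And>x::'a. norm x \<le> R \<Longrightarrow> 1 \<le> ennreal C * wgt s x" using one_le_wgt[OF s, of R] by blast
    have kC: "ennreal \<bar>indicator ?B y\<bar> \<le> ennreal C * wgt s y" for y using R C(2)[of y] by (auto simp: indicator_def)
    show "integrable lborel (\<lambda>z. w (fst z) (snd z) * (indicator {0<..<T} (fst z) * indicator ?B (snd z)))"
      by (rule w_int(1)[OF _ _ _ _ kC C(1), of _ 1]) (auto simp: indicator_def)
    fix c :: real and a b :: "real \<times> 'a" assume c: "c > 0" and ab: "box a b \<subseteq> box (0, - real n *\<^sub>R One) (T, real n *\<^sub>R One)" "box a b \<noteq> {}"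
    define f where "f = (\<lambda>i::'a. bump c (snd a \<bullet> i) (snd b \<bullet> i))"
    define \<theta> where "\<theta> = bump c (fst a) (fst b)"
    have f: "bumplike f" unfolding f_def by (rule bumplike_bump[OF c])
    note [measurable] = bumplike_measurable[OF f]
    have [measurable]: "\<theta> \<in> borel_measurable borel" unfolding \<theta>_def by measurable
    have te: "tensor (\<lambda>i. bump c (a \<bullet> i) (b \<bullet> i)) z = \<theta> (fst z) * tensor f (snd z)" for z :: "real \<times> 'a"
    proof -
      have "tensor (\<lambda>i. bump c (a \<bullet> i) (b \<bullet> i)) z = tensor (\<lambda>i. if i = (1, 0) then \<theta> else f (snd i)) z"
        unfolding tensor_def
        by (intro prod.cong refl) (auto simp: Basis_prod_def \<theta>_def f_def inner_prod_def)
      then show ?thesis by (simp only: tensor_prod)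
    qed
    have z0: "\<theta> (fst z) * tensor f (snd z) = 0" if "z \<notin> box a b" for z
    proof -
      from that obtain i where i: "i \<in> Basis" "z \<bullet> i \<notin> {a \<bullet> i<..<b \<bullet> i}" by (auto simp: mem_box)
      then have "tensor (\<lambda>i. bump c (a \<bullet> i) (b \<bullet> i)) z = 0"
        unfolding tensor_def using bump_eq_0_iff by (intro prod_zero) auto
      then show ?thesis by (simp only: te)
    qed
    \<comment> \<open>An inclusion of nonempty products passes to the factors, so the time interval
      of the bump lies in (0, T).\<close>
    have ab0: "0 \<le> fst a" "fst b \<le> T"
    proof -
      have "box a b = box (fst a) (fst b) \<times> box (snd a) (snd b)"
        "box (0, - real n *\<^sub>R One) (T, real n *\<^sub>R One) = box 0 T \<times> ?B"
        by (simp_all add: box_prod)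
      then have "{fst a<..<fst b} \<subseteq> {0<..<T}" "{fst a<..<fst b} \<noteq> {}" using ab by (auto simp: box_real times_subset_iff)
      then show "0 \<le> fst a" "fst b \<le> T" by (auto simp: greaterThanLessThan_subseteq_greaterThanLessThan)
    qed
    obtain C1 where C1: "C1 \<ge> 0" "\<And>y. ennreal \<bar>tensor f y\<bar> \<le> ennreal C1 * wgt s y" using gC[OF f] by blast
    have \<theta>0: "\<theta> t = 0" if "t \<notin> {0<..<T}" for t unfolding \<theta>_def bump_eq_0_iff using that ab0 by auto
    have \<theta>1: "\<bar>\<theta> t\<bar> \<le> 1" for t unfolding \<theta>_def using bump_nonneg bump_le_1[OF c] by simp
    have wi: "integrable lborel (\<lambda>z. w (fst z) (snd z) * (\<theta> (fst z) * tensor f (snd z)))"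
      by (rule w_int(1)[OF _ _ \<theta>1 \<theta>0 C1(2,1)]) auto
    have "(\<integral>z. tensor (\<lambda>i. bump c (a \<bullet> i) (b \<bullet> i)) z * (w (fst z) (snd z) * (indicator {0<..<T} (fst z) * indicator ?B (snd z))) \<partial>lborel)
        = (\<integral>z. w (fst z) (snd z) * (\<theta> (fst z) * tensor f (snd z)) \<partial>lborel)"
    proof (rule Bochner_Integration.integral_cong[OF refl])
      fix z :: "real \<times> 'a"
      show "tensor (\<lambda>i. bump c (a \<bullet> i) (b \<bullet> i)) z * (w (fst z) (snd z) * (indicator {0<..<T} (fst z) * indicator ?B (snd z))) = w (fst z) (snd z) * (\<theta> (fst z) * tensor f (snd z))"
      proof (cases "z \<in> box a b")
        case True
        then have "(fst z, snd z) \<in> box (0, - real n *\<^sub>R One) (T, real n *\<^sub>R One)" using ab(1) by auto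
        then have "fst z \<in> {0<..<T}" "snd z \<in> ?B" by (simp_all add: box_prod box_real mem_Times_iff)
        then show ?thesis unfolding te by simp
      qed (simp add: te z0)
    qed
    also have "\<dots> = (\<integral>t. (\<integral>y. w t y * tensor f y \<partial>lborel) * \<theta> t \<partial>lborel)" by (rule integral_product_split[OF wi])
    also have "\<dots> = (\<integral>t. 0 \<partial>(lborel :: real measure))"
    proof (rule integral_cong_AE)
      show "AE t in lborel. (\<integral>y. w t y * tensor f y \<partial>lborel) * \<theta> t = 0"
        using corr_zero_AE[OF f] by eventually_elim (use \<theta>0 in auto)
    qed (measurable)
    finally show "(\<integral>z. tensor (\<lambda>i. bump c (a \<bullet> i) (b \<bullet> i)) z * (w (fst z) (snd z) * (indicator {0<..<T} (fst z) * indicator ?B (snd z))) \<partial>lborel) = 0" by simp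
  qed
  then have "AE z in (lborel :: (real \<times> 'a) measure). \<forall>n::nat. z \<in> box (0, - real n *\<^sub>R One) (T, real n *\<^sub>R One) \<longrightarrow>
      w (fst z) (snd z) * (indicator {0<..<T} (fst z) * indicator (box (- real n *\<^sub>R One) (real n *\<^sub>R One)) (snd z)) = 0"
    unfolding AE_all_countable by (rule allI)
  then show ?thesis
  proof eventually_elim
    case (elim z)
    show ?case
    proof
      assume t: "fst z \<in> {0<..<T}"
      obtain n :: nat where n: "norm (snd z) < real n" using reals_Archimedean2 by blast
      have "\<bar>snd z \<bullet> i\<bar> < real n" if "i \<in> Basis" for i using Basis_le_norm[OF that, of "snd z"] n by linarith
      then have x: "snd z \<in> box (- real n *\<^sub>R One) (real n *\<^sub>R One)" by (auto simp: mem_box abs_less_iff minus_less_iff)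
      have "(fst z, snd z) \<in> box (0, - real n *\<^sub>R One) (T, real n *\<^sub>R One)"
        unfolding box_prod using t x by (simp add: box_real mem_Times_iff)
      with elim x t show "u1 (fst z) (snd z) = u2 (fst z) (snd z)" by (auto simp: w_def)
    qed
  qed
qed

end
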